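(* Let $d\ge 1$ and let $k$ be an algebraically closed field with $\mathrm{char}(k)=0$ or $\mathrm{char}(k)>d$. Let $\mathcal C$ be the category of finite-dimensional affine $k$-vector spaces with morphisms being affine maps, and let $\mathcal F_d$ be the contravariant functor on $\mathcal C$ given by $\mathcal F_d(V)=\{\text{polynomials on } V \text{ of degree} \le d\}$ (with an affine map $\phi:W\to V$ acting by $\phi^\star:\mathcal F_d(V)\to\mathcal F_d(W)$, $P\mapsto P\circ\phi$). Let $\mathcal G\subset\mathcal F_d$ be a proper subfunctor. Then there exists $r$ such that $r(P)\le r$ for any finite-dimensional $k$-vector space $V$ and any $P\in\mathcal G(V)$.
   Context: A subfunctor $\mathcal G\subset\mathcal F_d$ is a choice of subsets $\mathcal G(V)\subset\mathcal F_d(V)$ with $\phi^\star(\mathcal G(V))\subset\mathcal G(W)$ for every affine map $\phi:W\to V$ (no Zariski closedness is assumed); it is proper if $\mathcal G\ne\mathcal F_d$. For a polynomial $P$ on $V$, the rank $r(P)$ is the minimal number $r$ such that $P=\sum_{i=1}^rQ_iR_i$ with $Q_i,R_i$ polynomials over $k$ on $V$ of degrees strictly smaller than the degree of $P$.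
   Formalization: r(P) is bounded only for P of degree exactly d; for all P in G(V) the bound is on rank with factors of degree < d, as G=F_2, d=3 (quadratic forms) refutes the literal claim. The affine spaces are taken inside one infinite-dimensional space, an equivalent category. *)

theory Defs
  imports
    "HOL-Library.FuncSet"
    "HOL-Library.Extended_Nat"
    "HOL-Computational_Algebra.Polynomial"
begin

text \<open>
  The category of finite-dimensional affine spaces over a field \<open>'k\<close> is modelled by the
  finite-dimensional nonempty affine subspaces of an ambient \<open>'k\<close>-vector space on a type
  \<open>'v\<close> with scalar multiplication \<open>scale\<close>. As soon as the ambient space is
  infinite-dimensional, every finite-dimensional affine space is isomorphic to an object of
  this kind, and any set-sized family of finite-dimensional affine spaces can be realised
  inside a suitable ambient space.
\<close>

definition fin_affine_space ::
  "('k::field \<Rightarrow> 'v::ab_group_add \<Rightarrow> 'v) \<Rightarrow> 'v set \<Rightarrow> bool" where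
  "fin_affine_space scale V \<longleftrightarrow>
     (\<exists>p B. finite B \<and> V = (\<lambda>v. p + v) ` module.span scale B)"

text \<open>
  An affine map is a linear map followed by a translation. The linear part may be taken to be
  defined on the whole ambient space, because linear maps on a subspace extend.
\<close>

definition affine_map_on ::
  "('k::field \<Rightarrow> 'v::ab_group_add \<Rightarrow> 'v) \<Rightarrow> ('k \<Rightarrow> 'w::ab_group_add \<Rightarrow> 'w) \<Rightarrow> 'v set \<Rightarrow> ('v \<Rightarrow> 'w) \<Rightarrow> bool" where
  "affine_map_on s1 s2 W \<phi> \<longleftrightarrow>
     (\<exists>L c. Vector_Spaces.linear s1 s2 L \<and> (\<forall>x\<in>W. \<phi> x = L x + c))"

definition affine_morphisms ::
  "('k::field \<Rightarrow> 'v::ab_group_add \<Rightarrow> 'v) \<Rightarrow> 'v set \<Rightarrow> 'v set \<Rightarrow> ('v \<Rightarrow> 'v) set" where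
  "affine_morphisms scale W V = {\<phi> \<in> W \<rightarrow> V. affine_map_on scale scale W \<phi>}"

text \<open>
  Polynomials on \<open>V\<close> are taken to be functions, which is harmless since algebraically closed
  fields are infinite. Those of degree at most \<open>d\<close> are the linear combinations of products
  of at most \<open>d\<close> affine functions; no coordinates are chosen. Functions on \<open>V\<close> are made
  unique by requiring them to be \<^const>\<open>undefined\<close> outside \<open>V\<close>.
\<close>

definition polys_le ::
  "('k::field \<Rightarrow> 'v::ab_group_add \<Rightarrow> 'v) \<Rightarrow> nat \<Rightarrow> 'v set \<Rightarrow> ('v \<Rightarrow> 'k) set" where
  "polys_le scale d V = {P \<in> extensional V.
     \<exists>(n::nat) c ls.
       (\<forall>i<n. length (ls i) \<le> d \<and> (\<forall>l\<in>set (ls i). affine_map_on scale (*) V l)) \<and>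
       (\<forall>x\<in>V. P x = (\<Sum>i<n. c i * (\<Prod>l\<leftarrow>ls i. l x)))}"

definition polys ::
  "('k::field \<Rightarrow> 'v::ab_group_add \<Rightarrow> 'v) \<Rightarrow> 'v set \<Rightarrow> ('v \<Rightarrow> 'k) set" where
  "polys scale V = (\<Union>d. polys_le scale d V)"

text \<open>
  The degree of the zero polynomial is \<open>0\<close> here. This does not affect the ranks below: a zero
  factor contributes nothing to a sum of products, and the rank of zero is \<open>0\<close>.
\<close>

definition poly_degree ::
  "('k::field \<Rightarrow> 'v::ab_group_add \<Rightarrow> 'v) \<Rightarrow> 'v set \<Rightarrow> ('v \<Rightarrow> 'k) \<Rightarrow> nat" where
  "poly_degree scale V P = (LEAST d. P \<in> polys_le scale d V)"

text \<open>
  \<open>rank_below scale e V P\<close> is the least length of a decomposition of \<open>P\<close> into products of two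
  polynomials of degree \<open>< e\<close>, and \<open>\<infinity>\<close> if there is none. The rank \<open>r(P)\<close> is the case where
  \<open>e\<close> is the degree of \<open>P\<close>; for elements of the functor of polynomials of degree
  at most \<open>d\<close> one takes \<open>e = d\<close>, which is the same thing when the degree is exactly \<open>d\<close>.
  The distinction matters: for \<open>d = 3\<close> the polynomials of degree at most \<open>2\<close> form a proper
  subfunctor on which \<open>r(P)\<close> is unbounded, as quadratic forms have arbitrarily large rank.
\<close>

definition rank_below ::
  "('k::field \<Rightarrow> 'v::ab_group_add \<Rightarrow> 'v) \<Rightarrow> nat \<Rightarrow> 'v set \<Rightarrow> ('v \<Rightarrow> 'k) \<Rightarrow> enat" where
  "rank_below scale e V P = Inf {enat r | r. \<exists>Q R.
     (\<forall>i<r. Q i \<in> polys scale V \<and> poly_degree scale V (Q i) < e \<and>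
            R i \<in> polys scale V \<and> poly_degree scale V (R i) < e) \<and>
     (\<forall>x\<in>V. P x = (\<Sum>i<r. Q i x * R i x))}"

definition poly_rank ::
  "('k::field \<Rightarrow> 'v::ab_group_add \<Rightarrow> 'v) \<Rightarrow> 'v set \<Rightarrow> ('v \<Rightarrow> 'k) \<Rightarrow> enat" where
  "poly_rank scale V P = rank_below scale (poly_degree scale V P) V P"

text \<open>\<^term>\<open>compose W P \<phi>\<close> is the pullback of \<open>P\<close> along \<open>\<phi> : W \<rightarrow> V\<close>.\<close>

definition subfunctor ::
  "('k::field \<Rightarrow> 'v::ab_group_add \<Rightarrow> 'v) \<Rightarrow> nat \<Rightarrow> ('v set \<Rightarrow> ('v \<Rightarrow> 'k) set) \<Rightarrow> bool" where
  "subfunctor scale d G \<longleftrightarrow>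
     (\<forall>V. fin_affine_space scale V \<longrightarrow> G V \<subseteq> polys_le scale d V) \<and>
     (\<forall>V W \<phi> P. fin_affine_space scale V \<longrightarrow> fin_affine_space scale W \<longrightarrow>
        \<phi> \<in> affine_morphisms scale W V \<longrightarrow> P \<in> G V \<longrightarrow> compose W P \<phi> \<in> G W)"

definition proper_subfunctor ::
  "('k::field \<Rightarrow> 'v::ab_group_add \<Rightarrow> 'v) \<Rightarrow> nat \<Rightarrow> ('v set \<Rightarrow> ('v \<Rightarrow> 'k) set) \<Rightarrow> bool" where
  "proper_subfunctor scale d G \<longleftrightarrow> subfunctor scale d G \<and>
     (\<exists>V. fin_affine_space scale V \<and> G V \<noteq> polys_le scale d V)"

lemma affine_map_on_compose:
  assumes "affine_map_on s1 s2 W \<phi>" "\<phi> \<in> W \<rightarrow> V" "affine_map_on s2 s3 V l"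
  shows "affine_map_on s1 s3 W (\<lambda>x. l (\<phi> x))"
proof -
  obtain L c where L: "Vector_Spaces.linear s1 s2 L" "\<And>x. x \<in> W \<Longrightarrow> \<phi> x = L x + c"
    using assms(1) by (auto simp: affine_map_on_def)
  obtain M b where M: "Vector_Spaces.linear s2 s3 M" "\<And>x. x \<in> V \<Longrightarrow> l x = M x + b"
    using assms(3) by (auto simp: affine_map_on_def)
  have "l (\<phi> x) = (M \<circ> L) x + (M c + b)" if "x \<in> W" for x
  proof -
    have "\<phi> x \<in> V" using assms(2) that by (rule funcset_mem)
    then have "l (\<phi> x) = M (L x + c) + b" using L(2)[OF that] M(2) by metis
    also have "M (L x + c) = M (L x) + M c"
      using M(1) unfolding Vector_Spaces.linear_iff by blast
    finally show ?thesis by (simp add: add.assoc)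
  qed
  moreover have "Vector_Spaces.linear s1 s3 (M \<circ> L)"
    using Vector_Spaces.linear_compose[OF L(1) M(1)] .
  ultimately show ?thesis unfolding affine_map_on_def by blast
qed

lemma subfunctor_polys_le: "subfunctor scale d (polys_le scale d)"
  unfolding subfunctor_def
proof (intro conjI allI impI subset_refl)
  fix V W \<phi> and P :: "'b \<Rightarrow> 'a"
  assume \<phi>: "\<phi> \<in> affine_morphisms scale W V" and P: "P \<in> polys_le scale d V"
  obtain n :: nat and c ls where
    ls: "\<And>i. i < n \<Longrightarrow> length (ls i) \<le> d \<and> (\<forall>l\<in>set (ls i). affine_map_on scale (*) V l)"
    and eq: "\<And>x. x \<in> V \<Longrightarrow> P x = (\<Sum>i<n. c i * (\<Prod>l\<leftarrow>ls i. l x))"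
    using P unfolding polys_le_def by blast
  define ls' where "ls' i = map (\<lambda>l x. l (\<phi> x)) (ls i)" for i
  have "\<forall>i<n. length (ls' i) \<le> d \<and> (\<forall>l\<in>set (ls' i). affine_map_on scale (*) W l)"
  proof (intro allI impI conjI ballI)
    fix i assume i: "i < n"
    then show "length (ls' i) \<le> d" using ls[OF i] by (simp add: ls'_def)
    fix l' assume "l' \<in> set (ls' i)"
    then obtain l where l: "l \<in> set (ls i)" "l' = (\<lambda>x. l (\<phi> x))" by (auto simp: ls'_def)
    have \<phi>': "affine_map_on scale scale W \<phi>" "\<phi> \<in> W \<rightarrow> V"
      using \<phi> by (simp_all add: affine_morphisms_def)
    have "affine_map_on scale (*) V l" using ls[OF i] l(1) by blast
    then show "affine_map_on scale (*) W l'"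
      unfolding l(2) by (rule affine_map_on_compose[OF \<phi>'])
  qed
  moreover have "\<forall>x\<in>W. compose W P \<phi> x = (\<Sum>i<n. c i * (\<Prod>l\<leftarrow>ls' i. l x))"
  proof
    fix x assume x: "x \<in> W"
    then have "\<phi> x \<in> V" using \<phi> by (auto simp: affine_morphisms_def)
    then show "compose W P \<phi> x = (\<Sum>i<n. c i * (\<Prod>l\<leftarrow>ls' i. l x))"
      using eq x by (simp add: ls'_def compose_def o_def)
  qed
  moreover have "compose W P \<phi> \<in> extensional W"
    by (simp add: compose_def)
  ultimately show "compose W P \<phi> \<in> polys_le scale d W"
    unfolding polys_le_def by blast
qed

end

theory Submission
  imports
    Defs
    "HOL-Computational_Algebra.Formal_Laurent_Series"
    "HOL-Library.Function_Algebras"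
    "Jordan_Normal_Form.Determinant"
begin

text \<open>
  Let \<open>T\<close> be the part of degree \<open>d\<close> of a polynomial \<open>P\<close> of degree at most \<open>d\<close>. If \<open>T\<close> has large rank, then
  every polynomial of degree at most \<open>d\<close> in a fixed number of variables is a pullback of \<open>P\<close>, so \<open>P\<close>
  cannot lie in a proper subfunctor. First, if for all linear \<open>\<Phi> : k\<^sup>n \<rightarrow> V\<close> the differential of
  \<open>\<Phi> \<mapsto> T \<circ> \<Phi>\<close> fails to be surjective onto the forms of degree \<open>d\<close>, then expanding a bordered minor of
  this differential writes \<open>T\<close> as a sum of boundedly many products. Otherwise take \<open>\<Phi>\<close> with surjective
  differential. For \<open>n\<close> large, \<open>T \<circ> \<Phi>\<close> vanishes on a subspace of given dimension (Brauer's argument);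
  after restricting \<open>\<Phi>\<close> to it the differential is still surjective and \<open>T \<circ> \<Phi> = 0\<close>. Now
  \<open>t\<^sup>d P(x / t)\<close> is a deformation of \<open>T\<close>, and Hensel's lemma solves \<open>t\<^sup>d P((\<Phi> + \<dots>) / t) = t\<^sup>d q\<close> over
  \<open>k[[t]]\<close>, so \<open>q\<close> is a pullback of \<open>P\<close> over \<open>k((t))\<close>. Finally a \<open>k\<close>-homomorphism to \<open>k\<close> from the
  algebra generated by the finitely many coordinates of this solution makes \<open>q\<close> a pullback over \<open>k\<close>.
\<close>

text \<open>The subfunctor is not assumed closed, so obtaining \<open>q\<close> as a limit of
  pullbacks of \<open>P\<close> would not be enough: an exact pullback is needed. Rescaling by
  \<open>t\<close> makes the leading form \<open>T\<close> the special fibre of the equation to be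
  solved; the price is a solution over \<open>k((t))\<close>, which has to be specialized. At
  \<open>t = 0\<close> the equation reads \<open>T \<circ> \<Phi> = 0\<close>, because
  \<open>t^d q\<close> vanishes there. This is why a point with surjective differential does not
  suffice and an isotropic subspace is needed as well. Surjectivity survives the restriction because
  every form on the subspace extends to \<open>k^n\<close>. Affine maps are treated as linear maps
  in one more variable \<open>u 0\<close>, which is set to 1 at the end, so that every error term of
  the lifting is homogeneous of degree \<open>d\<close>. All dimensions depend only on
  \<open>d\<close> and on the number of variables of \<open>q\<close>, not on \<open>P\<close>; this
  makes the rank bound uniform. The characteristic enters through division by integers between 1 and
  \<open>d\<close>, in the polarization and in Euler's relation.\<close>

no_notation Matrix.vec_index (infixl "$" 100)

section \<open>Forms over a set of linear functions\<close>

text \<open>These are functions, not formal polynomials. If \<open>L\<close> consists of linear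
  functions, they are the homogeneous forms of degree \<open>b\<close>; if \<open>L\<close> also
  contains the constants, \<open>b\<close> becomes a mere upper bound for the degree. Zero has every
  degree.\<close>

inductive form :: "('a \<Rightarrow> 'k::comm_ring_1) set \<Rightarrow> nat \<Rightarrow> ('a \<Rightarrow> 'k) \<Rightarrow> bool"
  for L :: "('a \<Rightarrow> 'k::comm_ring_1) set" where
  form_const: "form L 0 (\<lambda>_. c)"
| form_zero: "form L b (\<lambda>_. 0)"
| form_add: "form L b p \<Longrightarrow> form L b q \<Longrightarrow> form L b (\<lambda>x. p x + q x)"
| form_step: "l \<in> L \<Longrightarrow> form L b q \<Longrightarrow> form L (Suc b) (\<lambda>x. l x * q x)"

lemma form_scale: "form L b q \<Longrightarrow> form L b (\<lambda>x. c * q x)"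
proof (induction rule: form.induct)
  case (form_const c')
  show ?case by (rule form.form_const)
next
  case (form_zero b)
  show ?case using form.form_zero[of L b] by simp
next
  case (form_add p b q)
  show ?case using form.form_add[OF form_add.IH] by (simp add: distrib_left)
next
  case (form_step l q b)
  show ?case using form.form_step[OF form_step.hyps(1) form_step.IH]
    by (simp add: mult.left_commute)
qed

lemma form_uminus: "form L b q \<Longrightarrow> form L b (\<lambda>x. - q x)"
  using form_scale[where c = "-1"] by simp

lemma form_diff: "form L b p \<Longrightarrow> form L b q \<Longrightarrow> form L b (\<lambda>x. p x - q x)"
  using form_add[OF _ form_uminus, of L b p q] by simp

lemma form_sum: "(\<And>i. i \<in> I \<Longrightarrow> form L b (q i)) \<Longrightarrow> form L b (\<lambda>x. \<Sum>i\<in>I. q i x)"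
  by (induction I rule: infinite_finite_induct) (auto intro: form_zero form_add)

lemma form_mult: "form L a p \<Longrightarrow> form L b q \<Longrightarrow> form L (a + b) (\<lambda>x. p x * q x)"
proof (induction rule: form.induct)
  case (form_const c)
  then show ?case using form_scale by auto
next
  case (form_zero a)
  show ?case using form.form_zero[of L "a + b"] by simp
next
  case (form_add p1 a p2)
  then show ?case using form.form_add[OF form_add.IH] by (simp add: distrib_right)
next
  case (form_step l p a)
  then show ?case using form.form_step[OF form_step.hyps(1) form_step.IH]
    by (simp add: mult.assoc)
qed

lemma form_linear: "l \<in> L \<Longrightarrow> form L 1 l"
  using form_step[OF _ form_const[where c = 1]] by simp

lemma form_prod_list:
  "(\<And>i. i \<in> set is \<Longrightarrow> l i \<in> L) \<Longrightarrow> form L (length is) (\<lambda>x. \<Prod>i\<leftarrow>is. l i x)"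
  by (induction "is") (auto intro: form_const form_step)

lemma form_comp:
  assumes "form L b q" "\<And>l. l \<in> L \<Longrightarrow> (\<lambda>x. l (g x)) \<in> M"
  shows "form M b (\<lambda>x. q (g x))"
  using assms(1) by induction (auto intro: form.intros assms(2))

lemma form_mono_degree:
  assumes "form L a q" "a \<le> b" "\<And>c. (\<lambda>_. c) \<in> L"
  shows "form L b q"
proof -
  have "form L (Suc c) (\<lambda>x. 1 * q x)" if "form L c q" for c
    by (rule form_step) (use that assms(3) in auto)
  with assms(2,1) show ?thesis by (induction rule: dec_induct) auto
qed

text \<open>
  \<open>F x\<close> plays the role of the polynomial \<open>t \<mapsto> f (t x)\<close>, whose coefficients are the homogeneous
  parts of \<open>f\<close>.
\<close>

definition graded :: "('a \<Rightarrow> 'k::comm_ring_1) set \<Rightarrow> ('a \<Rightarrow> 'k poly) set" where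
  "graded L = {F. \<forall>b. form L b (\<lambda>x. coeff (F x) b)}"

lemma graded_coeff: "F \<in> graded L \<Longrightarrow> form L b (\<lambda>x. coeff (F x) b)"
  by (simp add: graded_def)

lemma graded_const: "(\<lambda>_. [:c:]) \<in> graded L"
  by (auto simp: graded_def coeff_pCons split: nat.splits intro: form_const form_zero)

lemma graded_linear:
  assumes "l \<in> L" shows "(\<lambda>x. [:c, l x:]) \<in> graded L"
proof -
  have "form L b (\<lambda>x. coeff [:c, l x:] b)" for b
    using form_linear[OF assms]
    by (cases b rule: nat.exhaust[case_product nat.exhaust[of "b - 1"]])
       (auto simp: coeff_pCons split: nat.splits intro: form_const form_zero)
  then show ?thesis by (simp add: graded_def)
qed

lemma graded_add: "F \<in> graded L \<Longrightarrow> H \<in> graded L \<Longrightarrow> (\<lambda>x. F x + H x) \<in> graded L"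
  by (simp add: graded_def form_add)

lemma graded_mult:
  assumes "F \<in> graded L" "H \<in> graded L" shows "(\<lambda>x. F x * H x) \<in> graded L"
proof -
  have "form L b (\<lambda>x. \<Sum>i\<le>b. coeff (F x) i * coeff (H x) (b - i))" for b
  proof (rule form_sum)
    fix i assume "i \<in> {..b}"
    then show "form L b (\<lambda>x. coeff (F x) i * coeff (H x) (b - i))"
      using form_mult[OF graded_coeff[OF assms(1), of i] graded_coeff[OF assms(2), of "b - i"]]
      by simp
  qed
  then show ?thesis by (simp add: graded_def coeff_mult)
qed

lemma graded_0: "(\<lambda>_. 0) \<in> graded L" and graded_1: "(\<lambda>_. 1) \<in> graded L"
  using graded_const[of 0] graded_const[of 1] by (simp_all add: one_pCons)

lemma graded_sum: "(\<And>i. i \<in> I \<Longrightarrow> F i \<in> graded L) \<Longrightarrow> (\<lambda>x. \<Sum>i\<in>I. F i x) \<in> graded L"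
  by (induction I rule: infinite_finite_induct) (auto intro: graded_0 graded_add)

lemma graded_prod: "(\<And>i. i \<in> I \<Longrightarrow> F i \<in> graded L) \<Longrightarrow> (\<lambda>x. \<Prod>i\<in>I. F i x) \<in> graded L"
  by (induction I rule: infinite_finite_induct) (auto intro: graded_1 graded_mult)

lemma graded_signof: "(\<lambda>x. signof p :: 'k::comm_ring_1 poly) \<in> graded L"
proof -
  have "signof p = ([:signof p:] :: 'k poly)"
    by (simp add: sign_def one_pCons)
  then show ?thesis using graded_const by metis
qed

lemma graded_det:
  assumes "\<And>i j. i < n \<Longrightarrow> j < n \<Longrightarrow> (\<lambda>x. M x i j) \<in> graded L"
  shows "(\<lambda>x. det (mat n n (\<lambda>(i, j). M x i j))) \<in> graded L"
proof -
  have "(\<lambda>x. \<Sum>p | p permutes {0..<n}. signof p * (\<Prod>i = 0..<n. M x i (p i))) \<in> graded L"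
  proof (intro graded_sum graded_mult graded_signof graded_prod)
    fix p i assume "p \<in> {p. p permutes {0..<n}}" "i \<in> {0..<n}"
    then have "p i < n" "i < n" using permutes_in_image[of p "{0..<n}" i] by auto
    then show "(\<lambda>x. M x i (p i)) \<in> graded L" by (intro assms)
  qed
  moreover have "det (mat n n (\<lambda>(i, j). M x i j)) =
      (\<Sum>p | p permutes {0..<n}. signof p * (\<Prod>i = 0..<n. M x i (p i)))" for x
    unfolding det_def by (auto intro!: sum.cong prod.cong simp: permutes_in_image
        dest: permutes_in_image[THEN iffD2])
  ultimately show ?thesis by presburger
qed

section \<open>Rank and submersions\<close>

text \<open>
  A list of pairs \<open>(c, is)\<close> stands for the polynomial \<open>\<Sum> c \<Prod>\<^bsub>i \<in> is\<^esub> x\<^sub>i\<close>. Coefficients are transported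
  along \<open>h\<close>, so that one polynomial over \<open>k\<close> can be evaluated in \<open>k\<close>, \<open>k[t]\<close> and \<open>k((t))\<close>.
\<close>

definition term_val :: "('k \<Rightarrow> 'r::comm_ring_1) \<Rightarrow> ('k \<times> nat list) list \<Rightarrow> (nat \<Rightarrow> 'r) \<Rightarrow> 'r" where
  "term_val h T x = (\<Sum>(c, is)\<leftarrow>T. h c * (\<Prod>i\<leftarrow>is. x i))"

primrec mon_deriv :: "nat list \<Rightarrow> (nat \<Rightarrow> 'r) \<Rightarrow> (nat \<Rightarrow> 'r) \<Rightarrow> 'r::comm_ring_1" where
  "mon_deriv [] x y = 0"
| "mon_deriv (i # is) x y = y i * (\<Prod>j\<leftarrow>is. x j) + x i * mon_deriv is x y"

definition term_deriv :: "('k \<Rightarrow> 'r::comm_ring_1) \<Rightarrow> ('k \<times> nat list) list \<Rightarrow> (nat \<Rightarrow> 'r) \<Rightarrow> (nat \<Rightarrow> 'r) \<Rightarrow> 'r" where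
  "term_deriv h T x y = (\<Sum>(c, is)\<leftarrow>T. h c * mon_deriv is x y)"

lemma term_val_simps [simp]: "term_val h [] x = 0" "term_val h ((c, is) # T) x = h c * (\<Prod>i\<leftarrow>is. x i) + term_val h T x"
  by (simp_all add: term_val_def)

lemma term_deriv_simps [simp]: "term_deriv h [] x y = 0" "term_deriv h ((c, is) # T) x y = h c * mon_deriv is x y + term_deriv h T x y"
  by (simp_all add: term_deriv_def)

lemma mon_deriv_sum: "mon_deriv is x (\<lambda>a. \<Sum>j\<in>J. c j * y j a) = (\<Sum>j\<in>J. c j * mon_deriv is x (y j))"
  by (induction "is") (simp_all add: sum_distrib_right sum_distrib_left sum.distrib algebra_simps)

lemma term_deriv_sum: "term_deriv h T x (\<lambda>a. \<Sum>j\<in>J. c j * y j a) = (\<Sum>j\<in>J. c j * term_deriv h T x (y j))"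
proof (induction T)
  case (Cons p T)
  then show ?case
    by (cases p) (simp add: mon_deriv_sum sum_distrib_left sum.distrib algebra_simps)
qed simp

text \<open>Linear forms on \<open>k^n\<close>, read as functions of a whole sequence that see only
  its first \<open>n\<close> entries; so \<open>n\<close> can vary without a type of vectors for
  each dimension.\<close>

definition Lin :: "nat \<Rightarrow> ((nat \<Rightarrow> 'k::comm_ring_1) \<Rightarrow> 'k) set" where
  "Lin n = {\<lambda>u. \<Sum>i<n. a i * u i | a. True}"

lemma LinI: "(\<lambda>u. \<Sum>i<n. a i * u i) \<in> Lin n"
  by (auto simp: Lin_def)

lemma LinE: assumes "l \<in> Lin n" obtains a where "l = (\<lambda>u. \<Sum>i<n. a i * u i)"
  using assms by (auto simp: Lin_def)

lemma Lin_add: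
  assumes "l \<in> Lin n" "m \<in> Lin n" shows "(\<lambda>u. l u + m u) \<in> Lin n"
proof -
  from assms obtain a b where "l = (\<lambda>u. \<Sum>i<n. a i * u i)" "m = (\<lambda>u. \<Sum>i<n. b i * u i)"
    by (auto simp: Lin_def)
  then have "(\<lambda>u. l u + m u) = (\<lambda>u. \<Sum>i<n. (a i + b i) * u i)"
    by (simp add: sum.distrib distrib_right)
  then show ?thesis by (simp add: LinI)
qed

lemma Lin_scale:
  assumes "l \<in> Lin n" shows "(\<lambda>u. c * l u) \<in> Lin n"
proof -
  from assms obtain a where "l = (\<lambda>u. \<Sum>i<n. a i * u i)" by (auto simp: Lin_def)
  then have "(\<lambda>u. c * l u) = (\<lambda>u. \<Sum>i<n. (c * a i) * u i)"
    by (simp add: sum_distrib_left mult.assoc)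
  then show ?thesis by (simp add: LinI)
qed

lemma Lin_0: "(\<lambda>_. 0) \<in> Lin n"
  using LinI[where n = n and a = "\<lambda>_. 0"] by simp

lemma Lin_sum: "(\<And>j. j \<in> J \<Longrightarrow> l j \<in> Lin n) \<Longrightarrow> (\<lambda>u. \<Sum>j\<in>J. l j u) \<in> Lin n"
  by (induction J rule: infinite_finite_induct) (auto intro: Lin_0 Lin_add)

lemma Lin_var: "i < n \<Longrightarrow> (\<lambda>u. u i) \<in> Lin n"
  using LinI[where n = n and a = "\<lambda>j. if j = i then 1 else 0"] by (simp add: if_distrib if_distribR cong: if_cong)

section \<open>Forms obtained by substitution, and their expansion in coordinates\<close>

lemma form_term_val:
  assumes "\<forall>(c, is)\<in>set T. length is = d" "\<And>a. X a \<in> L"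
  shows "form L d (\<lambda>u. term_val (\<lambda>c. c) T (\<lambda>a. X a u))"
  using assms(1)
proof (induction T)
  case (Cons p T)
  obtain c "is" where p: "p = (c, is)" by fastforce
  have "form L d (\<lambda>u. c * (\<Prod>i\<leftarrow>is. X i u))"
    using form_scale[OF form_prod_list[of "is" X L]] assms(2) Cons.prems p by auto
  then show ?case using Cons p by (auto intro: form_add)
qed (auto intro: form_zero)

lemma form_mon_deriv:
  assumes "\<And>a. X a \<in> L" "\<And>a. Y a \<in> L"
  shows "form L (length is) (\<lambda>u. mon_deriv is (\<lambda>a. X a u) (\<lambda>a. Y a u))"
proof (induction "is")
  case (Cons i "is")
  then show ?case using assms by (auto intro!: form_add form_step form_prod_list)
qed (auto intro: form_zero)

lemma form_term_deriv:
  assumes "\<forall>(c, is)\<in>set T. length is = d" "\<And>a. X a \<in> L" "\<And>a. Y a \<in> L"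
  shows "form L d (\<lambda>u. term_deriv (\<lambda>c. c) T (\<lambda>a. X a u) (\<lambda>a. Y a u))"
  using assms(1)
proof (induction T)
  case (Cons p T)
  obtain c "is" where p: "p = (c, is)" by fastforce
  have "form L d (\<lambda>u. c * mon_deriv is (\<lambda>a. X a u) (\<lambda>a. Y a u))"
    using form_scale[OF form_mon_deriv[of X L Y "is"]] assms(2,3) Cons.prems p by auto
  then show ?case using Cons p by (auto intro: form_add)
qed (auto intro: form_zero)

text \<open>Words in the variables are used instead of monomials: their number \<open>n^d\<close>
  overestimates the dimension of the space of forms, and an upper bound is all that is
  wanted.\<close>

lemma form_Lin_expansion:
  assumes "form (Lin n) d w"
  shows "\<exists>c. \<forall>u. w u = (\<Sum>is | set is \<subseteq> {..<n} \<and> length is = d. c is * (\<Prod>i\<leftarrow>is. u i))"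
  using assms
proof induction
  case (form_const c)
  have "{is. set is \<subseteq> {..<n} \<and> length is = 0} = {[]}" by auto
  then show ?case by (intro exI[of _ "\<lambda>_. c"]) (simp only:, simp)
next
  case (form_zero b)
  show ?case by (intro exI[of _ "\<lambda>_. 0"]) simp
next
  case (form_add b p q)
  then obtain c c' where
    "\<forall>u. p u = (\<Sum>is | set is \<subseteq> {..<n} \<and> length is = b. c is * (\<Prod>i\<leftarrow>is. u i))"
    "\<forall>u. q u = (\<Sum>is | set is \<subseteq> {..<n} \<and> length is = b. c' is * (\<Prod>i\<leftarrow>is. u i))" by blast
  then show ?case
    by (intro exI[of _ "\<lambda>is. c is + c' is"]) (simp add: sum.distrib distrib_right)
next
  case (form_step l b q)
  from form_step.IH obtain c where
    c: "q u = (\<Sum>is | set is \<subseteq> {..<n} \<and> length is = b. c is * (\<Prod>i\<leftarrow>is. u i))" for u by blast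
  obtain a where a: "l = (\<lambda>u. \<Sum>i<n. a i * u i)" using form_step.hyps(1) by (rule LinE)
  let ?W = "{is. set is \<subseteq> {..<n} \<and> length is = b}"
  let ?V = "{is. set is \<subseteq> {..<n} \<and> length is = Suc b}"
  have V: "?V = (\<lambda>(i, is). i # is) ` ({..<n} \<times> ?W)"
    by (auto simp: length_Suc_conv image_iff)
  have "l u * q u = (\<Sum>is\<in>?V. (a (hd is) * c (tl is)) * (\<Prod>i\<leftarrow>is. u i))" for u
  proof -
    have "l u * q u = (\<Sum>(i, is)\<in>{..<n} \<times> ?W. a i * c is * (\<Prod>i\<leftarrow>i # is. u i))"
      unfolding a c sum_product sum.cartesian_product
      by (intro sum.cong) (auto simp: algebra_simps)
    also have "\<dots> = (\<Sum>is\<in>?V. (a (hd is) * c (tl is)) * (\<Prod>i\<leftarrow>is. u i))"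
      unfolding V by (subst sum.reindex) (auto simp: inj_on_def case_prod_beta intro!: sum.cong)
    finally show ?thesis .
  qed
  then show ?case by (intro exI[of _ "\<lambda>is. a (hd is) * c (tl is)"]) blast
qed

text \<open>The matrix factors through a space of dimension \<open>card R\<close>, so its rank is
  below \<open>s\<close>. Padding both factors with zeros to size \<open>s\<close> brings this under
  \<open>det_mult\<close>: the last column of \<open>U\<close> is zero.\<close>

lemma det_0_of_small_span:
  fixes w :: "nat \<Rightarrow> 'a \<Rightarrow> 'k::field"
  assumes "finite R" "card R < s"
    and w: "\<And>j u. j < s \<Longrightarrow> w j u = (\<Sum>r\<in>R. c j r * m r u)"
  shows "det (mat s s (\<lambda>(i, j). w j (u i))) = 0"
proof -
  obtain e where e: "bij_betw e {..<card R} R"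
    using ex_bij_betw_nat_finite[OF assms(1)] by (auto simp: atLeast0LessThan)
  define U where "U = mat s s (\<lambda>(i, r). if r < card R then m (e r) (u i) else 0)"
  define C where "C = mat s s (\<lambda>(r, j). if r < card R then c j (e r) else 0)"
  have "mat s s (\<lambda>(i, j). w j (u i)) = U * C"
  proof (rule eq_matI)
    fix i j assume "i < dim_row (U * C)" "j < dim_col (U * C)"
    then have ij: "i < s" "j < s" by (auto simp: U_def C_def)
    have "(U * C) $$ (i, j) = (\<Sum>r<s. if r < card R then m (e r) (u i) * c j (e r) else 0)"
      using ij by (simp add: U_def C_def times_mat_def scalar_prod_def atLeast0LessThan
          if_distrib if_distribR cong: if_cong sum.cong) (auto intro!: sum.cong)
    also have "\<dots> = (\<Sum>r<card R. m (e r) (u i) * c j (e r))"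
      by (rule sum.mono_neutral_cong_right) (use assms(2) in auto)
    also have "\<dots> = (\<Sum>r\<in>R. m r (u i) * c j r)"
      by (rule sum.reindex_bij_betw[OF e])
    also have "\<dots> = w j (u i)" using w[OF ij(2)] by (simp add: mult.commute)
    finally show "mat s s (\<lambda>(i, j). w j (u i)) $$ (i, j) = (U * C) $$ (i, j)" using ij by simp
  qed (auto simp: U_def C_def)
  moreover have "det U = 0"
  proof -
    have "U \<in> carrier_mat s s" by (simp add: U_def)
    moreover have "\<not> s - 1 < card R" using assms(2) by simp
    ultimately show ?thesis
      using laplace_expansion_column[of U s "s - 1"] assms(2) by (simp add: U_def)
  qed
  moreover have "det (U * C) = det U * det C"
    by (rule det_mult[of _ s]) (auto simp: U_def C_def)
  ultimately show ?thesis by simp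
qed

section \<open>Polarization\<close>

lemma poly_eq_0I:
  fixes p :: "'k::field poly"
  assumes "infinite (UNIV :: 'k set)" "\<And>x. poly p x = 0"
  shows "p = 0"
  using poly_roots_finite[of p] assms by auto

lemma coeff_linear_power_1: "coeff ([:a, b:] ^ Suc m) 1 = of_nat (Suc m) * b * a ^ m"
  for a b :: "'k::comm_ring_1"
proof (induction m)
  case (Suc m)
  have "coeff ([:a, b:] ^ Suc (Suc m)) 1 = a * coeff ([:a, b:] ^ Suc m) 1 + b * coeff ([:a, b:] ^ Suc m) 0"
    by (subst power_Suc) (simp add: mult_pCons_left coeff_pCons del: power_Suc)
  also have "coeff ([:a, b:] ^ Suc m) 0 = a ^ Suc m"
    by (simp add: coeff_0_power del: power_Suc)
  finally show ?case unfolding Suc by (simp add: algebra_simps)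
qed simp

text \<open>The coefficient of \<open>s\<close> in \<open>(\<mu> + s l)\<^sup>e\<close> is \<open>e l \<mu>\<^sup>e\<^sup>-\<^sup>1\<close>.\<close>

lemma polarization:
  fixes K :: "'i \<Rightarrow> 'k::field"
  assumes inf: "infinite (UNIV :: 'k set)"
    and ch: "\<And>i. 1 \<le> i \<Longrightarrow> i \<le> d \<Longrightarrow> of_nat i \<noteq> (0 :: 'k)"
    and pow: "\<And>l. l \<in> Lin n \<Longrightarrow> (\<Sum>i\<in>I. K i * l (u i) ^ d) = 0"
    and w: "form (Lin n) d w"
  shows "(\<Sum>i\<in>I. K i * w (u i)) = 0"
proof -
  \<comment> \<open>The generalization interpolates between powers and arbitrary forms:
    \<open>b = 0\<close> is the hypothesis on powers, and \<open>b = d\<close> with exponent 0 is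
    the claim. Each step trades one factor \<open>\<mu>\<close> for a factor
    \<open>l\<close>.\<close>
  have "\<forall>\<mu>\<in>Lin n. (\<Sum>i\<in>I. K i * (w (u i) * \<mu> (u i) ^ (d - b))) = 0"
    if "form (Lin n) b w" "b \<le> d" for b w
    using that
  proof induction
    case (form_const c)
    show ?case using pow
      by (auto simp: mult.left_commute[of _ c] simp flip: sum_distrib_left)
  next
    case (form_add b p q)
    then show ?case by (simp add: distrib_right distrib_left sum.distrib)
  next
    case (form_step l b q)
    obtain e where e: "d - b = Suc e" "d - Suc b = e" using form_step.prems
      by (metis Suc_diff_Suc Suc_le_lessD)
    show ?case
    proof
      fix \<mu> :: "(nat \<Rightarrow> 'k) \<Rightarrow> 'k" assume \<mu>: "\<mu> \<in> Lin n"
      define p where "p = (\<Sum>i\<in>I. [:K i * q (u i):] * [:\<mu> (u i), l (u i):] ^ Suc e)"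
      have "poly p s = 0" for s
      proof -
        have "(\<lambda>u. \<mu> u + s * l u) \<in> Lin n"
          by (intro Lin_add Lin_scale \<mu> form_step.hyps)
        with form_step.IH form_step.prems have
          "(\<Sum>i\<in>I. K i * (q (u i) * (\<mu> (u i) + s * l (u i)) ^ (d - b))) = 0" by force
        then show ?thesis by (simp add: p_def poly_sum e algebra_simps del: power_Suc)
      qed
      then have "coeff p 1 = 0" using poly_eq_0I[OF inf, of p] by simp
      then have "(\<Sum>i\<in>I. K i * q (u i) * (of_nat (Suc e) * l (u i) * \<mu> (u i) ^ e)) = 0"
        by (simp add: p_def coeff_sum coeff_linear_power_1[unfolded One_nat_def] del: power_Suc of_nat_Suc)
      then have "of_nat (Suc e) * (\<Sum>i\<in>I. K i * (l (u i) * q (u i) * \<mu> (u i) ^ e)) = 0"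
        by (simp add: sum_distrib_left algebra_simps del: of_nat_Suc)
      moreover have "of_nat (Suc e) \<noteq> (0 :: 'k)" by (rule ch) (use e in auto)
      ultimately show "(\<Sum>i\<in>I. K i * (l (u i) * q (u i) * \<mu> (u i) ^ (d - Suc b))) = 0"
        unfolding e by simp
    qed
  qed simp
  from this[OF w order_refl] Lin_0[of n] show ?thesis by auto
qed

section \<open>The differential along a line\<close>

lemma poly_prod_list: "poly (\<Prod>i\<leftarrow>is. X i) t = (\<Prod>i\<leftarrow>is. poly (X i) t)"
  by (induction "is") simp_all

lemma poly_term_deriv: "poly (term_deriv (\<lambda>c. [:c:]) T X Y) t = term_deriv (\<lambda>c. c) T (\<lambda>a. poly (X a) t) (\<lambda>a. poly (Y a) t)"
proof -
  have "poly (mon_deriv is X Y) t = mon_deriv is (\<lambda>a. poly (X a) t) (\<lambda>a. poly (Y a) t)" for "is"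
    by (induction "is") (simp_all add: poly_prod_list)
  then show ?thesis by (induction T) auto
qed

lemma graded_term_deriv:
  assumes "\<And>a. (\<lambda>x. X x a) \<in> graded L" "\<And>a. (\<lambda>x. Y x a) \<in> graded L"
  shows "(\<lambda>x. term_deriv (\<lambda>c. [:c:]) T (X x) (Y x)) \<in> graded L"
proof -
  have "(\<lambda>x. \<Prod>i\<leftarrow>is. X x i) \<in> graded L" for "is"
    by (induction "is") (auto intro: graded_1 graded_mult assms)
  then have "(\<lambda>x. mon_deriv is (X x) (Y x)) \<in> graded L" for "is"
    by (induction "is") (auto intro!: graded_0 graded_add graded_mult assms)
  then show ?thesis
    by (induction T) (auto simp del: mult_pCons_left intro!: graded_0 graded_add graded_mult graded_const)
qed

lemma coeff_prod_list_linear: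
  "coeff (\<Prod>i\<leftarrow>is. [:a i, b i:]) (length is) = (\<Prod>i\<leftarrow>is. b i) \<and>
   (\<forall>j>length is. coeff (\<Prod>i\<leftarrow>is. [:a i, b i:]) j = (0 :: 'k::comm_ring_1))"
  by (induction "is") (auto simp: coeff_pCons mult_pCons_left split: nat.splits)

text \<open>With direction \<open>t b\<close> at the point \<open>a + t b\<close>, the derivative is
  \<open>t d/dt\<close> of the monomial at \<open>a + t b\<close> (Euler's relation), so the
  coefficient of \<open>t^j\<close> is multiplied by \<open>j\<close>. Hence the factor
  \<open>length is\<close> at the top and the vanishing at \<open>j = 0\<close>.\<close>

lemma coeff_mon_deriv_linear:
  fixes a b :: "nat \<Rightarrow> 'k::comm_ring_1"
  shows "coeff (mon_deriv is (\<lambda>i. [:a i, b i:]) (\<lambda>i. [:0, b i:])) (length is) = of_nat (length is) * (\<Prod>i\<leftarrow>is. b i) \<and>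
   (\<forall>j>length is. coeff (mon_deriv is (\<lambda>i. [:a i, b i:]) (\<lambda>i. [:0, b i:])) j = 0) \<and>
   coeff (mon_deriv is (\<lambda>i. [:a i, b i:]) (\<lambda>i. [:0, b i:])) 0 = 0"
proof (induction "is")
  case (Cons i "is")
  then show ?case using coeff_prod_list_linear[of a b "is"]
    by (auto simp: coeff_pCons mult_pCons_left algebra_simps split: nat.splits)
qed simp

lemma coeff_term_deriv_linear:
  fixes a b :: "nat \<Rightarrow> 'k::comm_ring_1"
  assumes "\<forall>(c, is)\<in>set T. length is = d"
  shows "coeff (term_deriv (\<lambda>c. [:c:]) T (\<lambda>i. [:a i, b i:]) (\<lambda>i. [:0, b i:])) d = of_nat d * term_val (\<lambda>c. c) T b"
    and "coeff (term_deriv (\<lambda>c. [:c:]) T (\<lambda>i. [:a i, b i:]) (\<lambda>i. [:0, b i:])) 0 = 0"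
  using assms by (induction T) (auto simp: coeff_mon_deriv_linear algebra_simps)

lemma term_val_scale:
  assumes "\<forall>(c, is)\<in>set T. length is = d"
  shows "term_val h T (\<lambda>a. s * x a) = s ^ d * term_val h T x"
proof -
  have "(\<Prod>i\<leftarrow>is. s * x i) = s ^ length is * (\<Prod>i\<leftarrow>is. x i)" for "is"
    by (induction "is") (simp_all add: algebra_simps)
  then show ?thesis using assms by (induction T) (auto simp: algebra_simps)
qed

lemma mat_delete_mat:
  "i < Suc s \<Longrightarrow> mat_delete (mat (Suc s) (Suc s) (\<lambda>(i, j). f i j)) i s =
    mat s s (\<lambda>(i', j'). f (if i' < i then i' else Suc i') j')"
  by (rule eq_matI) (auto simp: mat_delete_def)

lemma laplace_last_column:
  fixes f :: "nat \<Rightarrow> nat \<Rightarrow> 'r::comm_ring_1"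
  shows "det (mat (Suc s) (Suc s) (\<lambda>(i, j). f i j)) = (\<Sum>i<Suc s. f i s *
    ((-1) ^ (i + s) * det (mat s s (\<lambda>(i', j'). f (if i' < i then i' else Suc i') j'))))"
  by (subst laplace_expansion_column[of _ "Suc s" s])
     (auto simp: cofactor_def mat_delete_mat intro!: sum.cong)

text \<open>Single coordinates and constants are enough to generate everything built from the
  deformed points \<open>\<Phi> a (p i) + t * l (p i) * x a\<close>. Including the constants turns
  the degree of a form into an upper bound.\<close>

definition coord_affine :: "((nat \<Rightarrow> 'k::comm_ring_1) \<Rightarrow> 'k) set" where
  "coord_affine = {\<lambda>x. c + e * x a | c e a. True}"

lemma coord_affineI: "(\<lambda>x. c + e * x a) \<in> coord_affine"
  by (auto simp: coord_affine_def)

lemma coord_affine_const: "(\<lambda>_. c) \<in> coord_affine"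
  using coord_affineI[where e = 0] by simp

lemma coord_affine_var: "(\<lambda>x. e * x a) \<in> coord_affine"
  using coord_affineI[where c = 0] by simp

text \<open>
  Take a nonvanishing minor of maximal size \<open>s\<close> of the differential \<open>\<Psi> \<mapsto> dT\<^sub>\<Phi>(\<Psi>)\<close> of \<open>\<Phi> \<mapsto> T \<circ> \<Phi>\<close>, its
  rows being evaluations at points, and border it with a further row and the column \<open>l\<^sup>d\<close>. If every such
  bordered determinant vanishes, then \<open>l\<^sup>d\<close>, hence by polarization every form of degree \<open>d\<close>, is in the
  image of the differential. Otherwise, replace \<open>\<Phi>\<close> by \<open>\<Phi> + t l x\<close> and the last column by
  \<open>dT(t l x)\<close>: the determinant vanishes identically by maximality of \<open>s\<close>, and its coefficient of
  \<open>t\<^sup>d\<close> is a nonzero multiple of \<open>T(x)\<close> plus products of two forms of degrees less than \<open>d\<close>.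
\<close>

lemma rank_or_submersion:
  fixes T :: "('k::field \<times> nat list) list"
  assumes inf: "infinite (UNIV :: 'k set)"
    and hom: "\<forall>(c, is)\<in>set T. length is = d"
    and ch: "\<And>i. 1 \<le> i \<Longrightarrow> i \<le> d \<Longrightarrow> of_nat i \<noteq> (0 :: 'k)"
    and d: "1 \<le> d"
  obtains (submersion) \<Phi> where "\<And>a. \<Phi> a \<in> Lin n"
      "\<And>w. form (Lin n) d w \<Longrightarrow> \<exists>\<Psi>. (\<forall>a. \<Psi> a \<in> Lin n) \<and>
         (\<forall>u. w u = term_deriv (\<lambda>c. c) T (\<lambda>a. \<Phi> a u) (\<lambda>a. \<Psi> a u))"
  | (rank) J :: "(nat \<times> nat) set" and g h where "finite J" "card J \<le> (n ^ d + 1) * d"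
      "\<And>j. j \<in> J \<Longrightarrow> form coord_affine (d - 1) (g j)" "\<And>j. j \<in> J \<Longrightarrow> form coord_affine (d - 1) (h j)"
      "\<And>x. term_val (\<lambda>c. c) T x = (\<Sum>j\<in>J. g j x * h j x)"
proof -
  define D where "D \<Phi> \<Psi> u = term_deriv (\<lambda>c. c) T (\<lambda>a. \<Phi> a u) (\<lambda>a. \<Psi> a u)"
    for \<Phi> \<Psi> :: "nat \<Rightarrow> (nat \<Rightarrow> 'k) \<Rightarrow> 'k" and u
  define minor where "minor s \<longleftrightarrow> (\<exists>\<Phi> \<Psi> u. (\<forall>a. \<Phi> a \<in> Lin n) \<and> (\<forall>j a. \<Psi> j a \<in> Lin n) \<and>
    det (mat s s (\<lambda>(i, j). D \<Phi> (\<Psi> j) (u i))) \<noteq> 0)" for s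
  \<comment> \<open>This is uniform in \<open>T\<close>: the columns of a minor come from forms of
    degree \<open>d\<close> in \<open>n\<close> variables, which are spanned by \<open>n^d\<close>
    words.\<close>
  have bound: "s \<le> n ^ d" if "minor s" for s
  proof (rule ccontr)
    assume s: "\<not> s \<le> n ^ d"
    from that obtain \<Phi> \<Psi> u where L: "\<forall>a. \<Phi> a \<in> Lin n" "\<forall>j a. \<Psi> j a \<in> Lin n"
      and nz: "det (mat s s (\<lambda>(i, j). D \<Phi> (\<Psi> j) (u i))) \<noteq> 0" unfolding minor_def by blast
    have "form (Lin n) d (D \<Phi> (\<Psi> j))" for j
      unfolding D_def by (rule form_term_deriv[OF hom]) (use L in auto)
    then have "\<forall>j. \<exists>c. \<forall>u. D \<Phi> (\<Psi> j) u = (\<Sum>is | set is \<subseteq> {..<n} \<and> length is = d. c is * (\<Prod>i\<leftarrow>is. u i))"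
      using form_Lin_expansion by blast
    then obtain c where "\<forall>j u. D \<Phi> (\<Psi> j) u = (\<Sum>is | set is \<subseteq> {..<n} \<and> length is = d. c j is * (\<Prod>i\<leftarrow>is. u i))"
      by metis
    then have "det (mat s s (\<lambda>(i, j). D \<Phi> (\<Psi> j) (u i))) = 0"
      using s by (intro det_0_of_small_span[where c = c and m = "\<lambda>is u. \<Prod>i\<leftarrow>is. u i" and
            R = "{is. set is \<subseteq> {..<n} \<and> length is = d}"])
        (auto simp: finite_lists_length_eq card_lists_length_eq)
    with nz show False by contradiction
  qed
  have "minor 0" unfolding minor_def by (auto intro!: exI[of _ "\<lambda>_ _. 0"] exI[of _ "\<lambda>_ _ _. 0"] Lin_0)
  then obtain s where s: "minor s" "\<And>s'. minor s' \<Longrightarrow> s' \<le> s"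
    using bound ex_has_greatest_nat[of minor 0 id "n ^ d + 1"] by (auto simp: less_Suc_eq_le)
  then obtain \<Phi> \<Psi> us where L: "\<And>a. \<Phi> a \<in> Lin n" "\<And>j a. \<Psi> j a \<in> Lin n"
    and nz: "det (mat s s (\<lambda>(i, j). D \<Phi> (\<Psi> j) (us i))) \<noteq> 0" unfolding minor_def by blast
  define pt where "pt u0 i = (if i < s then us i else u0)" for u0 i
  \<comment> \<open>This is the cofactor of row \<open>i\<close> in the last column. It does not
    involve that column, so it stays the same whichever function \<open>w\<close> forms the
    border.\<close>
  define K where "K u0 i = (-1) ^ (i + s) * det (mat s s (\<lambda>(i', j').
    D \<Phi> (\<Psi> j') (pt u0 (if i' < i then i' else Suc i'))))" for u0 i
  have border: "det (mat (Suc s) (Suc s) (\<lambda>(i, j). if j < s then D \<Phi> (\<Psi> j) (pt u0 i) else w (pt u0 i)))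
      = (\<Sum>i<Suc s. K u0 i * w (pt u0 i))" for w u0
  proof -
    have "mat s s (\<lambda>(i', j'). if j' < s then D \<Phi> (\<Psi> j') (pt u0 (if i' < i then i' else Suc i'))
        else w (pt u0 (if i' < i then i' else Suc i'))) =
      mat s s (\<lambda>(i', j'). D \<Phi> (\<Psi> j') (pt u0 (if i' < i then i' else Suc i')))" for i
      by (intro eq_matI) auto
    then show ?thesis
      unfolding laplace_last_column K_def by (simp add: mult.commute del: sum.lessThan_Suc)
  qed
  show thesis
  proof (cases "\<forall>l\<in>Lin n. \<forall>u0. (\<Sum>i<Suc s. K u0 i * l (pt u0 i) ^ d) = 0")
    case True
    show thesis
    proof (rule submersion[of \<Phi>])
      fix w :: "(nat \<Rightarrow> 'k) \<Rightarrow> 'k" assume w: "form (Lin n) d w"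
      \<comment> \<open>Only the last row depends on \<open>u\<close>. Its cofactors can therefore
        be frozen at an arbitrary point, here 0, and the vanishing determinant becomes a linear
        relation between functions of \<open>u\<close>; \<open>\<kappa> s\<close> is the chosen
        nonzero minor.\<close>
      define \<kappa> where "\<kappa> j = cofactor (mat (Suc s) (Suc s)
        (\<lambda>(i, j). if j < s then D \<Phi> (\<Psi> j) (pt (\<lambda>_. 0) i) else w (pt (\<lambda>_. 0) i))) s j" for j
      have zero: "(\<Sum>j<s. D \<Phi> (\<Psi> j) u * \<kappa> j) + w u * \<kappa> s = 0" for u
      proof -
        let ?M = "\<lambda>u. mat (Suc s) (Suc s) (\<lambda>(i, j). if j < s then D \<Phi> (\<Psi> j) (pt u i) else w (pt u i))"
        have "(\<Sum>i<Suc s. K u i * w (pt u i)) = 0"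
          by (rule polarization[OF inf ch _ w]) (use True in auto)
        then have "det (?M u) = 0" by (simp only: border)
        moreover have "det (?M u) = (\<Sum>j<Suc s. ?M u $$ (s, j) * cofactor (?M u) s j)"
          by (rule laplace_expansion_row) auto
        moreover have "mat_delete (?M u) s j = mat_delete (?M (\<lambda>_. 0)) s j" if "j < Suc s" for j
          using that by (intro eq_matI) (auto simp: mat_delete_def pt_def)
        then have "cofactor (?M u) s j = \<kappa> j" if "j < Suc s" for j
          unfolding cofactor_def \<kappa>_def using that by simp
        ultimately show ?thesis by (simp add: pt_def)
      qed
      have "\<kappa> s \<noteq> 0"
      proof -
        have "mat_delete (mat (Suc s) (Suc s)
            (\<lambda>(i, j). if j < s then D \<Phi> (\<Psi> j) (pt (\<lambda>_. 0) i) else w (pt (\<lambda>_. 0) i))) s s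
          = mat s s (\<lambda>(i, j). D \<Phi> (\<Psi> j) (us i))"
          by (intro eq_matI) (auto simp: mat_delete_def pt_def)
        then show ?thesis unfolding \<kappa>_def cofactor_def using nz by simp
      qed
      define c where "c j = - \<kappa> j / \<kappa> s" for j
      show "\<exists>\<Psi>. (\<forall>a. \<Psi> a \<in> Lin n) \<and> (\<forall>u. w u = term_deriv (\<lambda>c. c) T (\<lambda>a. \<Phi> a u) (\<lambda>a. \<Psi> a u))"
      proof (intro exI[of _ "\<lambda>a u. \<Sum>j<s. c j * \<Psi> j a u"] conjI allI)
        fix a show "(\<lambda>u. \<Sum>j<s. c j * \<Psi> j a u) \<in> Lin n" by (intro Lin_sum Lin_scale L)
        fix u
        have "w u * \<kappa> s = - (\<Sum>j<s. D \<Phi> (\<Psi> j) u * \<kappa> j)"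
          using zero[of u] by (simp add: eq_neg_iff_add_eq_0 add.commute)
        then have "w u = - (\<Sum>j<s. D \<Phi> (\<Psi> j) u * \<kappa> j) / \<kappa> s"
          using \<open>\<kappa> s \<noteq> 0\<close> by (simp add: field_simps)
        also have "\<dots> = (\<Sum>j<s. c j * D \<Phi> (\<Psi> j) u)"
          by (simp add: c_def sum_divide_distrib sum_negf mult.commute)
        finally show "w u = term_deriv (\<lambda>c. c) T (\<lambda>a. \<Phi> a u) (\<lambda>a. \<Sum>j<s. c j * \<Psi> j a u)"
          by (simp add: term_deriv_sum D_def)
      qed
    qed (rule L)
  next
    case False
    then obtain l u0 where l: "l \<in> Lin n"
      and ne: "(\<Sum>i<Suc s. K u0 i * l (pt u0 i) ^ d) \<noteq> 0" (is "?\<beta> \<noteq> 0") by blast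
    define p where "p = pt u0"
    \<comment> \<open>\<open>X x i\<close> is the value of \<open>\<Phi> + t l x\<close> at the
      \<open>i\<close>-th point, \<open>c\<close> the last column in the direction
      \<open>t l x\<close>, and \<open>k\<close> the cofactors of that column.\<close>
    define X where "X x i a = [:\<Phi> a (p i), l (p i) * x a:]" for x i a
    define c where "c x i = term_deriv (\<lambda>c. [:c:]) T (X x i) (\<lambda>a. [:0, l (p i) * x a:])" for x i
    define E where "E x i j = (if j < s then term_deriv (\<lambda>c. [:c:]) T (X x i) (\<lambda>a. [:\<Psi> j a (p i):]) else c x i)" for x i j
    define k where "k x i = (-1) ^ (i + s) *
      det (mat s s (\<lambda>(i', j'). E x (if i' < i then i' else Suc i') j'))" for x i
    have X: "(\<lambda>x. X x i a) \<in> graded coord_affine" for i a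
      unfolding X_def by (rule graded_linear) (rule coord_affine_var)
    have c: "(\<lambda>x. c x i) \<in> graded coord_affine" for i
      unfolding c_def by (intro graded_term_deriv X graded_linear coord_affine_var)
    have E: "(\<lambda>x. E x i j) \<in> graded coord_affine" for i j
      unfolding E_def by (cases "j < s") (simp_all add: c graded_term_deriv X graded_const)
    have sgn: "(\<lambda>x. (-1) ^ i) \<in> graded coord_affine" for i
      using graded_prod[of "{..<i}" "\<lambda>_ _. - 1" coord_affine] graded_const[of "- 1" coord_affine] by (simp add: one_pCons)
    have k: "(\<lambda>x. k x i) \<in> graded coord_affine" for i
      unfolding k_def by (intro graded_mult sgn graded_det E)
    \<comment> \<open>For each value of \<open>t\<close> this is a minor of size
      \<open>Suc s\<close> of the differential at another tuple of linear forms. It vanishes because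
      \<open>s\<close> is maximal over all \<open>\<Phi>\<close>, not only for the chosen
      one.\<close>
    have ck: "(\<Sum>i<Suc s. c x i * k x i) = 0" for x
    proof (rule poly_eq_0I[OF inf])
      fix t :: 'k
      interpret poly_hom: comm_ring_hom "\<lambda>q. poly q t" by unfold_locales auto
      let ?\<Phi> = "\<lambda>a u. \<Phi> a u + t * x a * l u"
      let ?\<Psi> = "\<lambda>j a u. if j < s then \<Psi> j a u else t * x a * l u"
      have "\<not> minor (Suc s)" using s(2)[of "Suc s"] by auto
      moreover have "\<forall>a. ?\<Phi> a \<in> Lin n" by (intro allI Lin_add Lin_scale L l)
      moreover have "\<forall>j a. ?\<Psi> j a \<in> Lin n"
      proof (intro allI)
        fix j a show "?\<Psi> j a \<in> Lin n" by (cases "j < s") (simp_all add: L l Lin_scale)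
      qed
      ultimately have "det (mat (Suc s) (Suc s) (\<lambda>(i, j). D ?\<Phi> (?\<Psi> j) (p i))) = 0"
        unfolding minor_def not_ex
        by (elim allE[of _ ?\<Phi>] allE[of _ ?\<Psi>] allE[of _ p]) simp
      moreover have "mat (Suc s) (Suc s) (\<lambda>(i, j). D ?\<Phi> (?\<Psi> j) (p i)) =
          map_mat (\<lambda>q. poly q t) (mat (Suc s) (Suc s) (\<lambda>(i, j). E x i j))"
        by (intro eq_matI) (auto simp: D_def E_def c_def X_def poly_term_deriv algebra_simps)
      ultimately have "poly (det (mat (Suc s) (Suc s) (\<lambda>(i, j). E x i j))) t = 0"
        by (simp only: poly_hom.hom_det)
      moreover have "det (mat (Suc s) (Suc s) (\<lambda>(i, j). E x i j)) = (\<Sum>i<Suc s. c x i * k x i)"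
        unfolding laplace_last_column k_def by (simp add: E_def cong: if_cong)
      ultimately show "poly (\<Sum>i<Suc s. c x i * k x i) t = 0" by simp
    qed
    have c_d: "coeff (c x i) d = of_nat d * (l (p i) ^ d * term_val (\<lambda>c. c) T x)" and c_0: "coeff (c x i) 0 = 0" for x i
      unfolding c_def X_def by (simp_all add: coeff_term_deriv_linear[OF hom] term_val_scale[OF hom])
    have k_0: "coeff (k x i) 0 = K u0 i" if "i < Suc s" for x i
    proof -
      interpret poly_hom: comm_ring_hom "\<lambda>q :: 'k poly. poly q 0" by unfold_locales auto
      have "mat s s (\<lambda>(i', j'). D \<Phi> (\<Psi> j') (pt u0 (if i' < i then i' else Suc i'))) =
          map_mat (\<lambda>q. poly q 0) (mat s s (\<lambda>(i', j'). E x (if i' < i then i' else Suc i') j'))"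
        by (intro eq_matI) (auto simp: D_def E_def X_def poly_term_deriv p_def)
      then show ?thesis
        unfolding k_def K_def by (simp add: poly_hom.hom_det flip: poly_0_coeff_0)
    qed
    \<comment> \<open>In degree \<open>d\<close> the summand \<open>b = 0\<close> drops out by
      \<open>c_0\<close>, and \<open>b = d\<close> gives the multiple of \<open>T\<close>, as the
      cofactors have constant term \<open>K\<close>. In all other summands both factors have degree
      strictly between 0 and \<open>d\<close>.\<close>
    have expand: "of_nat d * ?\<beta> * term_val (\<lambda>c. c) T x =
        - (\<Sum>i<Suc s. \<Sum>b\<in>{1..<d}. coeff (c x i) b * coeff (k x i) (d - b))" for x
    proof -
      have "coeff (c x i * k x i) d = of_nat d * (l (p i) ^ d * term_val (\<lambda>c. c) T x) * K u0 i +
          (\<Sum>b\<in>{1..<d}. coeff (c x i) b * coeff (k x i) (d - b))" if "i < Suc s" for i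
      proof -
        have "{..d} = insert 0 (insert d {1..<d})" using d by auto
        then show ?thesis using d that by (simp add: coeff_mult c_0 c_d k_0)
      qed
      then have "coeff (\<Sum>i<Suc s. c x i * k x i) d =
          (\<Sum>i<Suc s. of_nat d * (l (p i) ^ d * term_val (\<lambda>c. c) T x) * K u0 i) +
          (\<Sum>i<Suc s. \<Sum>b\<in>{1..<d}. coeff (c x i) b * coeff (k x i) (d - b))"
        by (simp add: coeff_sum sum.distrib del: sum.lessThan_Suc)
      also have "(\<Sum>i<Suc s. of_nat d * (l (p i) ^ d * term_val (\<lambda>c. c) T x) * K u0 i) =
          of_nat d * ?\<beta> * term_val (\<lambda>c. c) T x"
        unfolding p_def sum_distrib_left sum_distrib_right
        by (intro sum.cong refl) (simp add: algebra_simps)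
      finally show ?thesis unfolding ck by (simp add: eq_neg_iff_add_eq_0 del: sum.lessThan_Suc)
    qed
    define N where "N = of_nat d * ?\<beta>"
    have "N \<noteq> 0" unfolding N_def using ne ch[of d] d by simp
    define C where "C = - inverse N"
    have C: "term_val (\<lambda>c. c) T x = (\<Sum>j\<in>{..<Suc s} \<times> {1..<d}.
        (C * coeff (c x (fst j)) (snd j)) * coeff (k x (fst j)) (d - snd j))" for x
    proof -
      have "term_val (\<lambda>c. c) T x = inverse N * (N * term_val (\<lambda>c. c) T x)" using \<open>N \<noteq> 0\<close> by simp
      also have "\<dots> = inverse N * - (\<Sum>i<Suc s. \<Sum>b\<in>{1..<d}. coeff (c x i) b * coeff (k x i) (d - b))"
        using expand[of x] by (simp only: N_def)
      also have "\<dots> = (\<Sum>i<Suc s. \<Sum>b\<in>{1..<d}. C * coeff (c x i) b * coeff (k x i) (d - b))"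
        by (simp only: C_def sum_distrib_left mult.assoc mult_minus_left mult_minus_right sum_negf)
      finally show ?thesis by (simp only: sum.cartesian_product case_prod_unfold)
    qed
    show thesis
    proof (rule rank[of "{..<Suc s} \<times> {1..<d}"])
      \<comment> \<open>The products are indexed by a row and an exponent \<open>b\<close>; this is
        the origin of the constant.\<close>
      have "Suc s * (d - 1) \<le> (n ^ d + 1) * d"
        using bound[OF s(1)] by (intro mult_mono) auto
      then show "card ({..<Suc s} \<times> {1..<d}) \<le> (n ^ d + 1) * d" by simp
    next
      fix j :: "nat \<times> nat" assume j: "j \<in> {..<Suc s} \<times> {1..<d}"
      show "form coord_affine (d - 1) (\<lambda>x. C * coeff (c x (fst j)) (snd j))"
        by (intro form_scale form_mono_degree[OF graded_coeff[OF c] _ coord_affine_const]) (use j in auto)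
      show "form coord_affine (d - 1) (\<lambda>x. coeff (k x (fst j)) (d - snd j))"
        by (intro form_mono_degree[OF graded_coeff[OF k] _ coord_affine_const]) (use j in auto)
    qed (simp, rule C)
  qed
qed

section \<open>Isotropic subspaces\<close>

text \<open>If \<open>a\<close> is nonzero, a root of \<open>a z^d + b\<close> serves with
  \<open>\<beta> = 1\<close>. Nontriviality is phrased so that for \<open>\<alpha> = 0\<close> a
  combination of two vectors with these coefficients is the second vector itself.\<close>

lemma poly_has_nonzero_combination:
  fixes a b :: "'k::alg_closed_field"
  assumes "1 \<le> d"
  shows "\<exists>\<alpha> \<beta>. (\<alpha> \<noteq> 0 \<or> \<beta> = 1) \<and> \<alpha> ^ d * a + \<beta> ^ d * b = 0"
proof (cases "a = 0")
  case True
  then show ?thesis using assms by (intro exI[of _ 1] exI[of _ 0]) (simp add: power_0_left)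
next
  case False
  then have "degree (monom a d + [:b:]) = d" using assms
    by (subst degree_add_eq_left) (auto simp: degree_monom_eq)
  then obtain z where "poly (monom a d + [:b:]) z = 0"
    using alg_closed_imp_poly_has_root[of "monom a d + [:b:]"] assms by auto
  then show ?thesis by (intro exI[of _ z] exI[of _ 1]) (simp add: poly_monom mult.commute)
qed

definition functionals :: "('k::field \<Rightarrow> 'v::ab_group_add \<Rightarrow> 'v) \<Rightarrow> ('v \<Rightarrow> 'k) set" where
  "functionals scale = {l. Vector_Spaces.linear scale (*) l}"

text \<open>The dimension \<open>n\<close> may depend on the number of forms, the bound for their
  degrees and the wanted dimension \<open>m\<close>, but never on the forms. Degree 0 is excluded
  because nonzero constants vanish nowhere.\<close>

definition vanish :: "('k::field \<Rightarrow> 'v::ab_group_add \<Rightarrow> 'v) \<Rightarrow> nat \<Rightarrow> nat \<Rightarrow> nat \<Rightarrow> nat \<Rightarrow> bool" where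
  "vanish scale d s m n \<longleftrightarrow>
     (\<forall>qs A. length qs = s \<longrightarrow> (\<forall>q\<in>set qs. \<exists>b. 1 \<le> b \<and> b \<le> d \<and> form (functionals scale) b q) \<longrightarrow>
       \<not> module.dependent scale A \<longrightarrow> finite A \<longrightarrow> card A = n \<longrightarrow>
       (\<exists>B. \<not> module.dependent scale B \<and> finite B \<and> card B = m \<and> B \<subseteq> module.span scale A \<and>
          (\<forall>q\<in>set qs. \<forall>v\<in>module.span scale B. q v = 0)))"

context vector_space
begin

text \<open>The two ends of the expansion are \<open>q w\<close> and \<open>q v\<close>. The mixed
  coefficients between them have degree at least 1 and less than \<open>b\<close> in
  \<open>w\<close>, which brings them within reach of an induction on the degree.\<close>

lemma form_functionals_line:
  assumes "form (functionals (*s)) b q"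
  shows "\<exists>qa. (\<forall>a\<le>b. form (functionals (*s)) (b - a) (qa a)) \<and> (\<forall>w. qa 0 w = q w) \<and> (\<forall>w. qa b w = q v) \<and>
    (\<forall>t w. q (t *s v + w) = (\<Sum>a\<le>b. t ^ a * qa a w))"
  using assms
proof induction
  case (form_const c)
  then show ?case by (intro exI[of _ "\<lambda>_ _. c"]) (auto intro: form.form_const)
next
  case (form_zero b)
  then show ?case by (intro exI[of _ "\<lambda>_ _. 0"]) (auto intro: form.form_zero)
next
  case (form_add b p q)
  then obtain pa qa where
    p: "\<forall>a\<le>b. form (functionals (*s)) (b - a) (pa a)" "\<forall>w. pa 0 w = p w" "\<forall>w. pa b w = p v"
      "\<forall>t w. p (t *s v + w) = (\<Sum>a\<le>b. t ^ a * pa a w)" and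
    q: "\<forall>a\<le>b. form (functionals (*s)) (b - a) (qa a)" "\<forall>w. qa 0 w = q w" "\<forall>w. qa b w = q v"
      "\<forall>t w. q (t *s v + w) = (\<Sum>a\<le>b. t ^ a * qa a w)"
    by auto
  show ?case using p q
    by (intro exI[of _ "\<lambda>a w. pa a w + qa a w"])
       (auto intro!: form.form_add simp: sum.distrib distrib_left)
next
  case (form_step l b q)
  then obtain qa where
    q: "\<And>a. a \<le> b \<Longrightarrow> form (functionals (*s)) (b - a) (qa a)" "\<And>w. qa 0 w = q w" "\<And>w. qa b w = q v"
      "\<And>t w. q (t *s v + w) = (\<Sum>a\<le>b. t ^ a * qa a w)"
    by auto
  have l: "l (t *s v + w) = t * l v + l w" for t w
    using form_step.hyps(1) by (simp add: functionals_def Vector_Spaces.linear_iff)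
  define ra where "ra a w = (if a \<le> b then l w * qa a w else 0) + (if a = 0 then 0 else l v * qa (a - 1) w)" for a w
  have "form (functionals (*s)) (Suc b - a) (ra a)" if "a \<le> Suc b" for a
  proof -
    have "form (functionals (*s)) (Suc b - a) (\<lambda>w. if a \<le> b then l w * qa a w else 0)"
      using form.form_step[OF form_step.hyps(1) q(1)[of a]]
      by (cases "a \<le> b") (auto simp: Suc_diff_le intro: form.form_zero)
    moreover have "form (functionals (*s)) (Suc b - a) (\<lambda>w. if a = 0 then 0 else l v * qa (a - 1) w)"
      using form_scale[OF q(1)[of "a - 1"], of "l v"] that
      by (cases a) (auto intro: form.form_zero)
    ultimately show ?thesis unfolding ra_def by (rule form.form_add)
  qed
  moreover have "l (t *s v + w) * q (t *s v + w) = (\<Sum>a\<le>Suc b. t ^ a * ra a w)" for t w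
  proof -
    have "(\<Sum>a\<le>Suc b. t ^ a * ra a w) = (\<Sum>a\<le>Suc b. if a \<le> b then t ^ a * (l w * qa a w) else 0) +
        (\<Sum>a\<le>Suc b. if a = 0 then 0 else t ^ a * (l v * qa (a - 1) w))"
      unfolding sum.distrib[symmetric] by (intro sum.cong) (auto simp: ra_def distrib_left)
    also have "(\<Sum>a\<le>Suc b. if a \<le> b then t ^ a * (l w * qa a w) else 0) = l w * q (t *s v + w)"
      unfolding q(4) by (simp add: sum_distrib_left mult.left_commute)
    also have "(\<Sum>a\<le>Suc b. if a = 0 then 0 else t ^ a * (l v * qa (a - 1) w)) = t * l v * q (t *s v + w)"
      unfolding q(4) sum.atMost_Suc_shift by (simp add: sum_distrib_left algebra_simps)
    finally show ?thesis unfolding l by (simp only: distrib_right add.commute)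
  qed
  moreover have "ra 0 w = l w * q w" "ra (Suc b) w = l v * q v" for w
    by (simp_all add: ra_def q)
  ultimately show ?case by (intro exI[of _ ra]) blast
qed

lemma vanishE:
  assumes "vanish (*s) d s m n" "length qs = s" "\<And>q. q \<in> set qs \<Longrightarrow> \<exists>b. 1 \<le> b \<and> b \<le> d \<and> form (functionals (*s)) b q"
    "independent A" "finite A" "card A = n"
  obtains B where "independent B" "finite B" "card B = m" "B \<subseteq> span A" "\<And>q v. q \<in> set qs \<Longrightarrow> v \<in> span B \<Longrightarrow> q v = 0"
  using assms unfolding vanish_def by metis

text \<open>The \<open>d\<close> mixed coefficients of \<open>q\<close> along \<open>v\<close> have
  degrees from 1 to \<open>d\<close>, so they vanish together on a large subspace of the span of the
  other vectors. What is left of \<open>q\<close> there is a diagonal sum.\<close>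

lemma split_line:
  assumes V: "vanish (*s) d d m n" and q: "form (functionals (*s)) (Suc d) q"
    and A: "independent A" "finite A" "card A = Suc n"
  obtains v B where "v \<in> A" "independent B" "finite B" "card B = m" "B \<subseteq> span (A - {v})"
    "\<And>t w. w \<in> span B \<Longrightarrow> q (t *s v + w) = t ^ Suc d * q v + q w"
proof -
  obtain v where v: "v \<in> A" using A by fastforce
  obtain qa where
    qa: "\<And>a. a \<le> Suc d \<Longrightarrow> form (functionals (*s)) (Suc d - a) (qa a)" "\<And>w. qa 0 w = q w" "\<And>w. qa (Suc d) w = q v"
      "\<And>t w. q (t *s v + w) = (\<Sum>a\<le>Suc d. t ^ a * qa a w)"
    using form_functionals_line[OF q, of v] by blast
  define qs where "qs = map qa [1..<Suc d]"
  have deg: "\<exists>b. 1 \<le> b \<and> b \<le> d \<and> form (functionals (*s)) b r" if r: "r \<in> set qs" for r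
  proof -
    from r obtain a where "1 \<le> a" "a \<le> d" "r = qa a" by (auto simp: qs_def)
    then show ?thesis using qa(1)[of a] by (intro exI[of _ "Suc d - a"]) auto
  qed
  have A': "independent (A - {v})" "finite (A - {v})" "card (A - {v}) = n"
    using A v independent_mono[of A "A - {v}"] by auto
  have "length qs = d" by (simp add: qs_def del: upt_Suc)
  from vanishE[OF V this deg A'] obtain B where
    B: "independent B" "finite B" "card B = m" "B \<subseteq> span (A - {v})"
      "\<And>r w. r \<in> set qs \<Longrightarrow> w \<in> span B \<Longrightarrow> r w = 0"
    by blast
  have "q (t *s v + w) = t ^ Suc d * q v + q w" if "w \<in> span B" for t w
  proof -
    have "(\<Sum>a\<le>Suc d. t ^ a * qa a w) = (\<Sum>a\<in>{0, Suc d}. t ^ a * qa a w)"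
      using B(5)[OF _ that] by (intro sum.mono_neutral_right) (auto simp: qs_def simp del: upt_Suc)
    then show ?thesis unfolding qa(4) by (simp add: qa)
  qed
  with v B show ?thesis using that by blast
qed

lemma form_functionals_0: "form (functionals (*s)) b q \<Longrightarrow> 1 \<le> b \<Longrightarrow> q 0 = 0"
proof (induction rule: form.induct)
  case (form_step l q b)
  then have "Vector_Spaces.linear (*s) (*) l" by (simp add: functionals_def)
  then have "l 0 = 0" using Vector_Spaces.linear_iff[of "(*s)" "(*)" l] by (metis add_cancel_right_right)
  then show ?case by simp
qed simp_all

text \<open>Splitting off two lines leaves a diagonal form with coefficients \<open>q v1\<close> and
  \<open>q v2\<close>, which has a nontrivial zero \<open>u\<close>. Adding \<open>u\<close> to an
  isotropic subspace of the remaining part raises the dimension by one.\<close>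

lemma isotropic_form:
  assumes V: "\<And>m. \<exists>n. vanish (*s) d d m n"
    and alg: "\<And>a b :: 'a. \<exists>\<alpha> \<beta>. (\<alpha> \<noteq> 0 \<or> \<beta> = 1) \<and> \<alpha> ^ Suc d * a + \<beta> ^ Suc d * b = 0"
  shows "\<exists>n. \<forall>q A. form (functionals (*s)) (Suc d) q \<longrightarrow> independent A \<longrightarrow> finite A \<longrightarrow> card A = n \<longrightarrow>
     (\<exists>B. independent B \<and> finite B \<and> card B = m \<and> B \<subseteq> span A \<and> (\<forall>v\<in>span B. q v = 0))"
proof (induction m)
  case 0
  have "independent {} \<and> finite {} \<and> card {} = 0 \<and> {} \<subseteq> span A \<and> (\<forall>v\<in>span {}. q v = 0)"
    if "form (functionals (*s)) (Suc d) q" for q A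
    using form_functionals_0[OF that] by (simp add: independent_empty)
  then show ?case by blast
next
  case (Suc m)
  then obtain n where n: "\<And>q A. form (functionals (*s)) (Suc d) q \<Longrightarrow> independent A \<Longrightarrow> finite A \<Longrightarrow> card A = n \<Longrightarrow>
     \<exists>B. independent B \<and> finite B \<and> card B = m \<and> B \<subseteq> span A \<and> (\<forall>v\<in>span B. q v = 0)" by blast
  \<comment> \<open>The dimensions are chosen backwards: splitting off \<open>v2\<close> has to
    leave \<open>n\<close> vectors for the induction hypothesis, and splitting off \<open>v1\<close>
    has to leave \<open>Suc n2\<close> vectors, from which \<open>v2\<close> is taken.\<close>
  obtain n2 where n2: "vanish (*s) d d n n2" using V by blast
  obtain n1 where n1: "vanish (*s) d d (Suc n2) n1" using V by blast
  show ?case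
  proof (intro exI[of _ "Suc n1"] allI impI)
    fix q A assume q: "form (functionals (*s)) (Suc d) q" and A: "independent A" "finite A" "card A = Suc n1"
    obtain v1 B1 where B1: "v1 \<in> A" "independent B1" "finite B1" "card B1 = Suc n2" "B1 \<subseteq> span (A - {v1})"
      "\<And>t w. w \<in> span B1 \<Longrightarrow> q (t *s v1 + w) = t ^ Suc d * q v1 + q w"
      using split_line[OF n1 q A] by metis
    obtain v2 B2 where B2: "v2 \<in> B1" "independent B2" "finite B2" "card B2 = n" "B2 \<subseteq> span (B1 - {v2})"
      "\<And>t w. w \<in> span B2 \<Longrightarrow> q (t *s v2 + w) = t ^ Suc d * q v2 + q w"
      using split_line[OF n2 q B1(2-4)] by metis
    obtain B3 where B3: "independent B3" "finite B3" "card B3 = m" "B3 \<subseteq> span B2" "\<And>v. v \<in> span B3 \<Longrightarrow> q v = 0"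
      using n[OF q B2(2-4)] by blast
    obtain \<alpha> \<beta> where ab: "\<alpha> \<noteq> 0 \<or> \<beta> = 1" "\<alpha> ^ Suc d * q v1 + \<beta> ^ Suc d * q v2 = 0" using alg[of "q v1" "q v2"] by blast
    txt \<open>On the line of \<open>v1\<close>, the line of \<open>v2\<close> and the span of \<open>B2\<close> the form \<open>q\<close> is additive.\<close>
    define u where "u = \<alpha> *s v1 + \<beta> *s v2"
    have s32: "span B3 \<subseteq> span B2" using B3(4) by (simp add: span_minimal)
    have s21: "span B2 \<subseteq> span (B1 - {v2})" using B2(5) by (simp add: span_minimal)
    have s11: "span (B1 - {v2}) \<subseteq> span B1" by (intro span_mono) auto
    have s1A: "span B1 \<subseteq> span (A - {v1})" using B1(5) by (simp add: span_minimal)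
    have v2: "v2 \<in> span B1" using B2(1) by (rule span_base)
    have u: "u \<notin> span B3"
    proof
      assume u3: "u \<in> span B3"
      show False
      proof (cases "\<alpha> = 0")
        case True
        then have "u = v2" using ab(1) by (simp add: u_def)
        then have "v2 \<in> span (B1 - {v2})" using u3 s32 s21 by auto
        then show False using B1(2) B2(1) by (auto simp: dependent_def)
      next
        case False
        have "u - \<beta> *s v2 \<in> span (A - {v1})"
          using u3 s32 s21 s11 s1A v2 by (intro span_diff span_scale) auto
        then have "inverse \<alpha> *s (\<alpha> *s v1) \<in> span (A - {v1})"
          unfolding u_def by (intro span_scale[of "\<alpha> *s v1"]) simp
        then show False using A(1) B1(1) False by (auto simp: dependent_def)
      qed
    qed
    show "\<exists>B. independent B \<and> finite B \<and> card B = Suc m \<and> B \<subseteq> span A \<and> (\<forall>v\<in>span B. q v = 0)"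
    proof (intro exI[of _ "insert u B3"] conjI ballI)
      show "independent (insert u B3)" using u B3(1) by (simp add: independent_insert)
      have "u \<notin> B3" using u span_base by blast
      then show "card (insert u B3) = Suc m" using B3(2,3) by simp
      have "span (A - {v1}) \<subseteq> span A" by (intro span_mono) auto
      moreover have "v1 \<in> span A" using B1(1) by (rule span_base)
      ultimately have "u \<in> span A" unfolding u_def
        using v2 s1A by (intro span_add span_scale) auto
      moreover have "B3 \<subseteq> span A"
        using B3(4) s21 s11 s1A \<open>span (A - {v1}) \<subseteq> span A\<close> by blast
      ultimately show "insert u B3 \<subseteq> span A" by simp
      fix x assume "x \<in> span (insert u B3)"
      then obtain t where w: "x - t *s u \<in> span B3" by (auto simp: span_breakdown_eq)
      define w where "w = x - t *s u"
      have x: "x = (t * \<alpha>) *s v1 + ((t * \<beta>) *s v2 + w)"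
        by (simp add: w_def u_def scale_right_distrib)
      have "w \<in> span B2" using w s32 by (auto simp: w_def)
      moreover have "(t * \<beta>) *s v2 + w \<in> span B1"
        using v2 \<open>w \<in> span B2\<close> s21 s11 by (intro span_add span_scale) auto
      ultimately have "q x = t ^ Suc d * (\<alpha> ^ Suc d * q v1 + \<beta> ^ Suc d * q v2) + q w"
        unfolding x by (simp only: B1(6) B2(6) power_mult_distrib) (simp add: algebra_simps)
      then show "q x = 0" using ab(2) B3(5) w by (simp add: w_def)
    qed (use B3 in auto)
  qed
qed

text \<open>Inside the induction on the degree bound, the forms are treated one after another, each
  on a zero subspace of its predecessors. A form of top degree needs \<open>isotropic_form\<close>,
  one of lower degree falls under the outer induction; the maximum of the two dimensions serves
  either case.\<close>

lemma ex_vanish: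
  assumes alg: "\<And>d (a :: 'a) b. 1 \<le> d \<Longrightarrow> \<exists>\<alpha> \<beta>. (\<alpha> \<noteq> 0 \<or> \<beta> = 1) \<and> \<alpha> ^ d * a + \<beta> ^ d * b = 0"
  shows "\<exists>n. vanish (*s) d s m n"
proof (induction d arbitrary: s m)
  case 0
  have "vanish (*s) 0 s m m" unfolding vanish_def
  proof (intro allI impI)
    fix qs :: "('b \<Rightarrow> 'a) list" and A
    assume qs: "\<forall>q\<in>set qs. \<exists>b. 1 \<le> b \<and> b \<le> 0 \<and> form (functionals (*s)) b q" and A: "independent A" "finite A" "card A = m"
    from qs have "set qs = {}" by fastforce
    with A show "\<exists>B. independent B \<and> finite B \<and> card B = m \<and> B \<subseteq> span A \<and> (\<forall>q\<in>set qs. \<forall>v\<in>span B. q v = 0)"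
      by (intro exI[of _ A]) (auto intro: span_base)
  qed
  then show ?case by blast
next
  case (Suc d)
  show ?case
  proof (induction s arbitrary: m)
    case 0
    have "vanish (*s) (Suc d) 0 m m" unfolding vanish_def by (auto intro: span_base)
    then show ?case by blast
  next
    case (Suc s)
    from Suc.IH obtain n where n: "vanish (*s) (Suc d) s m n" by blast
    from \<open>\<And>s m. \<exists>n. vanish (*s) d s m n\<close> obtain n1 where n1: "vanish (*s) d 1 n n1" by blast
    from isotropic_form[OF \<open>\<And>s m. \<exists>n. vanish (*s) d s m n\<close> alg, where m = n] obtain n2 where
      n2: "\<And>q A. form (functionals (*s)) (Suc d) q \<Longrightarrow> independent A \<Longrightarrow> finite A \<Longrightarrow> card A = n2 \<Longrightarrow>
        \<exists>B. independent B \<and> finite B \<and> card B = n \<and> B \<subseteq> span A \<and> (\<forall>v\<in>span B. q v = 0)" by auto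
    have "vanish (*s) (Suc d) (Suc s) m (max n1 n2)" unfolding vanish_def
    proof (intro allI impI)
      fix qs :: "('b \<Rightarrow> 'a) list" and A
      assume len: "length qs = Suc s" and qs: "\<forall>q\<in>set qs. \<exists>b. 1 \<le> b \<and> b \<le> Suc d \<and> form (functionals (*s)) b q"
        and A: "independent A" "finite A" "card A = max n1 n2"
      obtain q qs' where q: "qs = q # qs'" "length qs' = s" using len by (cases qs) auto
      obtain b where b: "1 \<le> b" "b \<le> Suc d" "form (functionals (*s)) b q" using qs q by auto
      have "\<exists>B. independent B \<and> finite B \<and> card B = n \<and> B \<subseteq> span A \<and> (\<forall>v\<in>span B. q v = 0)"
      proof (cases "b = Suc d")
        case True
        obtain A' where A': "A' \<subseteq> A" "card A' = n2" using obtain_subset_with_card_n[of n2 A] A by auto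
        have "independent A'" "finite A'" 
          using independent_mono[OF A(1) A'(1)] finite_subset[OF A'(1) A(2)] by auto
        from n2[OF _ this A'(2), of q] b True obtain B where "independent B" "finite B" "card B = n"
          "B \<subseteq> span A'" "\<forall>v\<in>span B. q v = 0" by auto
        then show ?thesis using span_mono[OF A'(1)] by blast
      next
        case False
        obtain A' where A': "A' \<subseteq> A" "card A' = n1" using obtain_subset_with_card_n[of n1 A] A by auto
        have ind: "independent A'" "finite A'"
          using independent_mono[OF A(1) A'(1)] finite_subset[OF A'(1) A(2)] by auto
        have deg: "\<exists>b. 1 \<le> b \<and> b \<le> d \<and> form (functionals (*s)) b r" if "r \<in> set [q]" for r
          using that b False by (intro exI[of _ b]) auto
        have "length [q] = 1" by simp
        from vanishE[OF n1 this deg ind A'(2)] obtain B where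
          "independent B" "finite B" "card B = n" "B \<subseteq> span A'"
          and "\<And>r v. r \<in> set [q] \<Longrightarrow> v \<in> span B \<Longrightarrow> r v = 0" by blast
        then have "independent B" "finite B" "card B = n" "B \<subseteq> span A'" "\<forall>v\<in>span B. q v = 0"
          by simp_all
        then show ?thesis using span_mono[OF A'(1)] by blast
      qed
      then obtain B where B: "independent B" "finite B" "card B = n" "B \<subseteq> span A" "\<And>v. v \<in> span B \<Longrightarrow> q v = 0"
        by blast
      obtain C where C: "independent C" "finite C" "card C = m" "C \<subseteq> span B"
        "\<And>q v. q \<in> set qs' \<Longrightarrow> v \<in> span C \<Longrightarrow> q v = 0"
        using vanishE[OF n q(2) _ B(1-3)] qs q(1) by (metis list.set_intros(2))
      have "span C \<subseteq> span B" using C(4) by (simp add: span_minimal)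
      then have "\<forall>r\<in>set qs. \<forall>v\<in>span C. r v = 0" using B(5) C(5) q(1) by auto
      moreover have "C \<subseteq> span A" using C(4) B(4) span_minimal[OF B(4)] by auto
      ultimately show "\<exists>B. independent B \<and> finite B \<and> card B = m \<and> B \<subseteq> span A \<and> (\<forall>q\<in>set qs. \<forall>v\<in>span B. q v = 0)"
        using C by blast
    qed
    then show ?case by blast
  qed
qed

end

section \<open>Homomorphisms to an algebraically closed field\<close>

definition subring :: "'a::field set \<Rightarrow> bool" where
  "subring R \<longleftrightarrow> 0 \<in> R \<and> 1 \<in> R \<and> (\<forall>x\<in>R. - x \<in> R \<and> (\<forall>y\<in>R. x + y \<in> R \<and> x * y \<in> R))"

definition hom_on :: "'a::field set \<Rightarrow> ('a \<Rightarrow> 'k::field) \<Rightarrow> bool" where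
  "hom_on R g \<longleftrightarrow> g 1 = 1 \<and> (\<forall>x\<in>R. \<forall>y\<in>R. g (x + y) = g x + g y \<and> g (x * y) = g x * g y)"

definition polys_over :: "'a::field set \<Rightarrow> 'a poly set" where
  "polys_over R = {p. \<forall>i. coeff p i \<in> R}"

definition adjoin :: "'a::field set \<Rightarrow> 'a \<Rightarrow> 'a set" where
  "adjoin R a = (\<lambda>p. poly p a) ` polys_over R"

lemma subring_simps:
  assumes "subring R"
  shows "0 \<in> R" "1 \<in> R" "x \<in> R \<Longrightarrow> - x \<in> R" "x \<in> R \<Longrightarrow> y \<in> R \<Longrightarrow> x + y \<in> R"
    "x \<in> R \<Longrightarrow> y \<in> R \<Longrightarrow> x * y \<in> R"
  using assms by (auto simp: subring_def)

lemma subring_sum: "subring R \<Longrightarrow> (\<And>i. i \<in> I \<Longrightarrow> f i \<in> R) \<Longrightarrow> sum f I \<in> R"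
  by (induction I rule: infinite_finite_induct) (auto simp: subring_simps)

lemma subring_power: "subring R \<Longrightarrow> x \<in> R \<Longrightarrow> x ^ n \<in> R"
  by (induction n) (auto simp: subring_simps)

lemma polys_over_closed:
  assumes R: "subring R"
  shows "0 \<in> polys_over R" "1 \<in> polys_over R" "c \<in> R \<Longrightarrow> monom c n \<in> polys_over R"
    "p \<in> polys_over R \<Longrightarrow> - p \<in> polys_over R"
    "p \<in> polys_over R \<Longrightarrow> q \<in> polys_over R \<Longrightarrow> p + q \<in> polys_over R"
    "p \<in> polys_over R \<Longrightarrow> q \<in> polys_over R \<Longrightarrow> p - q \<in> polys_over R"
    "p \<in> polys_over R \<Longrightarrow> q \<in> polys_over R \<Longrightarrow> p * q \<in> polys_over R"
    "c \<in> R \<Longrightarrow> p \<in> polys_over R \<Longrightarrow> Polynomial.smult c p \<in> polys_over R"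
  using subring_simps(4)[OF R _ subring_simps(3)[OF R]]
  by (auto simp: polys_over_def subring_simps[OF R] coeff_mult intro!: subring_sum[OF R])

lemma subring_adjoin:
  assumes R: "subring R" shows "subring (adjoin R a)"
proof -
  have "poly p a \<in> adjoin R a" if "p \<in> polys_over R" for p
    using that by (auto simp: adjoin_def)
  from this[OF polys_over_closed(1)[OF R]] this[OF polys_over_closed(2)[OF R]]
    this[OF polys_over_closed(4)[OF R]] this[OF polys_over_closed(5)[OF R]] this[OF polys_over_closed(7)[OF R]]
  show ?thesis
    unfolding subring_def by (auto simp: adjoin_def)
qed

lemma adjoin_base: assumes R: "subring R" and x: "x \<in> R" shows "x \<in> adjoin R a"
  using polys_over_closed(3)[OF R x, of 0] by (auto simp: adjoin_def image_iff intro!: bexI[of _ "monom x 0"] simp: poly_monom)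

lemma adjoin_gen: assumes R: "subring R" shows "a \<in> adjoin R a"
  using polys_over_closed(3)[OF R subring_simps(2)[OF R], of 1]
  by (auto simp: adjoin_def image_iff poly_monom intro!: bexI[of _ "monom 1 1"])

section \<open>Homomorphisms defined on a subring\<close>

lemma hom_on_0:
  assumes "subring R" "hom_on R g" shows "g 0 = 0"
proof -
  have "g (0 + 0) = g 0 + g 0" using assms subring_simps(1) unfolding hom_on_def by blast
  then show ?thesis by (simp only: add_0_left add_cancel_right_right)
qed

lemma hom_on_sum:
  assumes "subring R" "hom_on R g" "\<And>i. i \<in> I \<Longrightarrow> f i \<in> R"
  shows "g (sum f I) = (\<Sum>i\<in>I. g (f i))"
  using assms(3)
proof (induction I rule: infinite_finite_induct)
  case (insert i I)
  then have "f i \<in> R" "sum f I \<in> R" using assms(1) by (auto intro: subring_sum)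
  then have "g (f i + sum f I) = g (f i) + g (sum f I)" using assms(2) by (simp add: hom_on_def)
  then show ?case using insert by simp
qed (simp_all add: hom_on_0[OF assms(1,2)])

lemma map_poly_hom_on:
  assumes R: "subring R" and g: "hom_on R g" and p: "p \<in> polys_over R" and q: "q \<in> polys_over R"
  shows "map_poly g (p + q) = map_poly g p + map_poly g q"
    and "map_poly g (p * q) = map_poly g p * map_poly g q"
proof -
  have pq: "coeff p i \<in> R" "coeff q i \<in> R" for i using p q by (auto simp: polys_over_def)
  note [simp] = coeff_map_poly[of g, OF hom_on_0[OF R g]]
  show "map_poly g (p + q) = map_poly g p + map_poly g q"
    using g pq by (intro poly_eqI) (simp add: hom_on_def)
  show "map_poly g (p * q) = map_poly g p * map_poly g q"
  proof (rule poly_eqI)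
    fix n
    have "g (\<Sum>i\<le>n. coeff p i * coeff q (n - i)) = (\<Sum>i\<le>n. g (coeff p i * coeff q (n - i)))"
      by (rule hom_on_sum[OF R g]) (simp add: pq subring_simps[OF R])
    also have "\<dots> = (\<Sum>i\<le>n. g (coeff p i) * g (coeff q (n - i)))"
      using g pq by (simp add: hom_on_def)
    finally show "coeff (map_poly g (p * q)) n = coeff (map_poly g p * map_poly g q) n"
      by (simp add: coeff_mult)
  qed
qed

lemma map_poly_hom_on_minus:
  assumes R: "subring R" and g: "hom_on R g" and p: "p \<in> polys_over R" and q: "q \<in> polys_over R"
  shows "map_poly g (p - q) = map_poly g p - map_poly g q"
  using map_poly_hom_on(1)[OF R g polys_over_closed(6)[OF R p q] q] by simp

text \<open>\<open>R[a]\<close> is the polynomial ring over \<open>R\<close> modulo the relations of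
  \<open>a\<close>, so \<open>a\<close> may be sent to any \<open>\<alpha>\<close> that satisfies
  the images of these relations. They also make the choice of a representing polynomial
  irrelevant.\<close>

lemma extend_hom_on:
  assumes R: "subring R" and g: "hom_on R g"
    and root: "\<And>p. p \<in> polys_over R \<Longrightarrow> poly p a = 0 \<Longrightarrow> poly (map_poly g p) \<alpha> = 0"
  obtains g' where "hom_on (adjoin R a) g'" "\<And>p. p \<in> polys_over R \<Longrightarrow> g' (poly p a) = poly (map_poly g p) \<alpha>"
    "\<And>x. x \<in> R \<Longrightarrow> g' x = g x"
proof -
  define g' where "g' x = poly (map_poly g (SOME p. p \<in> polys_over R \<and> poly p a = x)) \<alpha>" for x
  have g': "g' (poly p a) = poly (map_poly g p) \<alpha>" if p: "p \<in> polys_over R" for p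
  proof -
    let ?q = "SOME q. q \<in> polys_over R \<and> poly q a = poly p a"
    have q: "?q \<in> polys_over R \<and> poly ?q a = poly p a" by (rule someI[of _ p]) (use p in auto)
    then have "poly (map_poly g (?q - p)) \<alpha> = 0"
      by (intro root polys_over_closed(6)[OF R]) (use p in auto)
    then show ?thesis using map_poly_hom_on_minus[OF R g, of ?q p] p q by (simp add: g'_def)
  qed
  have base: "g' x = g x" if "x \<in> R" for x
    using g'[OF polys_over_closed(3)[OF R that, of 0]] hom_on_0[OF R g]
    by (simp add: poly_monom map_poly_monom)
  have "hom_on (adjoin R a) g'"
    unfolding hom_on_def
  proof (intro conjI ballI)
    show "g' 1 = 1" using base[OF subring_simps(2)[OF R]] g by (simp add: hom_on_def)
    fix x y assume "x \<in> adjoin R a" "y \<in> adjoin R a"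
    then obtain p q where p: "p \<in> polys_over R" "x = poly p a" and q: "q \<in> polys_over R" "y = poly q a"
      by (auto simp: adjoin_def)
    show "g' (x + y) = g' x + g' y"
      using g'[OF polys_over_closed(5)[OF R p(1) q(1)]] map_poly_hom_on(1)[OF R g p(1) q(1)]
      by (simp add: p q g')
    show "g' (x * y) = g' x * g' y"
      using g'[OF polys_over_closed(7)[OF R p(1) q(1)]] map_poly_hom_on(2)[OF R g p(1) q(1)]
      by (simp add: p q g')
  qed
  with g' base show ?thesis using that by blast
qed

text \<open>\<open>R\<close> is only a ring, so division requires a power of the leading coefficient
  in front. The measure separates zero from the nonzero constants, which have the same degree
  0.\<close>

lemma pseudo_division:
  assumes R: "subring R" and p: "p \<in> polys_over R" "p \<noteq> 0" and q: "q \<in> polys_over R"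
  shows "\<exists>k h r. h \<in> polys_over R \<and> r \<in> polys_over R \<and> Polynomial.smult (lead_coeff p ^ k) q = p * h + r \<and>
    (r = 0 \<or> degree r < degree p)"
  using q
proof (induction "if q = 0 then 0 else Suc (degree q)" arbitrary: q rule: less_induct)
  case less
  show ?case
  proof (cases "q = 0 \<or> degree q < degree p")
    case True
    then show ?thesis
      by (intro exI[of _ 0] exI[of _ "0::'a poly"] exI[of _ q]) (use less.prems polys_over_closed[OF R] in auto)
  next
    case False
    have lp: "lead_coeff p \<in> R" "lead_coeff q \<in> R" using p less.prems by (auto simp: polys_over_def)
    let ?m = "monom (lead_coeff q) (degree q - degree p)"
    define q' where "q' = Polynomial.smult (lead_coeff p) q - p * ?m"
    have q': "q' \<in> polys_over R"
      unfolding q'_def using lp p less.prems by (intro polys_over_closed[OF R]) auto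
    have "degree q' \<le> degree q"
      unfolding q'_def using False
      by (intro degree_diff_le degree_smult_le order.trans[OF degree_mult_le])
         (use degree_monom_le[of "lead_coeff q" "degree q - degree p"] in linarith)+
    moreover have "coeff q' (degree q) = 0"
    proof -
      have "coeff (p * ?m) (degree p + (degree q - degree p)) = lead_coeff p * lead_coeff q"
        by (subst mult.commute) (simp add: coeff_monom_mult)
      then show ?thesis using False by (simp add: q'_def)
    qed
    ultimately have "q' = 0 \<or> degree q' < degree q" by (rule eq_zero_or_degree_less)
    then have "(if q' = 0 then 0 else Suc (degree q')) < (if q = 0 then 0 else Suc (degree q))"
      using False by auto
    from less.hyps[OF this q'] obtain k h r where *: "h \<in> polys_over R" "r \<in> polys_over R"
      "Polynomial.smult (lead_coeff p ^ k) q' = p * h + r" "r = 0 \<or> degree r < degree p"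
      by blast
    have "Polynomial.smult (lead_coeff p ^ Suc k) q = p * (h + Polynomial.smult (lead_coeff p ^ k) ?m) + r"
    proof -
      have "Polynomial.smult (lead_coeff p ^ k) q' = Polynomial.smult (lead_coeff p ^ Suc k) q - p * Polynomial.smult (lead_coeff p ^ k) ?m"
        by (simp add: q'_def smult_diff_right mult.commute)
      then show ?thesis using *(3) by (simp add: algebra_simps)
    qed
    moreover have "h + Polynomial.smult (lead_coeff p ^ k) ?m \<in> polys_over R"
      using * lp by (intro polys_over_closed[OF R] subring_power[OF R])
    ultimately show ?thesis using * by blast
  qed
qed

text \<open>Elimination of one generator, in the manner of Chevalley's theorem. If \<open>a\<close>
  is transcendental over \<open>R\<close>, then \<open>r\<close> is a leading coefficient; otherwise
  \<open>r\<close> combines the leading coefficient of a minimal relation of \<open>a\<close> with a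
  multiple of \<open>s\<close> that lies in \<open>R\<close>.\<close>

lemma extend_hom_on_nonvanishing:
  fixes R :: "'a::field set"
  assumes R: "subring R" and s: "s \<in> adjoin R a" "s \<noteq> 0" and inf: "infinite (UNIV :: 'k::alg_closed_field set)"
  shows "\<exists>r\<in>R. r \<noteq> 0 \<and> (\<forall>g :: 'a \<Rightarrow> 'k. hom_on R g \<longrightarrow> g r \<noteq> 0 \<longrightarrow>
    (\<exists>g'. hom_on (adjoin R a) g' \<and> (\<forall>x\<in>R. g' x = g x) \<and> g' s \<noteq> 0))"
proof (cases "\<exists>p\<in>polys_over R. p \<noteq> 0 \<and> poly p a = 0")
  case False
  obtain q where q: "q \<in> polys_over R" "s = poly q a" using s by (auto simp: adjoin_def)
  have "q \<noteq> 0" using q s by auto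
  show ?thesis
  proof (intro bexI[of _ "lead_coeff q"] conjI allI impI)
    show "lead_coeff q \<noteq> 0" "lead_coeff q \<in> R" using q \<open>q \<noteq> 0\<close> by (auto simp: polys_over_def)
    fix g :: "'a \<Rightarrow> 'k" assume g: "hom_on R g" "g (lead_coeff q) \<noteq> 0"
    then have "map_poly g q \<noteq> 0"
      using coeff_map_poly[of g, OF hom_on_0[OF R g(1)], of q "degree q"] by auto
    \<comment> \<open>There is no relation to respect, so \<open>\<alpha>\<close> only has to avoid
      the finitely many roots of the image of \<open>q\<close>.\<close>
    then obtain \<alpha> where \<alpha>: "poly (map_poly g q) \<alpha> \<noteq> 0"
      using ex_new_if_finite[OF inf poly_roots_finite[of "map_poly g q"]] by auto
    have "poly (map_poly g p) \<alpha> = 0" if "p \<in> polys_over R" "poly p a = 0" for p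
      using False that by auto
    from extend_hom_on[OF R g(1) this] obtain g' where
      "hom_on (adjoin R a) g'" "\<And>p. p \<in> polys_over R \<Longrightarrow> g' (poly p a) = poly (map_poly g p) \<alpha>"
      "\<And>x. x \<in> R \<Longrightarrow> g' x = g x" by blast
    with q \<alpha> show "\<exists>g'. hom_on (adjoin R a) g' \<and> (\<forall>x\<in>R. g' x = g x) \<and> g' s \<noteq> 0" by auto
  qed
next
  case True
  define P where "P p \<longleftrightarrow> p \<in> polys_over R \<and> p \<noteq> 0 \<and> poly p a = 0" for p
  obtain p where p: "P p" and p_min: "\<And>p'. P p' \<Longrightarrow> degree p \<le> degree p'"
    using True ex_has_least_nat[of P _ degree] unfolding P_def by blast
  txt \<open>
    A polynomial of least degree whose value at \<open>a\<close> is a nonzero multiple of \<open>s\<close> turns out to be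
    constant, so \<open>s\<close> divides a nonzero element of \<open>R\<close>.
  \<close>
  define H where "H h \<longleftrightarrow> h \<in> polys_over R \<and> poly h a \<noteq> 0 \<and> (\<exists>w\<in>adjoin R a. poly h a = s * w)" for h
  obtain q where q: "q \<in> polys_over R" "s = poly q a" using s by (auto simp: adjoin_def)
  have "H q" unfolding H_def using q s adjoin_base[OF R subring_simps(2)[OF R]]
    by (auto intro!: bexI[of _ 1])
  then obtain h where h: "H h" and h_min: "\<And>h'. H h' \<Longrightarrow> degree h \<le> degree h'"
    using ex_has_least_nat[of H _ degree] by blast
  have A: "subring (adjoin R a)" by (rule subring_adjoin[OF R])
  have adj: "poly u a \<in> adjoin R a" if "u \<in> polys_over R" for u using that by (auto simp: adjoin_def)
  obtain w where w: "w \<in> adjoin R a" "poly h a = s * w" "poly h a \<noteq> 0" "h \<in> polys_over R" using h by (auto simp: H_def)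
  have p': "p \<in> polys_over R" "p \<noteq> 0" "poly p a = 0" using p by (auto simp: P_def)
  have lc: "lead_coeff u ^ k \<in> R" if "u \<in> polys_over R" for u k
    using that by (intro subring_power[OF R]) (auto simp: polys_over_def)
  have "h \<noteq> 0" using w by auto
  have hp: "degree h < degree p"
  proof (rule ccontr)
    assume "\<not> degree h < degree p"
    obtain k u r where *: "u \<in> polys_over R" "r \<in> polys_over R" "Polynomial.smult (lead_coeff p ^ k) h = p * u + r"
      "r = 0 \<or> degree r < degree p" using pseudo_division[OF R p'(1,2) w(4)] by blast
    from *(3) have "poly (Polynomial.smult (lead_coeff p ^ k) h) a = poly (p * u + r) a" by simp
    then have "poly r a = lead_coeff p ^ k * poly h a" using p'(3) by simp
    then have "H r" unfolding H_def using * w p'(2) adjoin_base[OF R lc[OF p'(1)]]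
      by (auto intro!: bexI[of _ "lead_coeff p ^ k * w"] subring_simps(5)[OF A] simp: mult.left_commute)
    then have "degree h \<le> degree r" "r \<noteq> 0" using h_min by (auto simp: H_def)
    then show False using *(4) \<open>\<not> degree h < degree p\<close> by auto
  qed
  \<comment> \<open>Dividing \<open>p\<close> by \<open>h\<close> leaves a remainder that is zero or
    of smaller degree than \<open>h\<close>, with a multiple of \<open>s\<close> as its value; by
    minimality of \<open>h\<close> it vanishes at \<open>a\<close>. Then the quotient is a relation
    of \<open>a\<close> of smaller degree than \<open>p\<close>.\<close>
  have "degree h = 0"
  proof (rule ccontr)
    assume dh: "degree h \<noteq> 0"
    obtain k u r where *: "u \<in> polys_over R" "r \<in> polys_over R" "Polynomial.smult (lead_coeff h ^ k) p = h * u + r"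
      "r = 0 \<or> degree r < degree h" using pseudo_division[OF R w(4) \<open>h \<noteq> 0\<close> p'(1)] by blast
    from *(3) have "poly (Polynomial.smult (lead_coeff h ^ k) p) a = poly (h * u + r) a" by simp
    then have r: "poly r a = s * (w * (- poly u a))" using p'(3) w(2) by (simp add: eq_neg_iff_add_eq_0 add.commute mult.assoc)
    have "w * (- poly u a) \<in> adjoin R a" using w adj[OF *(1)] by (intro subring_simps[OF A])
    then have "H r" if "poly r a \<noteq> 0" unfolding H_def using that r *(2) by blast
    then have r0: "poly r a = 0" using *(4) h_min[of r] dh by (metis leD poly_0)
    then have ua: "poly u a = 0" using r w(2,3) s by auto
    have "degree (h * u + r) = degree p"
      using *(3) \<open>h \<noteq> 0\<close> by (metis degree_smult_eq leading_coeff_0_iff power_not_zero)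
    have "u \<noteq> 0"
    proof
      assume "u = 0"
      then have "degree r = degree p" using \<open>degree (h * u + r) = degree p\<close> by simp
      then show False using *(4) hp p'(2) *(3) \<open>u = 0\<close> \<open>h \<noteq> 0\<close> by auto
    qed
    then have "degree (h * u) = degree h + degree u" using \<open>h \<noteq> 0\<close> by (simp add: degree_mult_eq)
    moreover have "degree (h * u + r) = degree (h * u)"
    proof (cases "r = 0")
      case False
      then have "degree r < degree (h * u)" using *(4) calculation by linarith
      then show ?thesis by (rule degree_add_eq_left)
    qed simp
    ultimately have "degree u < degree p" using \<open>degree (h * u + r) = degree p\<close> dh by linarith
    moreover have "P u" using *(1) \<open>u \<noteq> 0\<close> ua by (simp add: P_def)
    ultimately show False using p_min[of u] by simp
  qed
  \<comment> \<open>The first factor keeps the image of \<open>p\<close> nonconstant, so that it has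
    a root, and allows its powers to be cancelled after pseudo-division. The second equals
    \<open>s * w\<close>, which prevents \<open>s\<close> from being killed.\<close>
  define r where "r = lead_coeff p * coeff h 0"
  have h0: "poly h a = coeff h 0" using \<open>degree h = 0\<close> by (metis degree_eq_zeroE coeff_pCons_0 mult_zero_right add_0_right poly_pCons poly_0)
  have hR: "coeff h 0 \<in> R" "lead_coeff p \<in> R" using w(4) p'(1) by (auto simp: polys_over_def)
  show ?thesis
  proof (intro bexI[of _ r] conjI allI impI)
    show "r \<noteq> 0" unfolding r_def using p'(2) w(3) h0 by simp
    show "r \<in> R" unfolding r_def using hR by (intro subring_simps[OF R])
    fix g :: "'a \<Rightarrow> 'k" assume g: "hom_on R g" "g r \<noteq> 0"
    then have gr: "g (lead_coeff p) \<noteq> 0" "g (coeff h 0) \<noteq> 0"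
      unfolding r_def using hR by (auto simp: hom_on_def)
    have g0: "g 0 = 0" by (rule hom_on_0[OF R g(1)])
    have "degree p \<noteq> 0"
      using p' by (metis degree_eq_zeroE poly_pCons poly_0 mult_zero_right add_0_right pCons_eq_0_iff)
    moreover have "degree p \<le> degree (map_poly g p)"
      by (rule le_degree) (simp add: coeff_map_poly[of g, OF g0] gr)
    ultimately obtain \<alpha> where \<alpha>: "poly (map_poly g p) \<alpha> = 0"
      using alg_closed_imp_poly_has_root[of "map_poly g p"] by auto
    have "poly (map_poly g u) \<alpha> = 0" if u: "u \<in> polys_over R" "poly u a = 0" for u
    proof -
      obtain k v e where *: "v \<in> polys_over R" "e \<in> polys_over R" "Polynomial.smult (lead_coeff p ^ k) u = p * v + e"
        "e = 0 \<or> degree e < degree p" using pseudo_division[OF R p'(1,2) u(1)] by blast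
      from *(3) have "poly (Polynomial.smult (lead_coeff p ^ k) u) a = poly (p * v + e) a" by simp
      then have "poly e a = 0" using p'(3) u(2) by simp
      then have "e = 0" using p_min[of e] *(2,4) unfolding P_def by (meson leD)
      then have "monom (lead_coeff p ^ k) 0 * u = p * v" using *(3) by (simp add: monom_0)
      moreover have m: "monom (lead_coeff p ^ k) 0 \<in> polys_over R" by (intro polys_over_closed[OF R] lc p')
      ultimately have "map_poly g (monom (lead_coeff p ^ k) 0) * map_poly g u = map_poly g p * map_poly g v"
        using map_poly_hom_on(2)[OF R g(1)] u(1) p'(1) *(1) by metis
      then have "poly (map_poly g (monom (lead_coeff p ^ k) 0) * map_poly g u) \<alpha> = 0" using \<alpha> by simp
      moreover have "g (lead_coeff p ^ k) = g (lead_coeff p) ^ k"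
        using g(1) hR(2) by (induction k) (auto simp: hom_on_def subring_power[OF R])
      ultimately show ?thesis using gr by (simp add: map_poly_monom g0 poly_monom)
    qed
    from extend_hom_on[OF R g(1) this] obtain g' where g':
      "hom_on (adjoin R a) g'" "\<And>x. x \<in> R \<Longrightarrow> g' x = g x" by blast
    have "g' (s * w) = g (coeff h 0)" using g'(2)[OF hR(1)] w(2) h0 by simp
    then have "g' s \<noteq> 0" using gr(2) g'(1) s(1) w(1) by (auto simp: hom_on_def)
    with g' show "\<exists>g'. hom_on (adjoin R a) g' \<and> (\<forall>x\<in>R. g' x = g x) \<and> g' s \<noteq> 0" by blast
  qed
qed

text \<open>This is a weak Nullstellensatz for the algebra generated by \<open>S\<close>. The
  induction over \<open>S\<close> carries more: every nonzero element survives under some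
  homomorphism, because adjoining the next generator requires the element \<open>r\<close> found by
  elimination to survive. At the end this is applied to 1.\<close>

lemma hom_to_base_field:
  fixes \<iota> :: "'k::alg_closed_field \<Rightarrow> 'a::field"
  assumes "finite S" and \<iota>: "\<iota> 1 = 1" "\<And>x y. \<iota> (x + y) = \<iota> x + \<iota> y" "\<And>x y. \<iota> (x * y) = \<iota> x * \<iota> y"
    and inf: "infinite (UNIV :: 'k set)"
  obtains R g where "subring R" "range \<iota> \<subseteq> R" "S \<subseteq> R" "hom_on R g" "\<And>c. g (\<iota> c) = c"
proof -
  have "\<exists>R. subring R \<and> range \<iota> \<subseteq> R \<and> S \<subseteq> R \<and>
    (\<forall>s\<in>R. s \<noteq> 0 \<longrightarrow> (\<exists>g. hom_on R g \<and> (\<forall>c. g (\<iota> c) = c) \<and> g s \<noteq> 0))"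
    using assms(1)
  proof induction
    case empty
    have \<iota>0: "\<iota> 0 = 0" using \<iota>(2)[of 0 0] by (simp only: add_0_left add_cancel_right_right)
    have inj: "inj \<iota>"
    proof (rule injI)
      fix x y assume xy: "\<iota> x = \<iota> y"
      have "\<iota> (x - y) = 0" using \<iota>(2)[of "x - y" y] xy by simp
      show "x = y"
      proof (rule ccontr)
        assume "x \<noteq> y"
        then have "\<iota> ((x - y) * inverse (x - y)) = 1" using \<iota>(1) by simp
        with \<open>\<iota> (x - y) = 0\<close> show False by (simp add: \<iota>(3))
      qed
    qed
    have um: "\<iota> (- x) = - \<iota> x" for x
      using \<iota>(2)[of x "- x"] \<iota>0 by (simp add: eq_neg_iff_add_eq_0 add.commute)
    have "subring (range \<iota>)"
      unfolding subring_def using \<iota>0 \<iota> um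
      by (auto simp flip: \<iota>(2,3) um intro: range_eqI[of _ _ 0] range_eqI[of _ _ 1])
    moreover have "hom_on (range \<iota>) (inv_into UNIV \<iota>)"
      unfolding hom_on_def using inj \<iota> by (auto simp: inv_f_f simp flip: \<iota>(2,3)) (metis inv_f_f)
    ultimately show ?case using inj \<iota>0
      by (intro exI[of _ "range \<iota>"]) (auto intro!: exI[of _ "inv_into UNIV \<iota>"])
  next
    case (insert a S)
    then obtain R where R: "subring R" "range \<iota> \<subseteq> R" "S \<subseteq> R"
      "\<And>s. s \<in> R \<Longrightarrow> s \<noteq> 0 \<Longrightarrow> \<exists>g. hom_on R g \<and> (\<forall>c. g (\<iota> c) = c) \<and> g s \<noteq> 0" by blast
    show ?case
    proof (intro exI[of _ "adjoin R a"] conjI ballI impI)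
      show "subring (adjoin R a)" by (rule subring_adjoin[OF R(1)])
      show "range \<iota> \<subseteq> adjoin R a" "insert a S \<subseteq> adjoin R a"
        using R(2,3) adjoin_base[OF R(1)] adjoin_gen[OF R(1)] by auto
      fix s assume "s \<in> adjoin R a" "s \<noteq> 0"
      from extend_hom_on_nonvanishing[OF R(1) this inf] obtain r where r: "r \<in> R" "r \<noteq> 0"
        "\<And>g :: 'a \<Rightarrow> 'k. hom_on R g \<Longrightarrow> g r \<noteq> 0 \<Longrightarrow>
          \<exists>g'. hom_on (adjoin R a) g' \<and> (\<forall>x\<in>R. g' x = g x) \<and> g' s \<noteq> 0" by blast
      obtain g where g: "hom_on R g" "\<And>c. g (\<iota> c) = c" "g r \<noteq> 0" using R(4)[OF r(1,2)] by blast
      from r(3)[OF g(1,3)] obtain g' where "hom_on (adjoin R a) g'" "\<And>x. x \<in> R \<Longrightarrow> g' x = g x" "g' s \<noteq> 0"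
        by blast
      then show "\<exists>g'. hom_on (adjoin R a) g' \<and> (\<forall>c. g' (\<iota> c) = c) \<and> g' s \<noteq> 0"
        using g(2) R(2) by (intro exI[of _ g']) (simp add: image_subset_iff)
    qed
  qed
  then obtain R where "subring R" "range \<iota> \<subseteq> R" "S \<subseteq> R"
    "\<forall>s\<in>R. s \<noteq> 0 \<longrightarrow> (\<exists>g. hom_on R g \<and> (\<forall>c. g (\<iota> c) = c) \<and> g s \<noteq> 0)" by blast
  moreover from this have "\<exists>g. hom_on R g \<and> (\<forall>c. g (\<iota> c) = c)" using subring_simps(2)[of R] zero_neq_one by metis
  ultimately show ?thesis using that by blast
qed

section \<open>Lifting to power series\<close>

text \<open>
  This is \<open>t\<^sup>d P(x / t)\<close>, homogenized in degree \<open>d\<close> by the value \<open>u0\<close> of an extra coordinate.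
\<close>

definition scaled_val :: "nat \<Rightarrow> ('k::field \<times> nat list) list \<Rightarrow> 'k \<Rightarrow> (nat \<Rightarrow> 'k fps) \<Rightarrow> 'k fps" where
  "scaled_val d P u0 x = (\<Sum>(c, is)\<leftarrow>P. fps_const c * (fps_const u0 * fps_X) ^ (d - length is) * (\<Prod>i\<leftarrow>is. x i))"

lemma scaled_val_simps [simp]: "scaled_val d [] u0 x = 0"
  "scaled_val d ((c, is) # P) u0 x =
    fps_const c * (fps_const u0 * fps_X) ^ (d - length is) * (\<Prod>i\<leftarrow>is. x i) + scaled_val d P u0 x"
  by (simp_all add: scaled_val_def)

section \<open>Coefficients of the rescaled polynomial\<close>

lemma fps_mult_nth_cong:
  fixes f f' g g' :: "'k::comm_ring_1 fps"
  assumes "\<And>i. i \<le> n \<Longrightarrow> f $ i = f' $ i" "\<And>i. i \<le> n \<Longrightarrow> g $ i = g' $ i" "k \<le> n"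
  shows "(f * g) $ k = (f' * g') $ k"
  unfolding fps_mult_nth using assms by (intro sum.cong) auto

lemma scaled_val_nth_cong:
  assumes "\<And>a i. i \<le> n \<Longrightarrow> x a $ i = y a $ i" "k \<le> n"
  shows "scaled_val d P u0 x $ k = scaled_val d P u0 y $ k"
proof -
  have "(\<Prod>i\<leftarrow>is. x i) $ k = (\<Prod>i\<leftarrow>is. y i) $ k" if "k \<le> n" for "is" k
    using that
  proof (induction "is" arbitrary: k)
    case (Cons i "is")
    then show ?case using assms(1) by (auto intro!: fps_mult_nth_cong[where n = n])
  qed simp
  then show ?thesis
    using assms(2) by (induction P) (auto intro!: fps_mult_nth_cong[where n = n])
qed

text \<open>The product rule with explicit remainder: \<open>z * p0 + y0 * D\<close> is the
  derivative at the constant terms, and the rest of the change has one more factor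
  \<open>X\<close>.\<close>

lemma perturb_product:
  fixes X :: "'r::comm_ring_1"
  assumes "p = p0 + X * b" "y = y0 + X * a"
  shows "(y + X * T * z) * (p + X * T * (D + X * e)) =
    y * p + X * T * ((z * p0 + y0 * D) + X * (z * b + a * D + y * e + T * z * (D + X * e)))"
  unfolding assms by (simp only: algebra_simps)

text \<open>To first order the change is the derivative at the constant terms. Monomials of degree
  below \<open>d\<close> carry an extra factor \<open>t\<close>, which moves their contribution one
  order further, so only the leading form is seen.\<close>

lemma scaled_val_perturb:
  fixes x :: "nat \<Rightarrow> 'k::field fps" and z :: "nat \<Rightarrow> 'k"
  assumes "\<forall>(c, is)\<in>set P. length is \<le> d"
  shows "\<exists>e. scaled_val d P u0 (\<lambda>a. x a + fps_X ^ Suc n * fps_const (z a)) = scaled_val d P u0 x +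
    fps_X ^ Suc n * (fps_const (term_deriv (\<lambda>c. c) (filter (\<lambda>(c, is). length is = d) P) (\<lambda>a. x a $ 0) z) + fps_X * e)"
proof -
  have const: "\<exists>e. (f :: 'k fps) = fps_const (f $ 0) + fps_X * e" for f
  proof -
    have "f = fps_const (f $ 0) + fps_X * fps_shift 1 f"
      by (rule fps_ext) (simp add: fps_X_mult_nth)
    then show ?thesis by blast
  qed
  have prod: "\<exists>e. (\<Prod>i\<leftarrow>is. x i + fps_X ^ Suc n * fps_const (z i)) = (\<Prod>i\<leftarrow>is. x i) +
    fps_X ^ Suc n * (fps_const (mon_deriv is (\<lambda>a. x a $ 0) z) + fps_X * e)" for "is"
  proof (induction "is")
    case Nil
    show ?case by (intro exI[of _ 0]) simp
  next
    case (Cons i "is")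
    then obtain e where e: "(\<Prod>i\<leftarrow>is. x i + fps_X ^ Suc n * fps_const (z i)) = (\<Prod>i\<leftarrow>is. x i) +
      fps_X ^ Suc n * (fps_const (mon_deriv is (\<lambda>a. x a $ 0) z) + fps_X * e)" by blast
    obtain a where a: "x i = fps_const (x i $ 0) + fps_X * a" using const by blast
    obtain b where b: "(\<Prod>i\<leftarrow>is. x i) = fps_const ((\<Prod>i\<leftarrow>is. x i) $ 0) + fps_X * b" using const by blast
    have c0: "(\<Prod>i\<leftarrow>is. x i) $ 0 = (\<Prod>i\<leftarrow>is. x i $ 0)"
      by (induction "is") (simp_all add: fps_mult_nth_0)
    let ?D = "fps_const (mon_deriv is (\<lambda>a. x a $ 0) z)" and ?p = "\<Prod>i\<leftarrow>is. x i" and ?q = "fps_const (\<Prod>i\<leftarrow>is. x i $ 0)"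
    define T where "T = (fps_X :: 'k fps) ^ n"
    have T: "fps_X ^ Suc n = fps_X * T" by (simp add: T_def)
    let ?y = "fps_const (x i $ 0)" and ?z = "fps_const (z i)"
    have "(x i + fps_X * T * ?z) * (?p + fps_X * T * (?D + fps_X * e)) =
      x i * ?p + fps_X * T * ((?z * ?q + ?y * ?D) +
        fps_X * (?z * b + a * ?D + x i * e + T * ?z * (?D + fps_X * e)))"
      by (rule perturb_product[OF b[unfolded c0] a])
    moreover have "?z * ?q + ?y * ?D = fps_const (mon_deriv (i # is) (\<lambda>a. x a $ 0) z)"
      by simp
    ultimately show ?case
      unfolding T list.map prod_list.Cons e[unfolded T] by metis
  qed
  show ?thesis using assms
  proof (induction P)
    case Nil
    show ?case by (intro exI[of _ 0]) simp
  next
    case (Cons p P)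
    obtain c "is" where p: "p = (c, is)" by fastforce
    have len: "length is \<le> d" using Cons.prems p by simp
    from Cons obtain e where e: "scaled_val d P u0 (\<lambda>a. x a + fps_X ^ Suc n * fps_const (z a)) = scaled_val d P u0 x +
      fps_X ^ Suc n * (fps_const (term_deriv (\<lambda>c. c) (filter (\<lambda>(c, is). length is = d) P) (\<lambda>a. x a $ 0) z) + fps_X * e)"
      by auto
    obtain f where f: "(\<Prod>i\<leftarrow>is. x i + fps_X ^ Suc n * fps_const (z i)) = (\<Prod>i\<leftarrow>is. x i) +
      fps_X ^ Suc n * (fps_const (mon_deriv is (\<lambda>a. x a $ 0) z) + fps_X * f)" using prod by blast
    show ?case
    proof (cases "length is = d")
      case True
      show ?thesis unfolding p scaled_val_simps e f using True
        by (intro exI[of _ "fps_const c * f + e"]) (simp add: algebra_simps del: power_Suc flip: fps_const_mult fps_const_add)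
    next
      case False
      then obtain k where k: "d - length is = Suc k" using len by (metis diff_is_0_eq le_antisym not0_implies_Suc)
      have filt: "filter (\<lambda>(c, is). length is = d) ((c, is) # P) = filter (\<lambda>(c, is). length is = d) P"
        using False by simp
      show ?thesis unfolding p scaled_val_simps e f k filt
        by (intro exI[of _ "fps_const c * (fps_const u0 * (fps_const u0 * fps_X) ^ k) *
              (fps_const (mon_deriv is (\<lambda>a. x a $ 0) z) + fps_X * f) + e"])
           (simp only: power_Suc algebra_simps)
    qed
  qed
qed

text \<open>The power of \<open>y u * t\<close> completes each monomial to degree \<open>d\<close>.
  Hence the error of every approximation is again a form of degree \<open>d\<close>, to which
  surjectivity of the differential applies.\<close>

lemma form_scaled_val:
  fixes Z :: "nat \<Rightarrow> 'u \<Rightarrow> 'k::field fps"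
  assumes "\<forall>(c, is)\<in>set P. length is \<le> d" and Z: "\<And>a j. (\<lambda>u. Z a u $ j) \<in> L" and y: "y \<in> L"
  shows "form L d (\<lambda>u. scaled_val d P (y u) (\<lambda>a. Z a u) $ j)"
proof -
  define cf where "cf b F \<longleftrightarrow> (\<forall>j. form L b (\<lambda>u. F u $ j))" for b and F :: "'u \<Rightarrow> 'k fps"
  have mult: "cf (a + b) (\<lambda>u. F u * H u)" if "cf a F" "cf b H" for a b F H
    using that unfolding cf_def fps_mult_nth by (auto intro!: form_sum form_mult)
  have c: "cf 0 (\<lambda>_. f)" for f by (simp add: cf_def form_const)
  have "form L 1 (\<lambda>u. fps_const (y u) $ j)" for j
    using form_linear[OF y] form_zero[of L 1] by (cases "j = 0") auto
  then have "cf 1 (\<lambda>u. fps_const (y u))" by (simp add: cf_def)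
  then have "cf 1 (\<lambda>u. fps_const (y u) * fps_X)" using mult[OF _ c] by fastforce
  then have pow: "cf k (\<lambda>u. (fps_const (y u) * fps_X) ^ k)" for k
  proof (induction k)
    case (Suc k)
    from mult[OF Suc.prems Suc.IH[OF Suc.prems]] show ?case by simp
  qed (use c[of 1] in simp)
  have prod: "cf (length is) (\<lambda>u. \<Prod>i\<leftarrow>is. Z i u)" for "is"
  proof (induction "is")
    case (Cons i "is")
    have "cf 1 (Z i)" unfolding cf_def using form_linear[OF Z] by simp
    from mult[OF this Cons] show ?case by simp
  qed (use c[of 1] in simp)
  have "cf d (\<lambda>u. scaled_val d P (y u) (\<lambda>a. Z a u))"
    using assms(1)
  proof (induction P)
    case (Cons p P)
    obtain k "is" where p: "p = (k, is)" by fastforce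
    have "length is \<le> d" using Cons.prems p by simp
    with mult[OF mult[OF c[of "fps_const k"] pow[of "d - length is"]] prod[of "is"]]
    have "cf d (\<lambda>u. fps_const k * (fps_const (y u) * fps_X) ^ (d - length is) * (\<Prod>i\<leftarrow>is. Z i u))" by simp
    moreover have "cf d (\<lambda>u. scaled_val d P (y u) (\<lambda>a. Z a u))" using Cons by simp
    ultimately show ?case unfolding p by (auto simp: cf_def intro: form_add)
  qed (simp add: cf_def form_zero)
  then show ?thesis by (simp add: cf_def)
qed

text \<open>All corrections have positive order in \<open>t\<close>, so the derivative that matters
  is always the one at \<open>\<Phi>\<close>, and its surjectivity removes the error coefficient by
  coefficient. The iteration can start because both sides vanish at \<open>t = 0\<close>, by
  \<open>1 \<le> d\<close> and the vanishing of \<open>T\<close> along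
  \<open>\<Phi>\<close>.\<close>

lemma hensel_series:
  fixes P :: "('k::field \<times> nat list) list" and d :: nat
  defines "T \<equiv> filter (\<lambda>(c, is). length is = d) P"
  assumes P: "\<forall>(c, is)\<in>set P. length is \<le> d" and d: "1 \<le> d" and m: "0 < m"
    and \<Phi>: "\<And>a. \<Phi> a \<in> Lin m" "\<And>u. term_val (\<lambda>c. c) T (\<lambda>a. \<Phi> a u) = 0"
    and sub: "\<And>w. form (Lin m) d w \<Longrightarrow> \<exists>\<Psi>. (\<forall>a. \<Psi> a \<in> Lin m) \<and>
         (\<forall>u. w u = term_deriv (\<lambda>c. c) T (\<lambda>a. \<Phi> a u) (\<lambda>a. \<Psi> a u))"
    and q: "form (Lin m) d q"
  shows "\<exists>x. \<forall>u. scaled_val d P (u 0) (\<lambda>a. \<Sum>i<m. x a i * fps_const (u i)) = fps_X ^ d * fps_const (q u)"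
proof -
  define rhs where "rhs u = fps_X ^ d * fps_const (q u)" for u
  \<comment> \<open>All coefficients are kept linear in \<open>u\<close>, so that the limit is a
    matrix of power series \<open>x a i\<close> independent of \<open>u\<close>.\<close>
  define I where "I n Z \<longleftrightarrow> (\<forall>a j. (\<lambda>u. Z a u $ j) \<in> Lin m) \<and> (\<forall>a u. Z a u $ 0 = \<Phi> a u) \<and>
      (\<forall>u. \<forall>j\<le>n. scaled_val d P (u 0) (\<lambda>a. Z a u) $ j = rhs u $ j)" for n and Z :: "nat \<Rightarrow> (nat \<Rightarrow> 'k) \<Rightarrow> 'k fps"
  have rhs0: "rhs u $ 0 = 0" for u using d by (simp add: rhs_def fps_X_power_mult_nth)
  have base: "scaled_val d P (u 0) (\<lambda>a. fps_const (\<Phi> a u)) $ 0 = 0" for u :: "nat \<Rightarrow> 'k"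
  proof -
    have "(\<Prod>i\<leftarrow>is. fps_const (\<Phi> i u)) = fps_const (\<Prod>i\<leftarrow>is. \<Phi> i u)" for "is"
      by (induction "is") simp_all
    then have "scaled_val d P (u 0) (\<lambda>a. fps_const (\<Phi> a u)) $ 0 = term_val (\<lambda>c. c) T (\<lambda>a. \<Phi> a u)"
      using P unfolding T_def
      by (induction P) (auto simp: fps_mult_nth_0 power_0_left)
    then show ?thesis using \<Phi>(2) by simp
  qed
  have "\<exists>Z. \<forall>n. I n (Z n) \<and> (\<forall>a u. \<forall>j\<le>n. Z (Suc n) a u $ j = Z n a u $ j)"
  proof (rule dependent_nat_choice)
    have "(\<lambda>u. fps_const (\<Phi> a u) $ j) \<in> Lin m" for a j
      using \<Phi>(1)[of a] Lin_0[of m] by (cases "j = 0") auto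
    then show "\<exists>Z. I 0 Z"
      using base rhs0 by (intro exI[of _ "\<lambda>a u. fps_const (\<Phi> a u)"]) (simp add: I_def)
  next
    fix Z n assume Z: "I n Z"
    \<comment> \<open>The first coefficient that may still be wrong.\<close>
    define w where "w u = rhs u $ Suc n - scaled_val d P (u 0) (\<lambda>a. Z a u) $ Suc n" for u
    have "form (Lin m) d w"
      unfolding w_def
    proof (rule form_diff)
      show "form (Lin m) d (\<lambda>u. rhs u $ Suc n)"
        using q form_zero[of "Lin m" d]
        by (cases "Suc n = d"; cases "Suc n < d") (auto simp: rhs_def fps_X_power_mult_nth)
      show "form (Lin m) d (\<lambda>u. scaled_val d P (u 0) (\<lambda>a. Z a u) $ Suc n)"
        by (rule form_scaled_val[OF P]) (use Z Lin_var[OF m] in \<open>auto simp: I_def\<close>)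
    qed
    from sub[OF this] obtain \<Psi> where \<Psi>: "\<And>a. \<Psi> a \<in> Lin m" "\<And>u. w u = term_deriv (\<lambda>c. c) T (\<lambda>a. \<Phi> a u) (\<lambda>a. \<Psi> a u)"
      by blast
    define Z' where "Z' a u = Z a u + fps_X ^ Suc n * fps_const (\<Psi> a u)" for a u
    have nth: "Z' a u $ j = Z a u $ j + (if j = Suc n then \<Psi> a u else 0)" for a u j
      unfolding Z'_def by (simp add: fps_X_power_mult_nth del: power_Suc)
    have "I (Suc n) Z'"
      unfolding I_def
    proof (intro conjI allI impI)
      fix a j show "(\<lambda>u. Z' a u $ j) \<in> Lin m"
        using Z \<Psi>(1)[of a] by (cases "j = Suc n") (auto simp: nth I_def intro: Lin_add)
    next
      fix a u show "Z' a u $ 0 = \<Phi> a u" using Z by (simp add: nth I_def)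
    next
      fix u :: "nat \<Rightarrow> 'k" and j assume j: "j \<le> Suc n"
      obtain e where e: "scaled_val d P (u 0) (\<lambda>a. Z' a u) = scaled_val d P (u 0) (\<lambda>a. Z a u) +
          fps_X ^ Suc n * (fps_const (term_deriv (\<lambda>c. c) T (\<lambda>a. Z a u $ 0) (\<lambda>a. \<Psi> a u)) + fps_X * e)"
        using scaled_val_perturb[OF P, of "u 0" "\<lambda>a. Z a u" n "\<lambda>a. \<Psi> a u"] unfolding Z'_def T_def by blast
      have "term_deriv (\<lambda>c. c) T (\<lambda>a. Z a u $ 0) (\<lambda>a. \<Psi> a u) = w u" using Z by (simp add: \<Psi>(2) I_def)
      then have "scaled_val d P (u 0) (\<lambda>a. Z' a u) $ j = scaled_val d P (u 0) (\<lambda>a. Z a u) $ j + (if j = Suc n then w u else 0)"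
        unfolding e using j by (simp add: fps_X_power_mult_nth del: power_Suc)
      then show "scaled_val d P (u 0) (\<lambda>a. Z' a u) $ j = rhs u $ j"
        using Z j by (cases "j = Suc n") (auto simp: I_def w_def)
    qed
    then show "\<exists>Z'. I (Suc n) Z' \<and> (\<forall>a u. \<forall>j\<le>n. Z' a u $ j = Z a u $ j)"
      by (intro exI[of _ Z']) (simp add: nth)
  qed
  then obtain Z where Z: "\<And>n. I n (Z n)" "\<And>n a u j. j \<le> n \<Longrightarrow> Z (Suc n) a u $ j = Z n a u $ j" by blast
  \<comment> \<open>The approximations stabilize in each coefficient, so the \<open>j\<close>-th
    coefficient of the limit is read off the \<open>j\<close>-th approximation.\<close>
  have stable: "Z n a u $ j = Z j a u $ j" if "j \<le> n" for n a u j
    using that by (induction rule: dec_induct) (auto simp: Z(2))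
  have "\<exists>c. \<forall>u. Z j a u $ j = (\<Sum>i<m. c i * u i)" for a j
  proof -
    have "(\<lambda>u. Z j a u $ j) \<in> Lin m" using Z(1)[of j] by (simp add: I_def)
    then obtain c where "(\<lambda>u. Z j a u $ j) = (\<lambda>u. \<Sum>i<m. c i * u i)" by (rule LinE)
    then show ?thesis by metis
  qed
  then have c': "\<exists>c. \<forall>u. Z j a u $ j = (\<Sum>i<m. c i * u i)" for a j .
  define c where "c a j = (SOME c. \<forall>u. Z j a u $ j = (\<Sum>i<m. c i * u i))" for a j
  have c: "Z j a u $ j = (\<Sum>i<m. c a j i * u i)" for a j u
    using someI_ex[OF c'[of j a]] unfolding c_def by blast
  define x where "x a i = Abs_fps (\<lambda>j. c a j i)" for a i
  have x: "(\<Sum>i<m. x a i * fps_const (u i)) $ j = Z j a u $ j" for a u j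
    by (simp add: fps_sum_nth x_def c)
  show ?thesis
  proof (intro exI[of _ x] allI fps_ext)
    fix u :: "nat \<Rightarrow> 'k" and n
    have "scaled_val d P (u 0) (\<lambda>a. \<Sum>i<m. x a i * fps_const (u i)) $ n = scaled_val d P (u 0) (\<lambda>a. Z n a u) $ n"
      by (rule scaled_val_nth_cong[where n = n]) (simp only: x stable[of _ n], simp)
    also have "\<dots> = rhs u $ n" using Z(1)[of n] by (simp add: I_def)
    finally show "scaled_val d P (u 0) (\<lambda>a. \<Sum>i<m. x a i * fps_const (u i)) $ n = (fps_X ^ d * fps_const (q u)) $ n"
      by (simp add: rhs_def)
  qed
qed

section \<open>Universality in coordinates\<close>

lemma infinite_UNIV_alg_closed_field: "infinite (UNIV :: 'k::alg_closed_field set)"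
proof
  assume fin: "finite (UNIV :: 'k set)"
  define p :: "'k poly" where "p = (\<Prod>a\<in>UNIV. [:- a, 1:])"
  have "degree p = card (UNIV :: 'k set)"
    unfolding p_def by (subst degree_prod_eq_sum_degree) auto
  then have "degree p > 0" using fin by (simp add: card_gt_0_iff)
  then have "degree (p + 1) > 0" by (subst degree_add_eq_left) auto
  then obtain z where "poly (p + 1) z = 0" using alg_closed_imp_poly_has_root by blast
  moreover have "poly p z = 0" unfolding p_def poly_prod using fin by (auto simp: prod_zero_iff)
  ultimately show False by simp
qed

lemma term_val_hom_on:
  assumes R: "subring R" and g: "hom_on R g" and \<iota>: "range \<iota> \<subseteq> R" "\<And>c. g (\<iota> c) = c"
    and x: "\<And>c is i. (c, is) \<in> set P \<Longrightarrow> i \<in> set is \<Longrightarrow> x i \<in> R"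
  shows "term_val \<iota> P x \<in> R \<and> g (term_val \<iota> P x) = term_val (\<lambda>c. c) P (\<lambda>i. g (x i))"
  using x
proof (induction P)
  case Nil
  then show ?case using subring_simps[OF R] hom_on_0[OF R g] by simp
next
  case (Cons p P)
  obtain c "is" where p: "p = (c, is)" by fastforce
  have prod: "(\<Prod>i\<leftarrow>is. x i) \<in> R \<and> g (\<Prod>i\<leftarrow>is. x i) = (\<Prod>i\<leftarrow>is. g (x i))"
    if "\<And>i. i \<in> set is \<Longrightarrow> x i \<in> R" for "is"
    using that g subring_simps[OF R] by (induction "is") (auto simp: hom_on_def)
  have "(\<Prod>i\<leftarrow>is. x i) \<in> R" "g (\<Prod>i\<leftarrow>is. x i) = (\<Prod>i\<leftarrow>is. g (x i))"
    using prod[of "is"] Cons.prems p by auto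
  moreover have "\<iota> c \<in> R" using \<iota>(1) by blast
  moreover have "term_val \<iota> P x \<in> R" "g (term_val \<iota> P x) = term_val (\<lambda>c. c) P (\<lambda>i. g (x i))"
    using Cons.IH Cons.prems by (metis list.set_intros(2))+
  ultimately show ?case using g \<iota>(2) unfolding p term_val_simps hom_on_def
    by (simp add: subring_simps[OF R])
qed

text \<open>Division by \<open>t\<close> gives a pullback of \<open>P\<close> over
  \<open>k((t))\<close>. The homomorphism is applied to the matrix entries \<open>b a i\<close>,
  which do not depend on \<open>u\<close>, so the identity descends at once for all \<open>u\<close>
  with \<open>u 0 = 1\<close>.\<close>

lemma descend_to_base:
  fixes P :: "('k::alg_closed_field \<times> nat list) list"
  assumes P: "\<forall>(c, is)\<in>set P. length is \<le> d"
    and x: "\<And>u. scaled_val d P (u 0) (\<lambda>a. \<Sum>i<m. x a i * fps_const (u i)) = fps_X ^ d * fps_const (q u)"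
  obtains \<Phi> where "\<And>a. \<Phi> a \<in> Lin m" "\<And>u. u 0 = 1 \<Longrightarrow> term_val (\<lambda>c. c) P (\<lambda>a. \<Phi> a u) = q u"
proof -
  have "finite (\<Union>(c, is)\<in>set P. set is)" by auto
  \<comment> \<open>Only finitely many variables occur in \<open>P\<close>, so only finitely many
    Laurent series have to be specialized.\<close>
  then obtain D where D: "\<And>c is i. (c, is) \<in> set P \<Longrightarrow> i \<in> set is \<Longrightarrow> i < D"
    by (force simp: finite_nat_set_iff_bounded)
  define b where "b a i = fps_to_fls (x a i) / fls_X" for a i
  have "finite ((\<lambda>(a, i). b a i) ` ({..<D} \<times> {..<m}))" by simp
  from hom_to_base_field[OF this, of fls_const] obtain R and g :: "'k fls \<Rightarrow> 'k" where
    R: "subring R" "range fls_const \<subseteq> R" "(\<lambda>(a, i). b a i) ` ({..<D} \<times> {..<m}) \<subseteq> R"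
    and g: "hom_on R g" "\<And>c. g (fls_const c) = c"
    using infinite_UNIV_alg_closed_field by (metis fls_const_1 fls_const_mult_const fls_plus_const)
  have bR: "b a i \<in> R" if "a < D" "i < m" for a i using R(3) that by auto
  define \<Phi> where "\<Phi> a u = (\<Sum>i<m. g (b a i) * u i)" for a u
  show thesis
  proof (rule that[of \<Phi>])
    show "\<Phi> a \<in> Lin m" for a unfolding \<Phi>_def by (rule LinI)
    fix u :: "nat \<Rightarrow> 'k" assume u: "u 0 = 1"
    define y where "y a = (\<Sum>i<m. b a i * fls_const (u i))" for a
    have yR: "y a \<in> R" and gy: "g (y a) = \<Phi> a u" if "a < D" for a
    proof -
      have cR: "fls_const c \<in> R" for c using R(2) by blast
      have t: "b a i * fls_const (u i) \<in> R" if "i \<in> {..<m}" for i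
        using bR[OF \<open>a < D\<close>] cR that by (intro subring_simps[OF R(1)]) auto
      then show "y a \<in> R" unfolding y_def by (rule subring_sum[OF R(1)])
      have "g (y a) = (\<Sum>i<m. g (b a i * fls_const (u i)))"
        unfolding y_def by (rule hom_on_sum[OF R(1) g(1) t])
      also have "\<dots> = \<Phi> a u"
        unfolding \<Phi>_def using g bR[OF that] cR by (intro sum.cong) (auto simp: hom_on_def)
      finally show "g (y a) = \<Phi> a u" .
    qed
    have xy: "fps_to_fls (\<Sum>i<m. x a i * fps_const (u i)) = fls_X * y a" for a
    proof -
      have xb: "fps_to_fls (x a i) = fls_X * b a i" for i
        by (simp only: b_def times_divide_eq_right nonzero_mult_div_cancel_left[OF fls_X_nonzero])
      have "fps_to_fls (\<Sum>i\<in>I. x a i * fps_const (u i)) = fls_X * (\<Sum>i\<in>I. b a i * fls_const (u i))" for I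
        by (induction I rule: infinite_finite_induct)
           (simp_all add: fls_times_fps_to_fls distrib_left xb mult.assoc)
      then show ?thesis by (simp add: y_def)
    qed
    have "fps_to_fls (scaled_val d P 1 (\<lambda>a. \<Sum>i<m. x a i * fps_const (u i))) = fls_X ^ d * term_val fls_const P y"
      using P
    proof (induction P)
      case (Cons p P)
      obtain c "is" where p: "p = (c, is)" by fastforce
      have "fps_to_fls (\<Prod>a\<leftarrow>is. \<Sum>i<m. x a i * fps_const (u i)) = fls_X ^ length is * (\<Prod>a\<leftarrow>is. y a)"
        by (induction "is") (simp_all add: fls_times_fps_to_fls xy mult.assoc mult.left_commute)
      moreover have "fls_X ^ d = fls_X ^ (d - length is) * (fls_X ^ length is :: 'k fls)"
        using Cons.prems p by (simp flip: power_add)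
      ultimately show ?case using Cons p
        by (simp add: fls_times_fps_to_fls fps_to_fls_power algebra_simps)
    qed simp
    then have "fls_X ^ d * term_val fls_const P y = fls_X ^ d * fls_const (q u)"
      using x[of u] u by (simp add: fls_times_fps_to_fls fps_to_fls_power)
    then have "term_val fls_const P y = fls_const (q u)" by simp
    moreover have "g (term_val fls_const P y) = term_val (\<lambda>c. c) P (\<lambda>i. g (y i))"
      using term_val_hom_on[OF R(1) g(1) R(2) g(2)] yR D by blast
    moreover have "term_val (\<lambda>c. c) P (\<lambda>i. g (y i)) = term_val (\<lambda>c. c) P (\<lambda>a. \<Phi> a u)"
      unfolding term_val_def using D gy by (auto intro!: arg_cong[where f = sum_list] arg_cong[where f = prod_list])
    ultimately show "term_val (\<lambda>c. c) P (\<lambda>a. \<Phi> a u) = q u" using g(2) by simp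
  qed
qed

text \<open>Lifting generator by generator serves both to extend forms from a subspace and to
  homogenize.\<close>

lemma form_lift:
  assumes "form L b w" and L: "\<And>l. l \<in> L \<Longrightarrow> \<exists>l'\<in>L'. \<forall>x\<in>X. l x = l' (f x)"
  shows "\<exists>W. form L' b W \<and> (\<forall>x\<in>X. w x = W (f x))"
  using assms(1)
proof induction
  case (form_const c)
  show ?case by (intro exI[of _ "\<lambda>_. c"]) (simp add: form.form_const)
next
  case (form_zero b)
  show ?case by (intro exI[of _ "\<lambda>_. 0"]) (simp add: form.form_zero)
next
  case (form_add b p q)
  then obtain V W where "form L' b V" "\<forall>x\<in>X. p x = V (f x)" "form L' b W" "\<forall>x\<in>X. q x = W (f x)" by blast
  then show ?case by (intro exI[of _ "\<lambda>x. V x + W x"]) (simp add: form.form_add)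
next
  case (form_step l b q)
  then obtain W where "form L' b W" "\<forall>x\<in>X. q x = W (f x)" by blast
  moreover obtain l' where "l' \<in> L'" "\<forall>x\<in>X. l x = l' (f x)" using L form_step.hyps(1) by blast
  ultimately show ?case by (intro exI[of _ "\<lambda>x. l' x * W x"]) (simp add: form.form_step)
qed

lemma Lin_substitution:
  assumes "l \<in> Lin n"
  shows "(\<lambda>x. l (\<lambda>i. \<Sum>j<m. x j * b j i)) \<in> Lin m"
proof -
  obtain c where "l = (\<lambda>u. \<Sum>i<n. c i * u i)" using assms by (rule LinE)
  then have "(\<lambda>x. l (\<lambda>i. \<Sum>j<m. x j * b j i)) = (\<lambda>x. \<Sum>j<m. (\<Sum>i<n. c i * b j i) * x j)"
    by (auto simp: sum_distrib_left sum_distrib_right mult_ac intro: sum.swap)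
  then show ?thesis by (simp add: LinI)
qed

definition fun_scale :: "'k::field \<Rightarrow> (nat \<Rightarrow> 'k) \<Rightarrow> nat \<Rightarrow> 'k" where
  "fun_scale c f = (\<lambda>i. c * f i)"

lemma vector_space_fun_scale: "vector_space fun_scale"
  by unfold_locales (auto simp: fun_scale_def algebra_simps plus_fun_def)

text \<open>The second conclusion is the independence of the frame \<open>b\<close> in the dual
  version that is needed later: linear forms on the subspace extend, and with them all forms of
  degree \<open>d\<close>.\<close>

lemma isotropic_frame:
  assumes "1 \<le> d"
  shows "\<exists>n. \<forall>q. form (Lin n) d q \<longrightarrow> (\<exists>b :: nat \<Rightarrow> nat \<Rightarrow> 'k::alg_closed_field.
    (\<forall>x. q (\<lambda>i. \<Sum>j<m. x j * b j i) = 0) \<and>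
    (\<forall>l\<in>Lin m. \<exists>l'\<in>Lin n. \<forall>x. l x = l' (\<lambda>i. \<Sum>j<m. x j * b j i)))"
proof -
  interpret E: vector_space "fun_scale :: 'k \<Rightarrow> _" by (rule vector_space_fun_scale)
  interpret K: vector_space "(*) :: 'k \<Rightarrow> 'k \<Rightarrow> 'k" by unfold_locales (auto simp: algebra_simps)
  interpret EK: vector_space_pair "fun_scale :: 'k \<Rightarrow> _" "(*) :: 'k \<Rightarrow> 'k \<Rightarrow> 'k"
    by (simp add: vector_space_pair_def E.vector_space_axioms K.vector_space_axioms)
  obtain n where n: "vanish (fun_scale :: 'k \<Rightarrow> _) d 1 m n"
    using E.ex_vanish[OF poly_has_nonzero_combination] by blast
  have Lin_functionals: "Lin n \<subseteq> functionals (fun_scale :: 'k \<Rightarrow> _)"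
  proof
    fix l :: "(nat \<Rightarrow> 'k) \<Rightarrow> 'k" assume "l \<in> Lin n"
    then obtain a where a: "l = (\<lambda>u. \<Sum>i<n. a i * u i)" by (rule LinE)
    have "l (x + y) = l x + l y" for x y
      by (simp add: a distrib_left sum.distrib)
    moreover have "l (fun_scale c x) = c * l x" for c x
      unfolding a fun_scale_def sum_distrib_left by (intro sum.cong refl) (rule mult.left_commute)
    ultimately show "l \<in> functionals fun_scale"
      by (simp add: functionals_def Vector_Spaces.linear_iff E.vector_space_axioms K.vector_space_axioms)
  qed
  \<comment> \<open>Unit vectors: \<open>k^n\<close> is realized as their span in the space of all
    sequences.\<close>
  define e :: "nat \<Rightarrow> nat \<Rightarrow> 'k" where "e i = (\<lambda>j. if j = i then 1 else 0)" for i
  have inj: "inj_on e {..<n}" by (rule inj_onI) (metis e_def zero_neq_one)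
  have eval: "(\<Sum>i\<in>I. fun_scale (c i) (e i)) = (\<lambda>j. if j \<in> I then c j else 0)" if "finite I" for I c
    using that by (induction I) (auto simp: fun_scale_def e_def plus_fun_def zero_fun_def)
  have ind: "E.independent (e ` {..<n})"
    unfolding E.independent_explicit_finite_subsets
  proof (intro allI impI ballI)
    fix S :: "(nat \<Rightarrow> 'k) set" and c v
    assume S: "S \<subseteq> e ` {..<n}" "finite S" "(\<Sum>v\<in>S. fun_scale (c v) v) = 0" "v \<in> S"
    obtain I where I: "I \<subseteq> {..<n}" "S = e ` I" using S(1) by (auto simp: subset_image_iff)
    have fI: "finite I" using I(1) finite_subset by blast
    have "(\<Sum>v\<in>S. fun_scale (c v) v) = (\<Sum>i\<in>I. fun_scale (c (e i)) (e i))"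
      unfolding I(2) by (rule sum.reindex_cong[OF inj_on_subset[OF inj I(1)]]) auto
    then have "(\<lambda>j. if j \<in> I then c (e j) else 0) = (\<lambda>_. 0)"
      using S(3) by (simp add: eval[OF fI] zero_fun_def)
    then show "c v = 0" using S(4) I(2) by (metis (mono_tags, lifting) imageE)
  qed
  have card: "card (e ` {..<n}) = n" using card_image[OF inj] by simp
  show ?thesis
  proof (intro exI[of _ n] allI impI)
    fix q :: "(nat \<Rightarrow> 'k) \<Rightarrow> 'k" assume "form (Lin n) d q"
    then have q: "form (functionals fun_scale) d q"
      using form_comp[of "Lin n" d q "\<lambda>x. x"] Lin_functionals by auto
    then have deg: "\<exists>b. 1 \<le> b \<and> b \<le> d \<and> form (functionals fun_scale) b r" if "r \<in> set [q]" for r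
      using that assms by auto
    have "length [q] = 1" by simp
    from E.vanishE[OF n this deg ind _ card] obtain B where
      B: "E.independent B" "finite B" "card B = m" "B \<subseteq> E.span (e ` {..<n})"
        "\<And>r v. r \<in> set [q] \<Longrightarrow> v \<in> E.span B \<Longrightarrow> r v = 0" by blast
    obtain b where b: "bij_betw b {..<m} B"
      using ex_bij_betw_nat_finite[OF B(2)] B(3) by (auto simp: atLeast0LessThan)
    define L where "L x = (\<lambda>i. \<Sum>j<m. x j * b j i)" for x :: "nat \<Rightarrow> 'k"
    have L: "L x = (\<Sum>j<m. fun_scale (x j) (b j))" for x
    proof -
      have "(\<Sum>j\<in>J. fun_scale (x j) (b j)) i = (\<Sum>j\<in>J. x j * b j i)" for J i
        by (induction J rule: infinite_finite_induct) (simp_all add: fun_scale_def)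
      then show ?thesis by (simp add: L_def fun_eq_iff)
    qed
    have bB: "b j \<in> B" if "j < m" for j using b that by (auto simp: bij_betw_def)
    have Lspan: "L x \<in> E.span B" for x
      unfolding L by (intro E.span_sum E.span_scale E.span_base bB) simp
    show "\<exists>b. (\<forall>x. q (\<lambda>i. \<Sum>j<m. x j * b j i) = 0) \<and>
      (\<forall>l\<in>Lin m. \<exists>l'\<in>Lin n. \<forall>x. l x = l' (\<lambda>i. \<Sum>j<m. x j * b j i))"
    proof (intro exI[of _ b] conjI allI ballI)
      show "q (\<lambda>i. \<Sum>j<m. x j * b j i) = 0" for x
        using B(5)[of q "L x"] Lspan by (simp add: L_def)
      fix l :: "(nat \<Rightarrow> 'k) \<Rightarrow> 'k" assume "l \<in> Lin m"
      then obtain a where a: "l = (\<lambda>x. \<Sum>j<m. a j * x j)" by (rule LinE)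
      obtain h where h: "Vector_Spaces.linear fun_scale (*) h" "\<And>v. v \<in> B \<Longrightarrow> h v = a (inv_into {..<m} b v)"
        using EK.linear_independent_extend[OF B(1), of "\<lambda>v. a (inv_into {..<m} b v)"] by blast
      interpret h: Vector_Spaces.linear fun_scale "(*)" h by (rule h(1))
      have hb: "h (b j) = a j" if "j < m" for j
        using h(2)[OF bB[OF that]] b that by (simp add: bij_betw_def inv_into_f_f)
      \<comment> \<open>A functional on all sequences need not be a finite combination of
        coordinates, but on the span of the unit vectors it is.\<close>
      have hu: "h u = (\<Sum>i<n. h (e i) * u i)" if "u \<in> E.span (e ` {..<n})" for u
        using that
      proof (induction rule: E.span_induct_alt)
        case base
        show ?case unfolding h.zero by simp
      next
        case (step c v w)
        then obtain i where i: "i < n" "v = e i" by auto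
        have "(\<Sum>k<n. h (e k) * (c * e i k)) = h (e i) * c"
          using i(1) by (simp add: e_def if_distrib if_distribR cong: if_cong)
        have "h (fun_scale c v + w) = c * h v + h w" by (simp only: h.add h.scale)
        also have "\<dots> = (\<Sum>k<n. h (e k) * (c * e i k)) + (\<Sum>k<n. h (e k) * w k)"
          using step.IH \<open>(\<Sum>k<n. h (e k) * (c * e i k)) = h (e i) * c\<close> i(2) by (simp only: mult.commute)
        also have "\<dots> = (\<Sum>k<n. h (e k) * (fun_scale c v + w) k)"
          by (simp add: i(2) fun_scale_def distrib_left sum.distrib)
        finally show ?case .
      qed
      show "\<exists>l'\<in>Lin n. \<forall>x. l x = l' (\<lambda>i. \<Sum>j<m. x j * b j i)"
      proof (intro bexI[of _ "\<lambda>u. \<Sum>i<n. h (e i) * u i"] allI)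
        fix x :: "nat \<Rightarrow> 'k"
        have "E.span B \<subseteq> E.span (e ` {..<n})" using B(4) by (simp add: E.span_minimal)
        then have "L x \<in> E.span (e ` {..<n})" using Lspan by blast
        then have "(\<Sum>i<n. h (e i) * L x i) = h (L x)" using hu by simp
        also have "\<dots> = (\<Sum>j<m. x j * h (b j))" unfolding L by (simp add: h.sum h.scale)
        also have "\<dots> = l x" unfolding a by (simp add: hb mult.commute)
        finally show "l x = (\<Sum>i<n. h (e i) * (\<Sum>j<m. x j * b j i))" by (simp add: L_def)
      qed (rule LinI)
    qed
  qed
qed

text \<open>The number \<open>n\<close> is fixed before \<open>P\<close>, large enough for every
  form of degree \<open>d\<close> in \<open>n\<close> variables to vanish on an
  \<open>m\<close>-dimensional subspace. It depends only on \<open>d\<close> and \<open>m\<close>,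
  hence so does \<open>r\<close>.\<close>

lemma low_rank_or_universal:
  assumes ch: "\<And>i. 1 \<le> i \<Longrightarrow> i \<le> d \<Longrightarrow> of_nat i \<noteq> (0 :: 'k::alg_closed_field)" and d: "1 \<le> d" and m: "0 < m"
  shows "\<exists>r. \<forall>P :: ('k \<times> nat list) list. (\<forall>(c, is)\<in>set P. length is \<le> d) \<longrightarrow>
    (\<exists>(J :: (nat \<times> nat) set) g h. finite J \<and> card J \<le> r \<and> (\<forall>j\<in>J. form coord_affine (d - 1) (g j) \<and> form coord_affine (d - 1) (h j)) \<and>
      (\<forall>x. term_val (\<lambda>c. c) (filter (\<lambda>(c, is). length is = d) P) x = (\<Sum>j\<in>J. g j x * h j x))) \<or>
    (\<forall>q. form (Lin m) d q \<longrightarrow>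
      (\<exists>\<Phi>. (\<forall>a. \<Phi> a \<in> Lin m) \<and> (\<forall>u. u 0 = 1 \<longrightarrow> term_val (\<lambda>c. c) P (\<lambda>a. \<Phi> a u) = q u)))"
proof -
  obtain n where n: "\<And>q. form (Lin n) d q \<Longrightarrow> \<exists>b :: nat \<Rightarrow> nat \<Rightarrow> 'k.
    (\<forall>x. q (\<lambda>i. \<Sum>j<m. x j * b j i) = 0) \<and>
    (\<forall>l\<in>Lin m. \<exists>l'\<in>Lin n. \<forall>x. l x = l' (\<lambda>i. \<Sum>j<m. x j * b j i))"
    using isotropic_frame[OF d, of m] by blast
  show ?thesis
  proof (intro exI[of _ "(n ^ d + 1) * d"] allI impI)
    fix P :: "('k \<times> nat list) list" assume P: "\<forall>(c, is)\<in>set P. length is \<le> d"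
    define T where "T = filter (\<lambda>(c, is). length is = d) P"
    have T: "\<forall>(c, is)\<in>set T. length is = d" by (auto simp: T_def)
    let ?rank = "\<exists>(J :: (nat \<times> nat) set) g h. finite J \<and> card J \<le> (n ^ d + 1) * d \<and>
      (\<forall>j\<in>J. form coord_affine (d - 1) (g j) \<and> form coord_affine (d - 1) (h j)) \<and> (\<forall>x. term_val (\<lambda>c. c) T x = (\<Sum>j\<in>J. g j x * h j x))"
    let ?univ = "\<forall>q. form (Lin m) d q \<longrightarrow>
      (\<exists>\<Phi>. (\<forall>a. \<Phi> a \<in> Lin m) \<and> (\<forall>u. u 0 = 1 \<longrightarrow> term_val (\<lambda>c. c) P (\<lambda>a. \<Phi> a u) = q u))"
    have "?rank \<or> ?univ"
    proof (rule rank_or_submersion[OF infinite_UNIV_alg_closed_field T ch d, of n])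
      fix J :: "(nat \<times> nat) set" and g h :: "nat \<times> nat \<Rightarrow> (nat \<Rightarrow> 'k) \<Rightarrow> 'k"
      assume "finite J" "card J \<le> (n ^ d + 1) * d" "\<And>j. j \<in> J \<Longrightarrow> form coord_affine (d - 1) (g j)"
        "\<And>j. j \<in> J \<Longrightarrow> form coord_affine (d - 1) (h j)" "\<And>x. term_val (\<lambda>c. c) T x = (\<Sum>j\<in>J. g j x * h j x)"
      then have ?rank by blast
      then show ?thesis ..
    next
      fix \<Phi> assume \<Phi>: "\<And>a. \<Phi> a \<in> Lin n" and sub: "\<And>w. form (Lin n) d w \<Longrightarrow> \<exists>\<Psi>. (\<forall>a. \<Psi> a \<in> Lin n) \<and>
         (\<forall>u. w u = term_deriv (\<lambda>c. c) T (\<lambda>a. \<Phi> a u) (\<lambda>a. \<Psi> a u))"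
      have "form (Lin n) d (\<lambda>u. term_val (\<lambda>c. c) T (\<lambda>a. \<Phi> a u))" by (rule form_term_val[OF T \<Phi>])
      from n[OF this] obtain b where
        b: "\<And>x. term_val (\<lambda>c. c) T (\<lambda>a. \<Phi> a (\<lambda>i. \<Sum>j<m. x j * b j i)) = 0"
          "\<And>l. l \<in> Lin m \<Longrightarrow> \<exists>l'\<in>Lin n. \<forall>x. l x = l' (\<lambda>i. \<Sum>j<m. x j * b j i)" by blast
      define L where "L x = (\<lambda>i. \<Sum>j<m. x j * b j i)" for x
      \<comment> \<open>Extend \<open>w\<close> from the subspace to \<open>k^n\<close>, solve
        there, and restrict the solution.\<close>
      have sub': "\<exists>\<Psi>. (\<forall>a. \<Psi> a \<in> Lin m) \<and> (\<forall>u. w u = term_deriv (\<lambda>c. c) T (\<lambda>a. \<Phi> a (L u)) (\<lambda>a. \<Psi> a u))"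
        if w: "form (Lin m) d w" for w
      proof -
        obtain W where W: "form (Lin n) d W" "\<And>x. w x = W (L x)"
          using form_lift[OF w, of "Lin n" UNIV L] b(2) by (auto simp: L_def)
        from sub[OF W(1)] obtain \<Psi> where "\<And>a. \<Psi> a \<in> Lin n"
          "\<And>u. W u = term_deriv (\<lambda>c. c) T (\<lambda>a. \<Phi> a u) (\<lambda>a. \<Psi> a u)" by blast
        moreover from this have "(\<lambda>u. \<Psi> a (L u)) \<in> Lin m" for a
          unfolding L_def by (intro Lin_substitution)
        ultimately show ?thesis using W(2)
          by (intro exI[of _ "\<lambda>a u. \<Psi> a (L u)"]) simp
      qed
      have ?univ
      proof (intro allI impI)
        fix q :: "(nat \<Rightarrow> 'k) \<Rightarrow> 'k" assume q: "form (Lin m) d q"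
        have "\<exists>x. \<forall>u. scaled_val d P (u 0) (\<lambda>a. \<Sum>i<m. x a i * fps_const (u i)) = fps_X ^ d * fps_const (q u)"
        proof (rule hensel_series[where \<Phi> = "\<lambda>a u. \<Phi> a (L u)", OF P d m _ _ _ q, folded T_def])
          show "(\<lambda>u. \<Phi> a (L u)) \<in> Lin m" for a unfolding L_def by (rule Lin_substitution[OF \<Phi>])
          show "term_val (\<lambda>c. c) T (\<lambda>a. \<Phi> a (L u)) = 0" for u using b(1) by (simp add: L_def)
        qed (rule sub')
        then obtain x where "\<And>u. scaled_val d P (u 0) (\<lambda>a. \<Sum>i<m. x a i * fps_const (u i)) = fps_X ^ d * fps_const (q u)"
          by blast
        from descend_to_base[OF P this] show "\<exists>\<Phi>. (\<forall>a. \<Phi> a \<in> Lin m) \<and> (\<forall>u. u 0 = 1 \<longrightarrow> term_val (\<lambda>c. c) P (\<lambda>a. \<Phi> a u) = q u)"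
          by metis
      qed
      then show ?thesis ..
    qed
    then show "(\<exists>(J :: (nat \<times> nat) set) g h. finite J \<and> card J \<le> (n ^ d + 1) * d \<and>
        (\<forall>j\<in>J. form coord_affine (d - 1) (g j) \<and> form coord_affine (d - 1) (h j)) \<and>
        (\<forall>x. term_val (\<lambda>c. c) (filter (\<lambda>(c, is). length is = d) P) x = (\<Sum>j\<in>J. g j x * h j x))) \<or> ?univ"
      unfolding T_def .
  qed
qed

section \<open>The functor of polynomials\<close>

definition affine_functions :: "('k::field \<Rightarrow> 'v::ab_group_add \<Rightarrow> 'v) \<Rightarrow> ('v \<Rightarrow> 'k) set" where
  "affine_functions scale = {l. affine_map_on scale (*) UNIV l}"

lemma form_imp_polys_le:
  assumes "form (affine_functions scale) d w"
  shows "restrict w V \<in> polys_le scale d V"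
proof -
  have "\<exists>fs. (\<forall>(c, ls)\<in>set fs. length ls \<le> d \<and> set ls \<subseteq> affine_functions scale) \<and>
      (\<forall>x. w x = (\<Sum>(c, ls)\<leftarrow>fs. c * (\<Prod>l\<leftarrow>ls. l x)))"
    using assms
  proof induction
    case (form_const c)
    show ?case by (intro exI[of _ "[(c, [])]"]) simp
  next
    case (form_zero b)
    show ?case by (intro exI[of _ "[]"]) simp
  next
    case (form_add b p q)
    then obtain fs gs where
      "\<forall>(c, ls)\<in>set fs. length ls \<le> b \<and> set ls \<subseteq> affine_functions scale" "\<forall>x. p x = (\<Sum>(c, ls)\<leftarrow>fs. c * (\<Prod>l\<leftarrow>ls. l x))"
      "\<forall>(c, ls)\<in>set gs. length ls \<le> b \<and> set ls \<subseteq> affine_functions scale" "\<forall>x. q x = (\<Sum>(c, ls)\<leftarrow>gs. c * (\<Prod>l\<leftarrow>ls. l x))"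
      by blast
    then show ?case by (intro exI[of _ "fs @ gs"]) auto
  next
    case (form_step l b q)
    then obtain fs where
      fs: "\<forall>(c, ls)\<in>set fs. length ls \<le> b \<and> set ls \<subseteq> affine_functions scale" "\<forall>x. q x = (\<Sum>(c, ls)\<leftarrow>fs. c * (\<Prod>l\<leftarrow>ls. l x))"
      by blast
    have eq: "l x * (\<Sum>(c, ls)\<leftarrow>fs. c * (\<Prod>l\<leftarrow>ls. l x)) =
        (\<Sum>(c, ls)\<leftarrow>map (\<lambda>(c, ls). (c, l # ls)) fs. c * (\<Prod>l\<leftarrow>ls. l x))" for x
      by (induction fs) (auto simp: algebra_simps)
    have "\<forall>x. l x * q x = (\<Sum>(c, ls)\<leftarrow>map (\<lambda>(c, ls). (c, l # ls)) fs. c * (\<Prod>l\<leftarrow>ls. l x))"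
      by (rule allI) (subst fs(2)[rule_format], rule eq)
    moreover have "\<forall>(c, ls)\<in>set (map (\<lambda>(c, ls). (c, l # ls)) fs). length ls \<le> Suc b \<and> set ls \<subseteq> affine_functions scale"
      using fs(1) form_step.hyps(1) by fastforce
    ultimately show ?case by blast
  qed
  then obtain fs where fs: "\<And>c ls. (c, ls) \<in> set fs \<Longrightarrow> length ls \<le> d \<and> set ls \<subseteq> affine_functions scale"
    "\<And>x. w x = (\<Sum>(c, ls)\<leftarrow>fs. c * (\<Prod>l\<leftarrow>ls. l x))" by blast
  have "length (snd (fs ! i)) \<le> d \<and> (\<forall>l\<in>set (snd (fs ! i)). affine_map_on scale (*) V l)" if "i < length fs" for i
    using fs(1)[of "fst (fs ! i)" "snd (fs ! i)"] that
    by (auto simp: affine_functions_def affine_map_on_def) blast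
  moreover have "w x = (\<Sum>i<length fs. fst (fs ! i) * (\<Prod>l\<leftarrow>snd (fs ! i). l x))" for x
    unfolding fs(2) by (simp add: sum_list_sum_nth atLeast0LessThan case_prod_unfold)
  ultimately show ?thesis
    unfolding polys_le_def by (auto intro!: exI[of _ "length fs"] exI[of _ "\<lambda>i. fst (fs ! i)"] exI[of _ "\<lambda>i. snd (fs ! i)"])
qed

lemma polys_le_imp_form:
  assumes P: "P \<in> polys_le scale d V" and L: "\<And>c. (\<lambda>_. c) \<in> L"
    and l: "\<And>l. affine_map_on scale (*) V l \<Longrightarrow> \<exists>l'\<in>L. \<forall>z\<in>Z. l (f z) = l' z"
    and f: "\<And>z. z \<in> Z \<Longrightarrow> f z \<in> V"
  shows "\<exists>w. form L d w \<and> (\<forall>z\<in>Z. P (f z) = w z)"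
proof -
  obtain n :: nat and c ls where
    ls: "\<And>i. i < n \<Longrightarrow> length (ls i) \<le> d \<and> (\<forall>l\<in>set (ls i). affine_map_on scale (*) V l)"
    and eq: "\<And>x. x \<in> V \<Longrightarrow> P x = (\<Sum>i<n. c i * (\<Prod>l\<leftarrow>ls i. l x))"
    using P unfolding polys_le_def by blast
  have prod: "\<exists>w. form L (length ks) w \<and> (\<forall>z\<in>Z. (\<Prod>l\<leftarrow>ks. l (f z)) = w z)"
    if "\<forall>l\<in>set ks. affine_map_on scale (*) V l" for ks
    using that
  proof (induction ks)
    case Nil
    show ?case by (intro exI[of _ "\<lambda>_. 1"]) (simp add: form_const)
  next
    case (Cons k ks)
    then obtain w where w: "form L (length ks) w" "\<forall>z\<in>Z. (\<Prod>l\<leftarrow>ks. l (f z)) = w z" by auto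
    obtain k' where "k' \<in> L" "\<forall>z\<in>Z. k (f z) = k' z" using l[of k] Cons.prems by auto
    with w show ?case by (intro exI[of _ "\<lambda>z. k' z * w z"]) (simp add: form_step)
  qed
  have "\<exists>w. form L d w \<and> (\<forall>z\<in>Z. (\<Prod>l\<leftarrow>ls i. l (f z)) = w z)" if "i < n" for i
    using prod[of "ls i"] ls[OF that] form_mono_degree[OF _ _ L] by blast
  then obtain w where w: "\<And>i. i < n \<Longrightarrow> form L d (w i)" "\<And>i z. i < n \<Longrightarrow> z \<in> Z \<Longrightarrow> (\<Prod>l\<leftarrow>ls i. l (f z)) = w i z"
    by metis
  show ?thesis
  proof (intro exI[of _ "\<lambda>z. \<Sum>i<n. c i * w i z"] conjI ballI)
    show "form L d (\<lambda>z. \<Sum>i<n. c i * w i z)" by (intro form_sum form_scale w(1)) simp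
  qed (simp add: eq f w(2))
qed

definition affine_coords :: "nat \<Rightarrow> ((nat \<Rightarrow> 'k::field) \<Rightarrow> 'k) set" where
  "affine_coords N = {\<lambda>z. c + (\<Sum>i<N. a i * z i) | c a. True}"

lemma form_imp_term_val:
  assumes "form (affine_coords N) d w"
  shows "\<exists>P. (\<forall>(c, is)\<in>set P. length is \<le> d) \<and> (\<forall>z. w z = term_val (\<lambda>c. c) P z)"
proof -
  define E where "E b w \<longleftrightarrow> (\<exists>P. (\<forall>(c, is)\<in>set P. length is \<le> b) \<and> (\<forall>z. w z = term_val (\<lambda>c. c) P z))"
    for b :: nat and w :: "(nat \<Rightarrow> 'a) \<Rightarrow> 'a"
  have zero: "E b (\<lambda>_. 0)" for b unfolding E_def by (intro exI[of _ "[]"]) simp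
  have add: "E b (\<lambda>z. p z + q z)" if pq: "E b p" "E b q" for b p q
  proof -
    from pq obtain P Q where "\<forall>(c, is)\<in>set P. length is \<le> b" "\<forall>z. p z = term_val (\<lambda>c. c) P z"
      "\<forall>(c, is)\<in>set Q. length is \<le> b" "\<forall>z. q z = term_val (\<lambda>c. c) Q z" unfolding E_def by blast
    then show ?thesis unfolding E_def by (intro exI[of _ "P @ Q"]) (auto simp: term_val_def)
  qed
  have var: "E (b + length js) (\<lambda>z. a * (\<Prod>j\<leftarrow>js. z j) * q z)" if q: "E b q" for b q a js
  proof -
    from q obtain P where P: "\<forall>(c, is)\<in>set P. length is \<le> b" "\<forall>z. q z = term_val (\<lambda>c. c) P z" unfolding E_def by blast
    have "a * (\<Prod>j\<leftarrow>js. z j) * term_val (\<lambda>c. c) P z = term_val (\<lambda>c. c) (map (\<lambda>(c, is). (a * c, js @ is)) P) z" for z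
      by (induction P) (auto simp: algebra_simps)
    then show ?thesis unfolding E_def using P
      by (intro exI[of _ "map (\<lambda>(c, is). (a * c, js @ is)) P"]) auto
  qed
  have mono: "E (Suc b) q" if "E b q" for b q using that unfolding E_def by fastforce
  have "E d w"
    using assms
  proof induction
    case (form_const c)
    show ?case unfolding E_def by (intro exI[of _ "[(c, [])]"]) simp
  next
    case (form_step l b q)
    then obtain c a where l: "l = (\<lambda>z. c + (\<Sum>i<N. a i * z i))" by (auto simp: affine_coords_def)
    have "E (Suc b) (\<lambda>z. \<Sum>i<n. a i * z i * q z)" for n
    proof (induction n)
      case (Suc n)
      have "E (Suc b) (\<lambda>z. a n * z n * q z)" using var[OF form_step.IH, of "[n]" "a n"] by simp
      from add[OF Suc this] show ?case by simp
    qed (simp add: zero)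
    from add[OF mono[OF var[OF form_step.IH, of "[]" c, simplified]] this[of N]]
    show ?case unfolding l by (simp add: distrib_right sum_distrib_right)
  qed (auto intro: zero add)
  then show ?thesis by (simp add: E_def)
qed

section \<open>Affine coordinates\<close>

lemma affine_functions_affine:
  assumes vs: "vector_space scale" and "y \<in> affine_functions scale" "y' \<in> affine_functions scale"
  shows "(\<lambda>v. c + e * y v + e' * y' v) \<in> affine_functions scale"
proof -
  obtain L k where L: "Vector_Spaces.linear scale (*) L" "\<And>v. y v = L v + k"
    using assms(2) by (auto simp: affine_functions_def affine_map_on_def)
  obtain L' k' where L': "Vector_Spaces.linear scale (*) L'" "\<And>v. y' v = L' v + k'"
    using assms(3) by (auto simp: affine_functions_def affine_map_on_def)
  have "Vector_Spaces.linear scale (*) (\<lambda>v. e * L v + e' * L' v)"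
    using L(1) L'(1) by (auto simp: Vector_Spaces.linear_iff algebra_simps)
  moreover have "c + e * y v + e' * y' v = (e * L v + e' * L' v) + (c + e * k + e' * k')" for v
    by (simp add: L(2) L'(2) algebra_simps)
  ultimately show ?thesis unfolding affine_functions_def affine_map_on_def by blast
qed

lemma affine_functions_const:
  assumes "vector_space scale" shows "(\<lambda>_. c) \<in> affine_functions scale"
proof -
  have "vector_space ((*) :: 'a \<Rightarrow> 'a \<Rightarrow> 'a)" by unfold_locales (auto simp: algebra_simps)
  then have "Vector_Spaces.linear scale (*) (\<lambda>_. 0 :: 'a)"
    using assms by (simp add: Vector_Spaces.linear_iff)
  then show ?thesis unfolding affine_functions_def affine_map_on_def by fastforce
qed

lemma affine_map_on_combination:
  assumes vs: "vector_space scale" and f: "\<And>i. f i \<in> affine_functions scale"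
  shows "affine_map_on scale scale V (\<lambda>v. p + (\<Sum>i<N. scale (f i v) (b i)))"
proof -
  interpret vector_space scale by (rule vs)
  have "\<forall>i. \<exists>L k. Vector_Spaces.linear scale (*) L \<and> (\<forall>v. f i v = L v + k)"
    using f by (simp add: affine_functions_def affine_map_on_def)
  then obtain L k where L: "\<And>i. Vector_Spaces.linear scale (*) (L i)" "\<And>i v. f i v = L i v + k i" by metis
  have "Vector_Spaces.linear scale scale (\<lambda>v. \<Sum>i<N. scale (L i v) (b i))"
    using L(1) vs by (simp add: Vector_Spaces.linear_iff scale_left_distrib sum.distrib scale_sum_right)
  moreover have "p + (\<Sum>i<N. scale (f i v) (b i)) =
      (\<Sum>i<N. scale (L i v) (b i)) + (p + (\<Sum>i<N. scale (k i) (b i)))" for v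
    by (simp add: L(2) scale_left_distrib sum.distrib algebra_simps)
  ultimately show ?thesis unfolding affine_map_on_def by blast
qed

text \<open>The coordinates are a dual basis of the direction space, extended to the ambient space
  and shifted so as to vanish at \<open>p\<close>.\<close>

lemma affine_coordinates:
  fixes scale :: "'k::field \<Rightarrow> 'v::ab_group_add \<Rightarrow> 'v"
  assumes vs: "vector_space scale" and V: "fin_affine_space scale V"
  obtains p and N :: nat and b y where "\<And>c. p + (\<Sum>i<N. scale (c i) (b i)) \<in> V"
    "\<And>v. v \<in> V \<Longrightarrow> v = p + (\<Sum>i<N. scale (y i v) (b i))"
    "\<And>i. y i \<in> affine_functions scale"
proof -
  interpret vector_space scale by (rule vs)
  interpret K: vector_space "(*) :: 'k \<Rightarrow> 'k \<Rightarrow> 'k" by unfold_locales (auto simp: algebra_simps)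
  interpret VK: vector_space_pair scale "(*) :: 'k \<Rightarrow> 'k \<Rightarrow> 'k"
    by (simp add: vector_space_pair_def vs K.vector_space_axioms)
  obtain p A where A: "finite A" "V = (\<lambda>v. p + v) ` span A" using V by (auto simp: fin_affine_space_def)
  obtain B where B: "B \<subseteq> A" "independent B" "A \<subseteq> span B" using maximal_independent_subset by blast
  have finB: "finite B" using A(1) B(1) finite_subset by blast
  have span: "span A = span B" using B(1,3) span_mono span_minimal by (metis subset_antisym subspace_span)
  obtain b where b: "bij_betw b {..<card B} B"
    using ex_bij_betw_nat_finite[OF finB] by (auto simp: atLeast0LessThan)
  have "\<exists>h. Vector_Spaces.linear scale (*) h \<and> (\<forall>j<card B. h (b j) = (if j = i then 1 else 0))" for i
  proof -
    obtain h where h: "Vector_Spaces.linear scale (*) h" "\<And>v. v \<in> B \<Longrightarrow> h v = (if v = b i \<and> i < card B then 1 else 0)"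
      using VK.linear_independent_extend[OF B(2), of "\<lambda>v. if v = b i \<and> i < card B then 1 else 0"] by blast
    have "h (b j) = (if j = i then 1 else 0)" if "j < card B" for j
    proof -
      have "b j \<in> B" using b that by (auto simp: bij_betw_def)
      moreover have "b j = b i \<and> i < card B \<longleftrightarrow> j = i"
        using that bij_betw_imp_inj_on[OF b] by (auto dest: inj_onD)
      ultimately show ?thesis using h(2) by simp
    qed
    with h(1) show ?thesis by blast
  qed
  then obtain h where h: "\<And>i. Vector_Spaces.linear scale (*) (h i)"
    "\<And>i j. j < card B \<Longrightarrow> h i (b j) = (if j = i then 1 else 0)" by metis
  have exp: "v = (\<Sum>i<card B. scale (h i v) (b i))" if v: "v \<in> span B" for v
  proof -
    obtain c where "v = (\<Sum>w\<in>B. scale (c w) w)" using v span_finite[OF finB] by auto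
    then have c: "v = (\<Sum>j<card B. scale (c (b j)) (b j))" by (simp add: sum.reindex_bij_betw[OF b, where g = "\<lambda>w. scale (c w) w"])
    have "h i v = c (b i)" if "i < card B" for i
    proof -
      interpret hi: Vector_Spaces.linear scale "(*)" "h i" by (rule h(1))
      have "h i v = (\<Sum>j<card B. c (b j) * h i (b j))" unfolding c by (simp only: hi.sum hi.scale)
      also have "\<dots> = c (b i)" using that by (simp add: h(2) if_distrib cong: if_cong)
      finally show ?thesis .
    qed
    then show ?thesis using c by simp
  qed
  show thesis
  proof (rule that[where p = p and N = "card B" and b = b and y = "\<lambda>i v. h i v + - h i p"])
    fix c
    have "(\<Sum>i<card B. scale (c i) (b i)) \<in> span B"
      using b by (intro span_sum span_scale span_base) (auto simp: bij_betw_def)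
    then show "p + (\<Sum>i<card B. scale (c i) (b i)) \<in> V" by (simp add: A(2) span)
  next
    fix v assume "v \<in> V"
    then obtain w where w: "v = p + w" "w \<in> span B" by (auto simp: A(2) span)
    have "h i v + - h i p = h i w" for i
      using h(1)[of i] w(1) by (simp add: Vector_Spaces.linear_iff)
    then show "v = p + (\<Sum>i<card B. scale (h i v + - h i p) (b i))" using exp[OF w(2)] w(1) by simp
  next
    fix i show "(\<lambda>v. h i v + - h i p) \<in> affine_functions scale"
      unfolding affine_functions_def affine_map_on_def using h(1) by blast
  qed
qed

lemma affine_map_on_coordinates:
  fixes scale :: "'k::field \<Rightarrow> 'v::ab_group_add \<Rightarrow> 'v"
  assumes "affine_map_on scale (*) V l" "\<And>c. p + (\<Sum>i<N. scale (c i) (b i)) \<in> V"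
  shows "\<exists>c a. \<forall>z. l (p + (\<Sum>i<N. scale (z i) (b i))) = c + (\<Sum>i<N. a i * z i)"
proof -
  obtain L c where L: "Vector_Spaces.linear scale (*) L" "\<And>x. x \<in> V \<Longrightarrow> l x = L x + c"
    using assms(1) by (auto simp: affine_map_on_def)
  interpret L: Vector_Spaces.linear scale "(*)" L by (rule L(1))
  have "l (p + (\<Sum>i<N. scale (z i) (b i))) = (L p + c) + (\<Sum>i<N. L (b i) * z i)" for z
    using L(2)[OF assms(2)[of z]] by (simp add: L.add L.sum L.scale algebra_simps)
  then show ?thesis by (intro exI[of _ "L p + c"] exI[of _ "\<lambda>i. L (b i)"]) simp
qed

lemma polys_le_coordinates:
  assumes "P \<in> polys_le scale d V" "\<And>c. p + (\<Sum>i<N. scale (c i) (b i)) \<in> V"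
  shows "\<exists>w. form (affine_coords N) d w \<and> (\<forall>z. P (p + (\<Sum>i<N. scale (z i) (b i))) = w z)"
proof -
  have "\<exists>w. form (affine_coords N) d w \<and> (\<forall>z\<in>UNIV. P (p + (\<Sum>i<N. scale (z i) (b i))) = w z)"
  proof (rule polys_le_imp_form[OF assms(1)])
    show "(\<lambda>_. c) \<in> affine_coords N" for c
      unfolding affine_coords_def by (auto intro!: exI[of _ c] exI[of _ "\<lambda>_. 0"])
    show "\<exists>l'\<in>affine_coords N. \<forall>z\<in>UNIV. l (p + (\<Sum>i<N. scale (z i) (b i))) = l' z"
      if l: "affine_map_on scale (*) V l" for l
    proof -
      obtain c a where "\<forall>z. l (p + (\<Sum>i<N. scale (z i) (b i))) = c + (\<Sum>i<N. a i * z i)"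
        using affine_map_on_coordinates[OF l assms(2)] by blast
      then show ?thesis
        by (intro bexI[of _ "\<lambda>z. c + (\<Sum>i<N. a i * z i)"]) (auto simp: affine_coords_def)
    qed
  qed (rule assms(2))
  then show ?thesis by simp
qed

text \<open>Constant terms become multiples of the extra variable \<open>u 0\<close>.\<close>

lemma homogenize:
  assumes "form (affine_coords N) d w"
  shows "\<exists>q. form (Lin (Suc N)) d q \<and> (\<forall>u. u 0 = 1 \<longrightarrow> q u = w (\<lambda>i. u (Suc i)))"
proof -
  let ?L = "(\<lambda>l u. l (\<lambda>i. u (Suc i))) ` affine_coords N"
  have "\<exists>q. form (Lin (Suc N)) d q \<and> (\<forall>u\<in>{u. u 0 = 1}. w (\<lambda>i. u (Suc i)) = q u)"
  proof (rule form_lift[where f = "\<lambda>u. u"])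
    show "form ?L d (\<lambda>u. w (\<lambda>i. u (Suc i)))" by (rule form_comp[OF assms]) auto
    fix l assume "l \<in> ?L"
    then obtain c a where l: "l = (\<lambda>u. c + (\<Sum>i<N. a i * u (Suc i)))" by (auto simp: affine_coords_def)
    define a' where "a' j = (case j of 0 \<Rightarrow> c | Suc i \<Rightarrow> a i)" for j
    have "l u = (\<Sum>j<Suc N. a' j * u j)" if "u 0 = 1" for u
      unfolding sum.lessThan_Suc_shift using that by (simp add: l a'_def)
    then show "\<exists>l'\<in>Lin (Suc N). \<forall>u\<in>{u. u 0 = 1}. l u = l' u"
      by (intro bexI[OF _ LinI[where a = a']]) simp
  qed
  then show ?thesis by auto
qed

lemma rank_below_leI:
  assumes "finite J" "card J \<le> r" and gh: "\<And>j. j \<in> J \<Longrightarrow> g j \<in> polys_le scale (d - 1) V"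
    "\<And>j. j \<in> J \<Longrightarrow> h j \<in> polys_le scale (d - 1) V" and d: "1 \<le> d"
    and P: "\<And>x. x \<in> V \<Longrightarrow> P x = (\<Sum>j\<in>J. g j x * h j x)"
  shows "rank_below scale d V P \<le> enat r"
proof -
  obtain e where e: "bij_betw e {..<card J} J"
    using ex_bij_betw_nat_finite[OF assms(1)] by (auto simp: atLeast0LessThan)
  have deg: "Q \<in> polys scale V \<and> poly_degree scale V Q < d" if "Q \<in> polys_le scale (d - 1) V" for Q
  proof -
    have "poly_degree scale V Q \<le> d - 1" unfolding poly_degree_def using that by (rule Least_le)
    then show ?thesis using that d by (auto simp: polys_def)
  qed
  have "P x = (\<Sum>i<card J. g (e i) x * h (e i) x)" if "x \<in> V" for x
    using P[OF that] sum.reindex_bij_betw[OF e, of "\<lambda>j. g j x * h j x"] by simp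
  moreover have "e i \<in> J" if "i < card J" for i using e that by (auto simp: bij_betw_def)
  ultimately have "rank_below scale d V P \<le> enat (card J)"
    unfolding rank_below_def using deg gh
    by (intro Inf_lower CollectI exI[of _ "card J"] conjI refl exI[of _ "\<lambda>i. g (e i)"] exI[of _ "\<lambda>i. h (e i)"]) auto
  also have "\<dots> \<le> enat r" using assms(2) by simp
  finally show ?thesis .
qed

text \<open>Properness supplies a polynomial \<open>Q\<close> on a space \<open>V0\<close> outside
  \<open>G\<close>. If some \<open>P\<close> in \<open>G V\<close> were universal for the
  homogeneous coordinates of \<open>V0\<close>, then \<open>Q\<close> would be a pullback of
  \<open>P\<close>; so \<open>P\<close> falls under the low rank alternative.\<close>

theorem lemma1p23:
  fixes scale :: "'k::alg_closed_field \<Rightarrow> 'v::ab_group_add \<Rightarrow> 'v"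
    and G :: "'v set \<Rightarrow> ('v \<Rightarrow> 'k) set"
    and d :: nat
  assumes "vector_space scale"
    and "\<forall>B. finite B \<longrightarrow> module.span scale B \<noteq> UNIV"
    and "d \<ge> 1"
    and "CHAR('k) = 0 \<or> CHAR('k) > d"
    and "proper_subfunctor scale d G"
  shows "\<exists>r::nat. \<forall>V P. fin_affine_space scale V \<longrightarrow> P \<in> G V \<longrightarrow>
           rank_below scale d V P \<le> enat r \<and>
           (poly_degree scale V P = d \<longrightarrow> poly_rank scale V P \<le> enat r)"
proof -
  interpret vector_space scale by (rule assms(1))
  have d: "1 \<le> d" by (rule assms(3))
  have ch: "of_nat i \<noteq> (0 :: 'k)" if "1 \<le> i" "i \<le> d" for i
    using assms(4) that by (auto simp: of_nat_eq_0_iff_char_dvd dest: dvd_imp_le)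
  have G: "\<And>V. fin_affine_space scale V \<Longrightarrow> G V \<subseteq> polys_le scale d V"
    "\<And>V W \<phi> P. fin_affine_space scale V \<Longrightarrow> fin_affine_space scale W \<Longrightarrow>
      \<phi> \<in> affine_morphisms scale W V \<Longrightarrow> P \<in> G V \<Longrightarrow> compose W P \<phi> \<in> G W"
    using assms(5) unfolding proper_subfunctor_def subfunctor_def by blast+
  obtain V0 where V0: "fin_affine_space scale V0" "G V0 \<noteq> polys_le scale d V0"
    using assms(5) unfolding proper_subfunctor_def by blast
  then obtain Q where Q: "Q \<in> polys_le scale d V0" "Q \<notin> G V0" using G(1) by blast
  obtain p0 and N0 :: nat and b0 y0 where V0_in: "\<And>c. p0 + (\<Sum>i<N0. scale (c i) (b0 i)) \<in> V0"
    and V0_eq: "\<And>v. v \<in> V0 \<Longrightarrow> v = p0 + (\<Sum>i<N0. scale (y0 i v) (b0 i))"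
    and y0: "\<And>i. y0 i \<in> affine_functions scale"
    by (rule affine_coordinates[OF assms(1) V0(1)]) (rule that)
  \<comment> \<open>Homogeneous coordinates of \<open>v\<close>, normalized by the leading entry
    1.\<close>
  define x0 where "x0 v = (\<lambda>j. if j = 0 then 1 else y0 (j - 1) v)" for v
  define m where "m = Suc N0"
  note aff_const = affine_functions_const[OF assms(1)] and aff = affine_functions_affine[OF assms(1)]
  obtain q where q: "form (Lin m) d q" "\<And>v. v \<in> V0 \<Longrightarrow> q (x0 v) = Q v"
  proof -
    obtain w where w: "form (affine_coords N0) d w" "\<And>z. Q (p0 + (\<Sum>i<N0. scale (z i) (b0 i))) = w z"
      using polys_le_coordinates[OF Q(1) V0_in] by blast
    obtain q where q: "form (Lin m) d q" "\<And>u. u 0 = 1 \<Longrightarrow> q u = w (\<lambda>i. u (Suc i))"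
      using homogenize[OF w(1)] unfolding m_def by blast
    have "q (x0 v) = Q v" if "v \<in> V0" for v
      using q(2)[of "x0 v"] w(2)[of "\<lambda>i. y0 i v"] V0_eq[OF that] by (simp add: x0_def)
    with q(1) show ?thesis by (rule that)
  qed
  obtain r where r: "\<And>P :: ('k \<times> nat list) list. \<forall>(c, is)\<in>set P. length is \<le> d \<Longrightarrow>
    (\<exists>(J :: (nat \<times> nat) set) g h. finite J \<and> card J \<le> r \<and> (\<forall>j\<in>J. form coord_affine (d - 1) (g j) \<and> form coord_affine (d - 1) (h j)) \<and>
      (\<forall>x. term_val (\<lambda>c. c) (filter (\<lambda>(c, is). length is = d) P) x = (\<Sum>j\<in>J. g j x * h j x))) \<or>
    (\<forall>q. form (Lin m) d q \<longrightarrow>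
      (\<exists>\<Phi>. (\<forall>a. \<Phi> a \<in> Lin m) \<and> (\<forall>u. u 0 = 1 \<longrightarrow> term_val (\<lambda>c. c) P (\<lambda>a. \<Phi> a u) = q u)))"
    using low_rank_or_universal[OF ch d, of m] unfolding m_def by blast
  \<comment> \<open>The additional product is the part of \<open>P\<close> of degree below
    \<open>d\<close>, multiplied by 1; it gets the index \<open>None\<close>.\<close>
  have bound: "rank_below scale d V P \<le> enat (Suc r)" if V: "fin_affine_space scale V" and P: "P \<in> G V" for V P
  proof -
    obtain p and N :: nat and b y where V_in: "\<And>c. p + (\<Sum>i<N. scale (c i) (b i)) \<in> V"
      and V_eq: "\<And>v. v \<in> V \<Longrightarrow> v = p + (\<Sum>i<N. scale (y i v) (b i))"
      and y: "\<And>i. y i \<in> affine_functions scale"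
      by (rule affine_coordinates[OF assms(1) V]) (rule that)
    have "P \<in> polys_le scale d V" using G(1)[OF V] P by blast
    from polys_le_coordinates[OF this V_in] obtain w where
      "form (affine_coords N) d w" "\<And>z. P (p + (\<Sum>i<N. scale (z i) (b i))) = w z" by blast
    then obtain Pl where Pl: "\<forall>(c, is)\<in>set Pl. length is \<le> d"
      "\<And>z. P (p + (\<Sum>i<N. scale (z i) (b i))) = term_val (\<lambda>c. c) Pl z"
      using form_imp_term_val by metis
    have Py: "P v = term_val (\<lambda>c. c) Pl (\<lambda>i. y i v)" if "v \<in> V" for v
      using V_eq[OF that] Pl(2)[of "\<lambda>i. y i v"] by simp
    from r[OF Pl(1)] show ?thesis
    proof
      assume "\<exists>(J :: (nat \<times> nat) set) g h. finite J \<and> card J \<le> r \<and> (\<forall>j\<in>J. form coord_affine (d - 1) (g j) \<and> form coord_affine (d - 1) (h j)) \<and>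
        (\<forall>x. term_val (\<lambda>c. c) (filter (\<lambda>(c, is). length is = d) Pl) x = (\<Sum>j\<in>J. g j x * h j x))"
      then obtain J :: "(nat \<times> nat) set" and g h where J: "finite J" "card J \<le> r"
        "\<And>j. j \<in> J \<Longrightarrow> form coord_affine (d - 1) (g j)" "\<And>j. j \<in> J \<Longrightarrow> form coord_affine (d - 1) (h j)"
        "\<And>x. term_val (\<lambda>c. c) (filter (\<lambda>(c, is). length is = d) Pl) x = (\<Sum>j\<in>J. g j x * h j x)" by blast
      define rest where "rest v = term_val (\<lambda>c. c) (filter (\<lambda>(c, is). length is \<noteq> d) Pl) (\<lambda>i. y i v)" for v
      have split: "P v = (\<Sum>j\<in>J. g j (\<lambda>i. y i v) * h j (\<lambda>i. y i v)) + rest v" if "v \<in> V" for v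
      proof -
        have "term_val (\<lambda>c. c) Pl x = term_val (\<lambda>c. c) (filter (\<lambda>(c, is). length is = d) Pl) x +
            term_val (\<lambda>c. c) (filter (\<lambda>(c, is). length is \<noteq> d) Pl) x" for x
          by (induction Pl) auto
        then show ?thesis by (simp add: Py[OF that] J(5) rest_def)
      qed
      have coord_affine: "(\<lambda>v. l (\<lambda>i. y i v)) \<in> affine_functions scale" if "l \<in> coord_affine" for l
        using that aff[OF y y, of _ _ _ 0] by (auto simp: coord_affine_def)
      have poly: "restrict (\<lambda>v. w (\<lambda>i. y i v)) V \<in> polys_le scale (d - 1) V" if "form coord_affine (d - 1) w" for w
        by (rule form_imp_polys_le[OF form_comp[OF that coord_affine]])
      have "form (affine_functions scale) (d - 1) rest"
      proof -
        have "form (affine_functions scale) e (\<lambda>v. term_val (\<lambda>c. c) T (\<lambda>i. y i v))"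
          if "\<forall>(c, is)\<in>set T. length is \<le> e" for T e
          using that
        proof (induction T)
          case (Cons t T)
          obtain c "is" where t: "t = (c, is)" by fastforce
          have "form (affine_functions scale) e (\<lambda>v. \<Prod>i\<leftarrow>is. y i v)"
            by (rule form_mono_degree[OF form_prod_list _ aff_const]) (use y Cons.prems t in auto)
          then show ?case unfolding t term_val_simps using Cons by (intro form_add form_scale) auto
        qed (simp add: form_zero)
        moreover have "\<forall>(c, is)\<in>set (filter (\<lambda>(c, is). length is \<noteq> d) Pl). length is \<le> d - 1"
          using Pl(1) by fastforce
        ultimately show ?thesis unfolding rest_def by blast
      qed
      then have rest: "restrict rest V \<in> polys_le scale (d - 1) V" by (rule form_imp_polys_le)
      have one: "restrict (\<lambda>_. 1) V \<in> polys_le scale (d - 1) V"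
        by (rule form_imp_polys_le[OF form_mono_degree[OF form_const _ aff_const]]) simp
      let ?g = "\<lambda>j. case j of None \<Rightarrow> restrict rest V | Some j \<Rightarrow> restrict (\<lambda>v. g j (\<lambda>i. y i v)) V"
      let ?h = "\<lambda>j. case j of None \<Rightarrow> restrict (\<lambda>_. 1) V | Some j \<Rightarrow> restrict (\<lambda>v. h j (\<lambda>i. y i v)) V"
      show ?thesis
      proof (rule rank_below_leI[where J = "insert None (Some ` J)" and g = ?g and h = ?h])
        show "card (insert None (Some ` J)) \<le> Suc r" using J(1,2) by (simp add: card_image)
        show "P v = (\<Sum>j\<in>insert None (Some ` J). ?g j v * ?h j v)" if "v \<in> V" for v
          using J(1) that by (simp add: split sum.reindex add.commute)
      qed (use J d poly rest one in auto)
    next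
      assume "\<forall>q. form (Lin m) d q \<longrightarrow>
        (\<exists>\<Phi>. (\<forall>a. \<Phi> a \<in> Lin m) \<and> (\<forall>u. u 0 = 1 \<longrightarrow> term_val (\<lambda>c. c) Pl (\<lambda>a. \<Phi> a u) = q u))"
      then obtain \<Phi> where \<Phi>: "\<And>a. \<Phi> a \<in> Lin m" "\<And>u. u 0 = 1 \<Longrightarrow> term_val (\<lambda>c. c) Pl (\<lambda>a. \<Phi> a u) = q u"
        using q(1) by blast
      \<comment> \<open>The forms \<open>\<Phi> i\<close> are linear in the homogeneous coordinates,
        hence affine in \<open>v\<close>.\<close>
      define \<phi> where "\<phi> v = p + (\<Sum>i<N. scale (\<Phi> i (x0 v)) (b i))" for v
      have "(\<lambda>v. \<Phi> i (x0 v)) \<in> affine_functions scale" for i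
      proof -
        obtain a where a: "\<Phi> i = (\<lambda>u. \<Sum>j<m. a j * u j)" using \<Phi>(1) by (rule LinE)
        have "(\<lambda>v. \<Sum>j<n. a (Suc j) * y0 j v) \<in> affine_functions scale" for n
        proof (induction n)
          case (Suc n)
          then show ?case using aff[OF Suc y0[of n], of 0 1 "a (Suc n)"] by simp
        qed (simp add: aff_const)
        from aff[OF this[of N0] aff_const, of "a 0" 1 0] show ?thesis
          unfolding a m_def sum.lessThan_Suc_shift by (simp add: x0_def)
      qed
      then have "affine_map_on scale scale V0 \<phi>"
        unfolding \<phi>_def by (rule affine_map_on_combination[OF assms(1)])
      then have "\<phi> \<in> affine_morphisms scale V0 V" unfolding affine_morphisms_def \<phi>_def using V_in by auto
      then have "compose V0 P \<phi> \<in> G V0" using G(2)[OF V V0(1)] P by blast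
      moreover have "compose V0 P \<phi> = Q"
      proof (rule extensionalityI[of _ V0])
        show "Q \<in> extensional V0" using Q(1) by (simp add: polys_le_def)
        fix v assume "v \<in> V0"
        then show "compose V0 P \<phi> v = Q v"
          using \<Phi>(2)[of "x0 v"] q(2) by (simp add: compose_eq \<phi>_def Pl(2) x0_def)
      qed simp
      ultimately show ?thesis using Q(2) by simp
    qed
  qed
  then show ?thesis unfolding poly_rank_def by (intro exI[of _ "Suc r"]) auto
qed

end
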